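(* Assume: $g\in C^1(\mathbb{R})$ with $\int_{\mathbb{R}}e^{-g(y)}\mathrm{d}y=1$; there is $\delta>0$ with $\mathbb{E}_{X\sim\pi_1}|g'(X)|^{2+\delta}<\infty$; for every $(y_0,y_0')\in\mathbb{R}^2$ the initial value problem $y''(t)=-g'(y(t))$, $y(0)=y_0$, $y'(0)=y_0'$ has a unique solution $a(t;y_0,y_0')$ defined for all $t\in\mathbb{R}$; $\mu$ is a probability distribution on $(0,\infty)$ with $\mathbb{E}_{\nu\sim\mu}[\nu^{1+\delta/2}]<\infty$; and for every $n$ and distinct $t_1,\dots,t_n$ the matrix $(V(t_j-t_i))_{i,j=1}^n$ is positive definite, where $$V(t)=\mathbb{E}\big[\nu\,g'(X)\,P\,g'\big(a(\sqrt{\nu}\,t;X,P)\big)\,a'(\sqrt{\nu}\,t;X,P)\big],$$ with $X\sim\pi_1$, $P\sim\mathsf{N}(0,1)$, $\nu\sim\mu$ independent and $a'$ the time derivative of $a$. Let $\nu_1,\nu_2,\dots\stackrel{iid}{\sim}\mu$. Then for almost every realisation of $(\nu_i)_{i\ge1}$ the following holds: for every $n\ge1$ and times $t_1,\dots,t_n$, as $d\to\infty$, $(D^{(d)}(t_1),\dots,D^{(d)}(t_n))$ converges in distribution to $\mathsf{N}(0,\Sigma)$ with $\Sigma_{ij}=V(t_j-t_i)$; that is, the finite-dimensional distributions of $D^{(d)}$ converge to those of a centred stationary Gaussian process with covariance function $V$.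
   Context: $\pi_\nu$ denotes the density $\pi_\nu(x)=\sqrt{\nu}\,e^{-g(\sqrt{\nu}x)}$ on $\mathbb{R}$ (so $\pi_1=e^{-g}$). For each $d$, given $\nu_1,\dots,\nu_d$, set $U^{(d)}(x)=\sum_{i=1}^d g(\sqrt{\nu_i}x_i)-\sum_{i=1}^d\tfrac12\log\nu_i$ for $x\in\mathbb{R}^d$, so that $e^{-U^{(d)}}=\prod_i\pi_{\nu_i}(x_i)$. Let $(X(t),P(t))_{t\in\mathbb{R}}$ be the exact Hamiltonian flow with identity mass matrix, $\mathrm{d}X/\mathrm{d}t=P$, $\mathrm{d}P/\mathrm{d}t=-\nabla U^{(d)}(X)$, started from $(X(0),P(0))$ with $X(0)\sim e^{-U^{(d)}}$ and $P(0)\sim\mathsf{N}(0,I_d)$ independent (componentwise, $X_i(t)=a(\sqrt{\nu_i}t;\sqrt{\nu_i}X_i(0),P_i(0))/\sqrt{\nu_i}$, $P_i(t)=a'(\sqrt{\nu_i}t;\sqrt{\nu_i}X_i(0),P_i(0))$). Define $D^{(d)}(t)=d^{-1/2}P(t)\cdot\nabla U^{(d)}(X(t))=d^{-1/2}\sum_{i=1}^d\sqrt{\nu_i}\,g'(\sqrt{\nu_i}X_i(t))\,P_i(t)$. *)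

theory Defs
  imports "HOL-Probability.Probability"
begin

definition pi_nu :: "(real \<Rightarrow> real) \<Rightarrow> real \<Rightarrow> real \<Rightarrow> real" where
  "pi_nu g \<nu> x = sqrt \<nu> * exp (- g (sqrt \<nu> * x))"

definition N01 :: "real measure" where
  "N01 = density lborel std_normal_density"

text \<open>The covariance function
  V(t) = E[ nu g'(X) P g'(a(sqrt nu t; X, P)) a'(sqrt nu t; X, P) ],
  X ~ pi_1, P ~ N(0,1), nu ~ mu independent; a' is the time derivative of a (given as ad).\<close>
definition Vfun :: "(real \<Rightarrow> real) \<Rightarrow> (real \<Rightarrow> real) \<Rightarrow> (real \<Rightarrow> real \<Rightarrow> real \<Rightarrow> real)
    \<Rightarrow> (real \<Rightarrow> real \<Rightarrow> real \<Rightarrow> real) \<Rightarrow> real measure \<Rightarrow> real \<Rightarrow> real" where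
  "Vfun g dg a ad \<mu> t =
     (\<integral>(x, p, \<nu>). \<nu> * dg x * p * dg (a (sqrt \<nu> * t) x p) * ad (sqrt \<nu> * t) x p
        \<partial>(density lborel (\<lambda>y. exp (- g y)) \<Otimes>\<^sub>M (N01 \<Otimes>\<^sub>M \<mu>)))"

definition init_law :: "(real \<Rightarrow> real) \<Rightarrow> (nat \<Rightarrow> real) \<Rightarrow> nat
    \<Rightarrow> ((nat \<Rightarrow> real) \<times> (nat \<Rightarrow> real)) measure" where
  "init_law g \<nu> d =
     (\<Pi>\<^sub>M i\<in>{..<d}. density lborel (pi_nu g (\<nu> i))) \<Otimes>\<^sub>M (\<Pi>\<^sub>M i\<in>{..<d}. N01)"

text \<open>Exact Hamiltonian flow, componentwise:
  X_i(t) = a(sqrt nu_i t; sqrt nu_i X_i(0), P_i(0)) / sqrt nu_i,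
  P_i(t) = a'(sqrt nu_i t; sqrt nu_i X_i(0), P_i(0)).\<close>
definition flowX :: "(real \<Rightarrow> real \<Rightarrow> real \<Rightarrow> real) \<Rightarrow> real \<Rightarrow> real \<Rightarrow> real \<Rightarrow> real \<Rightarrow> real" where
  "flowX a \<nu> t x p = a (sqrt \<nu> * t) (sqrt \<nu> * x) p / sqrt \<nu>"

definition flowP :: "(real \<Rightarrow> real \<Rightarrow> real \<Rightarrow> real) \<Rightarrow> real \<Rightarrow> real \<Rightarrow> real \<Rightarrow> real \<Rightarrow> real" where
  "flowP ad \<nu> t x p = ad (sqrt \<nu> * t) (sqrt \<nu> * x) p"

text \<open>D^(d)(t) = d^(-1/2) P(t) . grad U^(d)(X(t))
   = d^(-1/2) sum_(i<d) sqrt nu_i g'(sqrt nu_i X_i(t)) P_i(t), as a function of the initial state.\<close>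
definition Dd :: "(real \<Rightarrow> real) \<Rightarrow> (real \<Rightarrow> real \<Rightarrow> real \<Rightarrow> real) \<Rightarrow> (real \<Rightarrow> real \<Rightarrow> real \<Rightarrow> real)
    \<Rightarrow> (nat \<Rightarrow> real) \<Rightarrow> nat \<Rightarrow> real \<Rightarrow> (nat \<Rightarrow> real) \<times> (nat \<Rightarrow> real) \<Rightarrow> real" where
  "Dd dg a ad \<nu> d t z =
     (1 / sqrt (real d)) * (\<Sum>i<d. sqrt (\<nu> i) * dg (sqrt (\<nu> i) * flowX a (\<nu> i) t (fst z i) (snd z i))
                                   * flowP ad (\<nu> i) t (fst z i) (snd z i))"

text \<open>Vectors in R^n are encoded as functions nat => real that vanish from index n on
  (a closed subspace of the product space R^nat, homeomorphic to R^n).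
  The random vector (D^(d)(t_0), ..., D^(d)(t_(n-1))) as a function of the initial state:\<close>
definition Dvec :: "(real \<Rightarrow> real) \<Rightarrow> (real \<Rightarrow> real \<Rightarrow> real \<Rightarrow> real) \<Rightarrow> (real \<Rightarrow> real \<Rightarrow> real \<Rightarrow> real)
    \<Rightarrow> (nat \<Rightarrow> real) \<Rightarrow> nat \<Rightarrow> nat \<Rightarrow> (nat \<Rightarrow> real) \<Rightarrow> (nat \<Rightarrow> real) \<times> (nat \<Rightarrow> real) \<Rightarrow> nat \<Rightarrow> real" where
  "Dvec dg a ad \<nu> d n t z = (\<lambda>j. if j < n then Dd dg a ad \<nu> d (t j) z else 0)"

definition conv_in_distr :: "(nat \<Rightarrow> 'a::topological_space measure) \<Rightarrow> 'a measure \<Rightarrow> bool" where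
  "conv_in_distr M N \<longleftrightarrow>
     (\<forall>f :: 'a \<Rightarrow> real. continuous_on UNIV f \<and> bounded (range f) \<longrightarrow>
        (\<lambda>k. \<integral>x. f x \<partial>M k) \<longlonglongrightarrow> (\<integral>x. f x \<partial>N))"

definition centred_gaussian :: "nat \<Rightarrow> (nat \<Rightarrow> nat \<Rightarrow> real) \<Rightarrow> (nat \<Rightarrow> real) measure \<Rightarrow> bool" where
  "centred_gaussian n S N \<longleftrightarrow>
     prob_space N \<and> sets N = sets borel \<and> (AE x in N. \<forall>i\<ge>n. x i = 0) \<and>
     (\<forall>u :: nat \<Rightarrow> real.
        (\<integral>x. cis (\<Sum>j<n. u j * x j) \<partial>N) =
        complex_of_real (exp (- (\<Sum>i<n. \<Sum>j<n. u i * S i j * u j) / 2)))"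

end

theory Submission
  imports Defs "HOL-Complex_Analysis.Great_Picard" "HOL-Real_Asymp.Real_Asymp"
begin

text \<open>
  Given the sequence of the \<nu>'s, the vector of the D(t_j) is a normalised sum of independent random
  vectors, so its characteristic function is a product which the Lindeberg method compares with
  a Gaussian one; a multivariate continuity theorem then gives weak convergence.

  The central point is stationarity: the law of (X, P) is invariant under the flow y'' = - g'(y)
  although g' is merely continuous.  Each step of the symplectic Euler scheme is a composition of
  two shears and preserves Lebesgue measure; by compactness and uniqueness of solutions the scheme
  converges to the flow; Fatou's lemma and invertibility of the flow yield Liouville's
  theorem, and conservation of energy gives invariance of the Gibbs measure.

  By stationarity the variance of the d-th sum is an average over i < d of functions
  \<nu>_i c(sqrt \<nu>_i s) with c continuous and bounded, which the strong law of large numbers handles for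
  all rational s, and equicontinuity for all s simultaneously; second moments suffice for the
  Lindeberg condition because, by stationarity again, it is uniform in the times.
\<close>

section \<open>Centred Gaussian measures\<close>

text \<open>The obstacle is that \<open>dg\<close> is only continuous: the flow need not be
  differentiable in its initial state, so no Jacobian is available for Liouville's theorem.
  Uniqueness of solutions takes its place by identifying every limit of the Euler scheme. The same
  limit makes the flow measurable jointly in time and state, which is needed because the time sqrt
  \<nu> * t is random under \<mu>. The exponent 1 + \<delta> / 2 enters through the law of large
  numbers: being larger than 1, it makes the Borel-Cantelli series converge after truncation. That
  law is applied to countably many functions of \<nu>. Beyond the averages of covariances it yields
  max_{i<d} \<nu>_i = o(d), since the averages of the \<nu>_i converge, so that no coordinate
  dominates the sum. From there on \<nu> is a fixed sequence. The Gaussian law is built from a Gram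
  factorisation of its covariance matrix. The nonnegativity which this uses is obtained as a limit
  of averages of variances.\<close>

lemma psd_gram:
  fixes S :: "nat \<Rightarrow> nat \<Rightarrow> real"
  assumes sym: "\<And>i j. i < n \<Longrightarrow> j < n \<Longrightarrow> S i j = S j i"
    and psd: "\<And>u. 0 \<le> (\<Sum>i<n. \<Sum>j<n. u i * S i j * u j)"
  obtains L where "\<And>i j. i < n \<Longrightarrow> j < n \<Longrightarrow> S i j = (\<Sum>k<n. L k i * L k j)"
proof -
  \<comment> \<open>Induction on n, eliminating the last index by a Schur complement. Degenerate
    forms are covered, since the pivot s may vanish.\<close>
  have "\<exists>L. \<forall>i<n. \<forall>j<n. S i j = (\<Sum>k<n. L k i * L k j)"
    using assms
  proof (induction n arbitrary: S)
    case 0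
    then show ?case by simp
  next
    case (Suc n)
    define s where "s = S n n"
    have quad: "(\<Sum>i<Suc n. \<Sum>j<Suc n. v i * S i j * v j) =
        (\<Sum>i<n. \<Sum>j<n. v i * S i j * v j) + 2 * v n * (\<Sum>i<n. v i * S i n) + (v n)\<^sup>2 * s" for v
    proof -
      have "(\<Sum>j<n. v n * S n j * v j) = v n * (\<Sum>i<n. v i * S i n)"
        unfolding sum_distrib_left by (intro sum.cong) (auto simp: Suc.prems(1)[of n])
      moreover have "(\<Sum>i<n. v i * S i n * v n) = v n * (\<Sum>i<n. v i * S i n)"
        unfolding sum_distrib_left by (intro sum.cong) auto
      ultimately show ?thesis
        by (simp add: sum.distrib s_def power2_eq_square algebra_simps)
    qed
    have s0: "0 \<le> s"
      using Suc.prems(2)[of "\<lambda>i. if i = n then 1 else 0"] unfolding quad by simp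
    \<comment> \<open>A vanishing diagonal entry kills its column: otherwise the vector with 1 at i
      and c at n would give the form the value S i i + 2 * c * S i n, and c is chosen to make this
      -1.\<close>
    have zero: "S i n = 0" if "s = 0" "i < n" for i
    proof (rule ccontr)
      assume nz: "S i n \<noteq> 0"
      define c where "c = - (S i i + 1) / (2 * S i n)"
      define v where "v = (\<lambda>k. if k = i then 1 else if k = n then c else 0)"
      have vi: "(\<Sum>k<n. v k * f k) = f i" for f
      proof -
        have "(\<Sum>k<n. v k * f k) = (\<Sum>k<n. if k = i then f k else 0)"
          by (intro sum.cong) (auto simp: v_def)
        then show ?thesis using that by simp
      qed
      have "(\<Sum>k<n. \<Sum>j<n. v k * S k j * v j) = (\<Sum>k<n. v k * (\<Sum>j<n. v j * S k j))"
        unfolding sum_distrib_left by (intro sum.cong) auto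
      also have "\<dots> = S i i" by (simp add: vi)
      finally have "0 \<le> S i i + 2 * c * S i n"
        using Suc.prems(2)[of v] unfolding quad vi using that by (simp add: v_def)
      also have "\<dots> = -1" using nz by (simp add: c_def field_simps)
      finally show False by simp
    qed
    \<comment> \<open>The Schur complement. Below, v at n takes the value minimising the form in
      that coordinate, so the form of S at v is the form of S' at u. For s = 0 all quotients are 0,
      consistently with \<open>zero\<close>.\<close>
    define S' where "S' i j = S i j - S i n * S j n / s" for i j
    have "\<exists>L. \<forall>i<n. \<forall>j<n. S' i j = (\<Sum>k<n. L k i * L k j)"
    proof (rule Suc.IH)
      show "S' i j = S' j i" if "i < n" "j < n" for i j
        using Suc.prems(1)[of i j] that by (simp add: S'_def)
      show "0 \<le> (\<Sum>i<n. \<Sum>j<n. u i * S' i j * u j)" for u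
      proof -
        define b where "b = (\<Sum>i<n. u i * S i n)"
        define v where "v = u(n := - b / s)"
        have "0 \<le> (\<Sum>i<n. \<Sum>j<n. v i * S i j * v j) + 2 * v n * (\<Sum>i<n. v i * S i n) + (v n)\<^sup>2 * s"
          using Suc.prems(2)[of v] unfolding quad .
        also have "\<dots> = (\<Sum>i<n. \<Sum>j<n. u i * S i j * u j) - b * b / s"
          by (simp add: v_def b_def power2_eq_square)
        also have "b * b / s = (\<Sum>i<n. \<Sum>j<n. u i * (S i n * S j n / s) * u j)"
          unfolding b_def sum_product sum_divide_distrib by (intro sum.cong) auto
        also have "(\<Sum>i<n. \<Sum>j<n. u i * S i j * u j) - \<dots> = (\<Sum>i<n. \<Sum>j<n. u i * S' i j * u j)"
          unfolding sum_subtractf[symmetric] S'_def by (intro sum.cong) (auto simp: algebra_simps)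
        finally show ?thesis .
      qed
    qed
    then obtain L where L: "\<And>i j. i < n \<Longrightarrow> j < n \<Longrightarrow> S' i j = (\<Sum>k<n. L k i * L k j)"
      by blast
    define L' where "L' k i = (if k < n then (if i < n then L k i else 0) else S i n / sqrt s)" for k i
    have prod_s: "S i n / sqrt s * (S j n / sqrt s) = S i n * S j n / s" for i j
      using s0 by simp
    have "S i j = (\<Sum>k<Suc n. L' k i * L' k j)" if "i < Suc n" "j < Suc n" for i j
    proof -
      have "(\<Sum>k<Suc n. L' k i * L' k j) =
          (\<Sum>k<n. (if i < n then L k i else 0) * (if j < n then L k j else 0)) + S i n * S j n / s"
        by (simp add: L'_def prod_s abs_of_nonneg[OF s0])
      also have "\<dots> = S i j"
      proof (cases "i < n \<and> j < n")
        case True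
        then show ?thesis using L[of i j] by (simp add: S'_def)
      next
        case False
        then have "i = n \<or> j = n" using that by auto
        then show ?thesis
          using Suc.prems(1)[of n j] that zero[of i] zero[of j] by (auto simp: s_def less_Suc_eq)
      qed
      finally show ?thesis by simp
    qed
    then show ?case by blast
  qed
  then show ?thesis using that by blast
qed

text \<open>The index set is countable, so the Borel sets of the product topology form the product
  sigma-algebra and measurability can be tested coordinatewise.\<close>

lemma borel_measurable_fun_iff:
  fixes f :: "'a \<Rightarrow> nat \<Rightarrow> real"
  shows "f \<in> borel_measurable M \<longleftrightarrow> (\<forall>i. (\<lambda>x. f x i) \<in> borel_measurable M)"
proof
  assume "f \<in> borel_measurable M"
  then have "f \<in> measurable M (\<Pi>\<^sub>M i\<in>UNIV. borel)"
    using measurable_cong_sets[OF refl sets_PiM_equal_borel] by blast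
  then show "\<forall>i. (\<lambda>x. f x i) \<in> borel_measurable M"
    by (auto dest: measurable_PiM_component_rev simp: )
next
  assume "\<forall>i. (\<lambda>x. f x i) \<in> borel_measurable M"
  then have "f \<in> measurable M (\<Pi>\<^sub>M i\<in>UNIV. borel)"
    by (intro measurable_PiM_single') auto
  then show "f \<in> borel_measurable M"
    using measurable_cong_sets[OF refl sets_PiM_equal_borel] by blast
qed

lemma borel_measurable_coord:
  "(\<lambda>x. x i) \<in> borel_measurable (borel :: (nat \<Rightarrow> real) measure)"
  by (rule borel_measurable_continuous_onI) simp

lemma N01_sets [measurable_cong, simp]: "sets N01 = sets borel"
  by (simp add: N01_def)

lemma prob_space_N01: "prob_space N01"
  unfolding N01_def by (rule prob_space_normal_density) simp

lemma integral_cis_N01: "(\<integral>x. cis (w * x) \<partial>N01) = of_real (exp (- w\<^sup>2 / 2))"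
  using fun_cong[OF char_std_normal_distribution, of w]
  by (simp add: char_def N01_def cis_conv_exp mult_ac)

lemma cis_sum: "finite A \<Longrightarrow> cis (sum f A) = (\<Prod>i\<in>A. cis (f i))"
  by (induction A rule: finite_induct) (auto simp: cis_mult[symmetric])

lemma borel_measurable_cis [measurable (raw)]:
  "f \<in> borel_measurable M \<Longrightarrow> (\<lambda>x. cis (f x)) \<in> borel_measurable M"
  using borel_measurable_continuous_on[of cis f M] by (simp add: continuous_on_cis)

text \<open>The law is the image of n independent standard normals under the transpose of the Gram
  factor L, padded with zeros from index n on.\<close>

lemma centred_gaussian_exists:
  assumes sym: "\<And>i j. i < n \<Longrightarrow> j < n \<Longrightarrow> S i j = S j i"
    and psd: "\<And>u. 0 \<le> (\<Sum>i<n. \<Sum>j<n. u i * S i j * u j)"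
  obtains N where "centred_gaussian n S N"
proof -
  obtain L where L: "\<And>i j. i < n \<Longrightarrow> j < n \<Longrightarrow> S i j = (\<Sum>k<n. L k i * L k j)"
    using psd_gram[OF sym psd] by blast
  define P where "P = (\<Pi>\<^sub>M i\<in>{..<n}. N01)"
  interpret N01: prob_space N01 by (rule prob_space_N01)
  interpret product_sigma_finite "\<lambda>_::nat. N01" by standard
  interpret P: prob_space P unfolding P_def by (intro prob_space_PiM prob_space_N01)
  define F where "F x i = (if i < n then \<Sum>k<n. L k i * x k else 0)" for x :: "nat \<Rightarrow> real" and i
  have coord: "(\<lambda>x. x k) \<in> borel_measurable P" if "k < n" for k
    using measurable_component_singleton[of k "{..<n}" "\<lambda>_. N01"] that
    by (simp add: P_def measurable_cong_sets[OF refl N01_sets])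
  have F [measurable]: "F \<in> borel_measurable P"
    unfolding borel_measurable_fun_iff
  proof
    fix i
    show "(\<lambda>x. F x i) \<in> borel_measurable P"
      unfolding F_def
      by (cases "i < n") (auto intro!: borel_measurable_sum borel_measurable_times coord)
  qed
  have "centred_gaussian n S (distr P borel F)"
    unfolding centred_gaussian_def
  proof (intro conjI allI)
    show "prob_space (distr P borel F)" by (rule P.prob_space_distr) simp
    show "AE x in distr P borel F. \<forall>i\<ge>n. x i = 0"
      by (subst AE_distr_iff) (auto simp: F_def)
    fix u :: "nat \<Rightarrow> real"
    define w where "w k = (\<Sum>j<n. u j * L k j)" for k
    have "(\<integral>x. cis (\<Sum>j<n. u j * x j) \<partial>distr P borel F) = (\<integral>x. cis (\<Sum>j<n. u j * F x j) \<partial>P)"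
      by (rule integral_distr[OF F])
        (intro borel_measurable_cis borel_measurable_sum borel_measurable_times
          borel_measurable_coord borel_measurable_const)
    also have "\<dots> = (\<integral>x. (\<Prod>k<n. cis (w k * x k)) \<partial>P)"
    proof (intro Bochner_Integration.integral_cong refl)
      fix x
      have "(\<Sum>j<n. u j * F x j) = (\<Sum>k<n. w k * x k)"
        by (simp add: F_def w_def sum_distrib_left sum_distrib_right mult_ac) (rule sum.swap)
      then show "cis (\<Sum>j<n. u j * F x j) = (\<Prod>k<n. cis (w k * x k))" by (simp add: cis_sum)
    qed
    also have "\<dots> = (\<Prod>k<n. \<integral>x. cis (w k * x) \<partial>N01)"
      unfolding P_def
    proof (rule product_integral_prod)
      show "integrable N01 (\<lambda>x. cis (w k * x))" for k
        by (rule N01.integrable_const_bound[of _ 1], simp, measurable)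
    qed simp
    also have "\<dots> = of_real (exp (- (\<Sum>k<n. (w k)\<^sup>2) / 2))"
      by (simp add: integral_cis_N01 exp_sum sum_divide_distrib flip: of_real_prod sum_negf)
    also have "(\<Sum>k<n. (w k)\<^sup>2) = (\<Sum>i<n. \<Sum>j<n. u i * S i j * u j)"
    proof -
      have "(\<Sum>i<n. \<Sum>j<n. u i * S i j * u j) = (\<Sum>i<n. \<Sum>j<n. \<Sum>k<n. (u i * L k i) * (u j * L k j))"
        by (intro sum.cong refl) (simp add: L sum_distrib_left sum_distrib_right mult_ac)
      also have "\<dots> = (\<Sum>i<n. \<Sum>k<n. \<Sum>j<n. (u i * L k i) * (u j * L k j))"
        by (rule sum.cong[OF refl]) (rule sum.swap)
      also have "\<dots> = (\<Sum>k<n. \<Sum>i<n. \<Sum>j<n. (u i * L k i) * (u j * L k j))"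
        by (rule sum.swap)
      also have "\<dots> = (\<Sum>k<n. (w k)\<^sup>2)"
        by (simp add: w_def power2_eq_square sum_product)
      finally show ?thesis by simp
    qed
    finally show "(\<integral>x. cis (\<Sum>j<n. u j * x j) \<partial>distr P borel F) =
        of_real (exp (- (\<Sum>i<n. \<Sum>j<n. u i * S i j * u j) / 2))" .
  qed simp
  then show ?thesis by (rule that)
qed

section \<open>Multivariate continuity theorem\<close>

text \<open>The phase b makes sines and constants special cases and closes the class under products,
  by the product-to-sum formula. The integral of each generator is a real part of a rotated
  characteristic function.\<close>

inductive trig_poly :: "nat \<Rightarrow> ((nat \<Rightarrow> real) \<Rightarrow> real) \<Rightarrow> bool" for n where
  cos: "trig_poly n (\<lambda>x. c * cos ((\<Sum>j<n. u j * x j) + b))"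
| add: "trig_poly n f \<Longrightarrow> trig_poly n h \<Longrightarrow> trig_poly n (\<lambda>x. f x + h x)"

lemma trig_poly_const: "trig_poly n (\<lambda>_. c)"
  using trig_poly.cos[of n c "\<lambda>_. 0" 0] by simp

lemma trig_poly_sin: "j < n \<Longrightarrow> trig_poly n (\<lambda>x. sin (w * x j))"
  using trig_poly.cos[of n 1 "\<lambda>i. if i = j then w else 0" "- pi / 2"]
  by (simp add: cos_diff if_distrib[of "\<lambda>y. y * _"] cong: if_cong)

lemma trig_poly_mult:
  assumes "trig_poly n f" "trig_poly n h"
  shows "trig_poly n (\<lambda>x. f x * h x)"
  using assms(1)
proof induction
  case (cos c u b)
  note outer = cos
  show ?case
    using assms(2)
  proof induction
    case (cos c' u' b')
    have "c * cos ((\<Sum>j<n. u j * x j) + b) * (c' * cos ((\<Sum>j<n. u' j * x j) + b')) =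
        c * c' / 2 * cos ((\<Sum>j<n. (u j - u' j) * x j) + (b - b'))
        + c * c' / 2 * cos ((\<Sum>j<n. (u j + u' j) * x j) + (b + b'))" for x :: "nat \<Rightarrow> real"
    proof -
      define A B where "A = (\<Sum>j<n. u j * x j) + b" and "B = (\<Sum>j<n. u' j * x j) + b'"
      have e1: "(\<Sum>j<n. (u j - u' j) * x j) + (b - b') = A - B"
        and e2: "(\<Sum>j<n. (u j + u' j) * x j) + (b + b') = A + B"
        by (auto simp: A_def B_def algebra_simps sum.distrib sum_subtractf)
      show ?thesis
        unfolding e1 e2 A_def[symmetric] B_def[symmetric] by (simp add: cos_add cos_diff algebra_simps)
    qed
    then show ?case
      by (simp only:) (rule trig_poly.add[OF trig_poly.cos trig_poly.cos])
  next
    case (add f h)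
    then show ?case
      by (auto simp: algebra_simps intro: trig_poly.add)
  qed
next
  case (add f h)
  then show ?case
    by (auto simp: algebra_simps intro: trig_poly.add)
qed

lemma borel_measurable_linear_fun [measurable]:
  "(\<lambda>x. \<Sum>j<n. u j * x j) \<in> borel_measurable (borel :: (nat \<Rightarrow> real) measure)"
  by (intro borel_measurable_sum borel_measurable_times borel_measurable_coord) simp

lemma trig_poly_measurable_bounded:
  assumes "trig_poly n f"
  shows "f \<in> borel_measurable borel \<and> (\<exists>B. \<forall>x. \<bar>f x\<bar> \<le> B)"
  using assms
proof induction
  case (cos c u b)
  have "\<bar>c * cos ((\<Sum>j<n. u j * x j) + b)\<bar> \<le> \<bar>c\<bar>" for x :: "nat \<Rightarrow> real"
    by (simp add: abs_mult mult_left_le)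
  moreover have "(\<lambda>x. c * cos ((\<Sum>j<n. u j * x j) + b)) \<in> borel_measurable borel" by measurable
  ultimately show ?case by blast
next
  case (add f h)
  then obtain B C where "\<And>x. \<bar>f x\<bar> \<le> B" "\<And>x. \<bar>h x\<bar> \<le> C" by auto
  then have "\<bar>f x + h x\<bar> \<le> B + C" for x
    using abs_triangle_ineq[of "f x" "h x"] by (smt (verit))
  with add show ?case by auto
qed

lemma trig_poly_integrable:
  assumes "trig_poly n f" "prob_space M" "sets M = sets borel"
  shows "integrable M f"
proof -
  interpret prob_space M by fact
  obtain B where "\<And>x. \<bar>f x\<bar> \<le> B" and "f \<in> borel_measurable borel"
    using trig_poly_measurable_bounded[OF assms(1)] by blast
  then show ?thesis
    by (intro integrable_const_bound[of _ B])
      (auto simp: measurable_cong_sets[OF assms(3) refl])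
qed

lemma trig_poly_integral_tendsto:
  fixes M :: "nat \<Rightarrow> (nat \<Rightarrow> real) measure"
  assumes "trig_poly n f"
    and M: "\<And>k. prob_space (M k)" "\<And>k. sets (M k) = sets borel"
    and N: "prob_space N" "sets N = sets borel"
    and conv: "\<And>u :: nat \<Rightarrow> real. (\<lambda>k. \<integral>x. cis (\<Sum>j<n. u j * x j) \<partial>M k)
       \<longlonglongrightarrow> (\<integral>x. cis (\<Sum>j<n. u j * x j) \<partial>N)"
  shows "(\<lambda>k. \<integral>x. f x \<partial>M k) \<longlonglongrightarrow> (\<integral>x. f x \<partial>N)"
  using assms(1)
proof induction
  case (cos c u b)
  have *: "(\<integral>x. c * cos ((\<Sum>j<n. u j * x j) + b) \<partial>P) =
      c * Re (cis b * (\<integral>x. cis (\<Sum>j<n. u j * x j) \<partial>P))"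
    if "prob_space P" "sets P = sets borel" for P
  proof -
    interpret prob_space P by fact
    note [measurable_cong] = that(2)
    have "integrable P (\<lambda>x. cis b * cis (\<Sum>j<n. u j * x j))"
      by (intro integrable_const_bound[of _ 1]) (auto simp: norm_mult)
    then have "(\<integral>x. Re (cis b * cis (\<Sum>j<n. u j * x j)) \<partial>P) =
        Re (\<integral>x. cis b * cis (\<Sum>j<n. u j * x j) \<partial>P)"
      by (rule integral_Re)
    moreover have "Re (cis b * cis r) = cos (r + b)" for r
      by (simp only: cis_mult cis.simps add.commute)
    ultimately show ?thesis by simp
  qed
  show ?case
    unfolding *[OF M] *[OF N] by (intro tendsto_intros conv)
next
  case (add f h)
  then show ?case
    using trig_poly_integrable[OF _ M] trig_poly_integrable[OF _ N]
    by (simp add: tendsto_add)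
qed

text \<open>Tychonoff's theorem. With the coordinates from n on pinned to 0, this is the unit cube
  of R^n in the encoding by functions.\<close>

lemma compact_box_fun:
  fixes n :: nat
  shows "compact {y :: nat \<Rightarrow> real. (\<forall>j<n. \<bar>y j\<bar> \<le> 1) \<and> (\<forall>j\<ge>n. y j = 0)}"
proof -
  have "compactin (product_topology (\<lambda>_::nat. euclideanreal) UNIV)
      (PiE UNIV (\<lambda>j. if j < n then {-1..1} else {0}))"
    by (subst compactin_PiE) (auto simp: compactin_euclidean_iff)
  moreover have "PiE UNIV (\<lambda>j. if j < n then {-1..1} else {0}) =
      {y :: nat \<Rightarrow> real. (\<forall>j<n. \<bar>y j\<bar> \<le> 1) \<and> (\<forall>j\<ge>n. y j = 0)}"
  proof -
    have "y j \<in> (if j < n then {-1..1} else {0}) \<longleftrightarrow>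
        (j < n \<longrightarrow> \<bar>y j\<bar> \<le> 1) \<and> (n \<le> j \<longrightarrow> y j = 0)" for y :: "nat \<Rightarrow> real" and j
      by (auto simp: abs_le_iff)
    then show ?thesis
      unfolding PiE_UNIV_domain Pi_def by auto
  qed
  ultimately show ?thesis
    by (simp add: euclidean_product_topology compactin_euclidean_iff)
qed

text \<open>
  Away from a large box the masses are controlled by the one-dimensional continuity theorem.
  On the box, a continuous function of x agrees with a continuous function of the numbers
  sin (pi x_j / (2 K)), which by Stone-Weierstrass is a uniform limit, on the whole space, of
  trigonometric polynomials.
\<close>

theorem multidim_levy_continuity:
  fixes M :: "nat \<Rightarrow> (nat \<Rightarrow> real) measure"
  assumes M: "\<And>k. prob_space (M k)" "\<And>k. sets (M k) = sets borel"
      "\<And>k. AE x in M k. \<forall>i\<ge>n. x i = 0"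
    and N: "prob_space N" "sets N = sets borel" "AE x in N. \<forall>i\<ge>n. x i = 0"
    and conv: "\<And>u :: nat \<Rightarrow> real. (\<lambda>k. \<integral>x. cis (\<Sum>j<n. u j * x j) \<partial>M k)
       \<longlonglongrightarrow> (\<integral>x. cis (\<Sum>j<n. u j * x j) \<partial>N)"
  shows "conv_in_distr M N"
  unfolding conv_in_distr_def
proof (intro allI impI)
  fix f :: "(nat \<Rightarrow> real) \<Rightarrow> real"
  assume "continuous_on UNIV f \<and> bounded (range f)"
  then obtain B where cont: "continuous_on UNIV f" and B: "\<And>x. \<bar>f x\<bar> \<le> B"
    by (auto simp: bounded_iff)
  then have B0: "0 \<le> B" by (meson abs_ge_zero order_trans)
  note [measurable_cong] = M(2) N(2)
  interpret M: prob_space "M k" for k by (rule M)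
  interpret N: prob_space N by (rule N)
  have [measurable]: "f \<in> borel_measurable borel"
    using cont by (rule borel_measurable_continuous_onI)

  \<comment> \<open>A continuous cutoff: 0 on [-m, m] and 1 outside [-(m+1), m+1]. Continuity makes
    its integrals converge with the marginals, and its sum over the coordinates dominates the
    indicator of leaving the box of half-width K = m + 1.\<close>
  define \<phi> :: "nat \<Rightarrow> real \<Rightarrow> real" where "\<phi> m y = min 1 (max 0 (\<bar>y\<bar> - real m))" for m y
  have \<phi>_meas [measurable]: "\<phi> m \<in> borel_measurable borel" for m
    unfolding \<phi>_def by measurable
  have \<phi>_coord [measurable]: "(\<lambda>x :: nat \<Rightarrow> real. \<phi> m (x j)) \<in> borel_measurable borel" for m j
    by (rule measurable_compose[OF borel_measurable_coord \<phi>_meas])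
  have \<phi>_bd: "0 \<le> \<phi> m y" "\<phi> m y \<le> 1" for m y by (auto simp: \<phi>_def)
  have weak: "(\<lambda>k. \<integral>x. \<phi> m (x j) \<partial>M k) \<longlonglongrightarrow> (\<integral>x. \<phi> m (x j) \<partial>N)" if j: "j < n" for m j
  proof -
    have dM: "real_distribution (distr (M k) borel (\<lambda>x. x j))" for k
      by (rule M.real_distribution_distr) (simp add: measurable_cong_sets[OF M(2) refl] measurable_cong_sets[OF N(2) refl] borel_measurable_coord)
    have dN: "real_distribution (distr N borel (\<lambda>x. x j))"
      by (rule N.real_distribution_distr) (simp add: measurable_cong_sets[OF M(2) refl] measurable_cong_sets[OF N(2) refl] borel_measurable_coord)
    have char: "char (distr P borel (\<lambda>x. x j)) t =
        (\<integral>x. cis (\<Sum>i<n. (if i = j then t else 0) * x i) \<partial>P)"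
      if [measurable_cong]: "sets P = sets borel" for P t
      unfolding char_def using j borel_measurable_coord[of j]
      by (subst integral_distr) (auto simp: cis_conv_exp if_distrib[of "\<lambda>y. y * _"] cong: if_cong)
    have "weak_conv_m (\<lambda>k. distr (M k) borel (\<lambda>x. x j)) (distr N borel (\<lambda>x. x j))"
      by (rule levy_continuity[OF dM dN]) (simp only: char[OF M(2)] char[OF N(2)] conv)
    then have "(\<lambda>k. \<integral>y. \<phi> m y \<partial>distr (M k) borel (\<lambda>x. x j)) \<longlonglongrightarrow>
        (\<integral>y. \<phi> m y \<partial>distr N borel (\<lambda>x. x j))"
      by (rule weak_conv_imp_integral_bdd_continuous_conv[OF dM dN, where B = 1])
        (auto simp: \<phi>_def intro!: continuous_intros continuous_min continuous_max)
    then show ?thesis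
      using borel_measurable_coord[of j]
      by (simp add: integral_distr measurable_cong_sets[OF M(2) refl] measurable_cong_sets[OF N(2) refl])
  qed
  define p where "p P m = (\<integral>x. (\<Sum>j<n. \<phi> m (x j)) \<partial>P)" for P :: "(nat \<Rightarrow> real) measure" and m
  have int_\<phi>: "integrable P (\<lambda>x. \<phi> m (x j))" if "prob_space P" "sets P = sets borel" for P m j
  proof -
    interpret prob_space P by fact
    note [measurable_cong] = that(2)
    show ?thesis
      by (rule integrable_const_bound[of _ 1], simp add: \<phi>_bd, measurable)
  qed
  have p_conv: "(\<lambda>k. p (M k) m) \<longlonglongrightarrow> p N m" for m
    unfolding p_def using int_\<phi>[OF M(1,2)] int_\<phi>[OF N(1,2)] weak
    by (simp only: Bochner_Integration.integral_sum) (intro tendsto_sum, auto)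
  have p_lim: "(\<lambda>m. p N m) \<longlonglongrightarrow> 0"
  proof -
    have "(\<lambda>m. p N m) \<longlonglongrightarrow> (\<integral>x. 0 \<partial>N)"
      unfolding p_def
    proof (rule integral_dominated_convergence[where w = "\<lambda>_. real n"])
      show "AE x in N. (\<lambda>m. \<Sum>j<n. \<phi> m (x j)) \<longlonglongrightarrow> 0"
      proof (rule AE_I2, rule tendsto_null_sum)
        fix x :: "nat \<Rightarrow> real" and j
        obtain m0 where "\<bar>x j\<bar> \<le> real m0" using real_arch_simple by blast
        then have "\<forall>\<^sub>F m in sequentially. \<phi> m (x j) = 0"
          unfolding eventually_sequentially \<phi>_def by (intro exI[of _ m0]) auto
        then show "(\<lambda>m. \<phi> m (x j)) \<longlonglongrightarrow> 0" by (rule tendsto_eventually)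
      qed
      show "AE x in N. norm (\<Sum>j<n. \<phi> m (x j)) \<le> real n" for m
      proof (rule AE_I2)
        fix x :: "nat \<Rightarrow> real"
        have "(\<Sum>j<n. \<phi> m (x j)) \<le> (\<Sum>j<n. 1)" by (intro sum_mono \<phi>_bd)
        moreover have "0 \<le> (\<Sum>j<n. \<phi> m (x j))" by (intro sum_nonneg \<phi>_bd)
        ultimately show "norm (\<Sum>j<n. \<phi> m (x j)) \<le> real n" by simp
      qed
    qed auto
    then show ?thesis by simp
  qed

  show "(\<lambda>k. \<integral>x. f x \<partial>M k) \<longlonglongrightarrow> (\<integral>x. f x \<partial>N)"
  proof (rule LIMSEQ_I)
    fix e :: real assume "0 < e"
    \<comment> \<open>The total error is below 4 * B * \<eta> + 3 * \<eta>: at most 2 * B * \<eta> +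
      \<eta> for replacing f by T under each of the two measures, and \<eta> for the integrals of
      T.\<close>
    define \<eta> where "\<eta> = e / (4 * B + 4)"
    have \<eta>: "0 < \<eta>" using \<open>0 < e\<close> B0 by (simp add: \<eta>_def)
    obtain m where m: "p N m < \<eta>"
      using order_tendstoD(2)[OF p_lim \<eta>] unfolding eventually_sequentially by blast
    define K where "K = real m + 1"
    have K: "K > 0" by (simp add: K_def)
    \<comment> \<open>This frequency maps [-K, K] onto [-pi / 2, pi / 2], where the sine is inverted
      by \<open>arcsin\<close>; hence \<open>\<tau>\<close> inverts \<open>s\<close> on the
      box.\<close>
    define w where "w = pi / (2 * K)"
    have w: "w > 0" using K by (simp add: w_def)
    define Q where "Q = {y :: nat \<Rightarrow> real. (\<forall>j<n. \<bar>y j\<bar> \<le> 1) \<and> (\<forall>j\<ge>n. y j = 0)}"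
    define s where "s x = (\<lambda>j. if j < n then sin (w * x j) else 0)" for x :: "nat \<Rightarrow> real"
    have sQ: "s x \<in> Q" for x by (simp add: s_def Q_def)
    have [measurable]: "s \<in> borel_measurable borel"
      unfolding borel_measurable_fun_iff s_def
      by (auto intro!: measurable_compose[OF borel_measurable_coord])
    define \<tau> where "\<tau> y = (\<lambda>j. if j < n then arcsin (y j) / w else 0)" for y :: "nat \<Rightarrow> real"
    define F where "F y = f (\<tau> y)" for y
    have \<tau>_cont: "continuous_on Q \<tau>"
    proof (rule continuous_on_coordinatewise_then_product)
      fix j
      show "continuous_on Q (\<lambda>y. \<tau> y j)"
      proof (cases "j < n")
        case True
        have "continuous_on Q (\<lambda>y. y j)"
          by (rule continuous_on_subset[OF continuous_on_product_coordinates]) simp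
        moreover have "\<forall>y\<in>Q. - 1 \<le> y j \<and> y j \<le> 1"
          using True by (auto simp: Q_def abs_le_iff)
        ultimately show ?thesis
          using True w by (auto simp: \<tau>_def intro!: continuous_intros continuous_on_arcsin)
      qed (simp add: \<tau>_def)
    qed
    have F_cont: "continuous_on Q F"
      unfolding F_def by (rule continuous_on_compose2[OF cont \<tau>_cont]) auto
    \<comment> \<open>The algebra for Stone-Weierstrass is chosen through its pull-back along
      \<open>s\<close>: an approximation on Q then becomes a trigonometric polynomial on the whole
      space. The coordinates lie in it and separate points.\<close>
    define R where "R = {G. continuous_on Q G \<and> trig_poly n (\<lambda>x. G (s x))}"
    have "function_ring_on R Q"
    proof
      show "compact Q" unfolding Q_def by (rule compact_box_fun)
      show "(\<lambda>x. c) \<in> R" for c by (auto simp: R_def intro: trig_poly_const)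
      show "\<exists>G\<in>R. G y \<noteq> G z" if "y \<in> Q" "z \<in> Q" "y \<noteq> z" for y z
      proof -
        from \<open>y \<noteq> z\<close> obtain j where j: "y j \<noteq> z j" by auto
        then have "j < n" using that by (cases "j < n") (auto simp: Q_def)
        then have "(\<lambda>y. y j) \<in> R"
          using trig_poly_sin[of j n w]
            continuous_on_subset[OF continuous_on_product_coordinates, of Q j]
          by (simp add: R_def s_def)
        then show ?thesis by (rule bexI[rotated]) (rule j)
      qed
    qed (auto simp: R_def intro: continuous_intros trig_poly.add trig_poly_mult)
    then interpret function_ring_on R Q .
    obtain G where G: "G \<in> R" "\<And>y. y \<in> Q \<Longrightarrow> \<bar>F y - G y\<bar> < \<eta>"
      using Stone_Weierstrass_basic[OF F_cont \<eta>] by blast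
    define T where "T x = G (s x)" for x
    have T: "trig_poly n T" using G(1) by (simp add: R_def T_def[abs_def])
    have Tmeas [measurable]: "T \<in> borel_measurable borel"
      using trig_poly_measurable_bounded[OF T] by blast
    have main: "\<bar>f x - T x\<bar> \<le> 2 * B * (\<Sum>j<n. \<phi> m (x j)) + \<eta>" if x: "\<forall>i\<ge>n. x i = 0" for x
    proof -
      have FT: "\<bar>F (s x) - T x\<bar> < \<eta>" unfolding T_def by (intro G sQ)
      have "\<bar>f x - F (s x)\<bar> \<le> 2 * B * (\<Sum>j<n. \<phi> m (x j))"
      proof (cases "\<forall>j<n. \<bar>x j\<bar> \<le> K")
        case True
        have "\<tau> (s x) = x"
        proof
          fix j
          show "\<tau> (s x) j = x j"
          proof (cases "j < n")
            case j: True
            then have "\<bar>x j\<bar> \<le> K" using True by auto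
            then have "\<bar>w * x j\<bar> \<le> w * K" using w by (simp add: abs_mult)
            also have "w * K = pi / 2" using K by (simp add: w_def)
            finally show ?thesis using j w
              by (simp add: \<tau>_def s_def arcsin_sin abs_le_iff)
          qed (use x in \<open>simp add: \<tau>_def\<close>)
        qed
        then show ?thesis using B0 by (simp add: F_def sum_nonneg \<phi>_bd)
      next
        case False
        then obtain j where j: "j < n" "\<bar>x j\<bar> > K" by auto
        have "1 \<le> \<phi> m (x j)" using j by (simp add: \<phi>_def K_def)
        also have "\<phi> m (x j) \<le> (\<Sum>j<n. \<phi> m (x j))"
          using j by (intro member_le_sum) (auto simp: \<phi>_bd)
        finally have "2 * B * 1 \<le> 2 * B * (\<Sum>j<n. \<phi> m (x j))"
          using B0 by (intro mult_left_mono) auto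
        moreover have "\<bar>f x - F (s x)\<bar> \<le> 2 * B"
          using B[of x] B[of "\<tau> (s x)"] unfolding F_def by linarith
        ultimately show ?thesis by linarith
      qed
      with FT show ?thesis by linarith
    qed
    have diff: "\<bar>(\<integral>x. f x \<partial>P) - (\<integral>x. T x \<partial>P)\<bar> \<le> 2 * B * p P m + \<eta>"
      if P: "prob_space P" "sets P = sets borel" "AE x in P. \<forall>i\<ge>n. x i = 0" for P
    proof -
      interpret prob_space P by fact
      note [measurable_cong] = P(2)
      have f: "integrable P f" by (rule integrable_const_bound[of _ B]) (auto simp: B)
      have T': "integrable P T" by (rule trig_poly_integrable[OF T P(1,2)])
      have \<Phi>: "integrable P (\<lambda>x. \<Sum>j<n. \<phi> m (x j))"
        using int_\<phi>[OF P(1,2)] by simp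
      have "\<bar>(\<integral>x. f x \<partial>P) - (\<integral>x. T x \<partial>P)\<bar> = \<bar>\<integral>x. f x - T x \<partial>P\<bar>"
        using f T' by simp
      also have "\<dots> \<le> (\<integral>x. \<bar>f x - T x\<bar> \<partial>P)" by (rule integral_abs_bound)
      also have "\<dots> \<le> (\<integral>x. 2 * B * (\<Sum>j<n. \<phi> m (x j)) + \<eta> \<partial>P)"
        using P(3) by (intro integral_mono_AE) (use f T' \<Phi> main in auto)
      also have "\<dots> = 2 * B * p P m + \<eta>"
        using \<Phi> by (simp add: p_def prob_space)
      finally show ?thesis .
    qed
    have "\<forall>\<^sub>F k in sequentially. p (M k) m < \<eta>"
      by (rule order_tendstoD(2)[OF p_conv m])
    moreover have "\<forall>\<^sub>F k in sequentially. \<bar>(\<integral>x. T x \<partial>M k) - (\<integral>x. T x \<partial>N)\<bar> < \<eta>"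
      using tendstoD[OF trig_poly_integral_tendsto[OF T M(1,2) N(1,2) conv] \<eta>]
      by (simp add: dist_real_def)
    ultimately have "\<forall>\<^sub>F k in sequentially. norm ((\<integral>x. f x \<partial>M k) - (\<integral>x. f x \<partial>N)) < e"
    proof eventually_elim
      case (elim k)
      have "2 * B * p (M k) m \<le> 2 * B * \<eta>" "2 * B * p N m \<le> 2 * B * \<eta>"
        using elim m B0 by (auto intro!: mult_left_mono)
      then have "\<bar>(\<integral>x. f x \<partial>M k) - (\<integral>x. f x \<partial>N)\<bar> < 4 * B * \<eta> + 3 * \<eta>"
        using diff[OF M, of k] diff[OF N] elim by linarith
      also have "\<dots> \<le> (4 * B + 4) * \<eta>" using \<eta> by (simp add: algebra_simps)
      also have "\<dots> = e" using B0 by (simp add: \<eta>_def)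
      finally show ?case by simp
    qed
    then show "\<exists>no. \<forall>k\<ge>no. norm ((\<integral>x. f x \<partial>M k) - (\<integral>x. f x \<partial>N)) < e"
      by (simp add: eventually_sequentially)
  qed
qed

section \<open>One-step schemes for ordinary differential equations\<close>

definition clamp01 :: "real \<Rightarrow> real" where
  "clamp01 y = min 1 (max 0 y)"

text \<open>The k-th summand is the length of the part of [0, y] lying in [k, k + 1].\<close>

lemma sum_clamp01:
  assumes "0 \<le> y" "y \<le> real n"
  shows "(\<Sum>k<n. clamp01 (y - real k)) = y"
proof -
  have "(\<Sum>k<n. clamp01 (y - real k)) = min (real n) y" if "0 \<le> y" for n y
    using that by (induction n) (auto simp: clamp01_def min_def max_def)
  with assms show ?thesis by simp
qed

text \<open>
  Piecewise linear interpolation of w at the nodes k / n, written with \<^term>\<open>clamp01\<close> so that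
  an increment over [t, t'] is a nonnegative combination of the differences of w, of total
  weight n (t' - t).
\<close>

definition interp :: "nat \<Rightarrow> (nat \<Rightarrow> 'a) \<Rightarrow> real \<Rightarrow> 'a::real_normed_vector" where
  "interp n w t = w 0 + (\<Sum>k<n. clamp01 (real n * t - real k) *\<^sub>R (w (Suc k) - w k))"

lemma interp_grid:
  assumes "j \<le> n" "0 < n"
  shows "interp n w (real j / real n) = w j"
proof -
  have "(\<Sum>k<n. clamp01 (real n * (real j / real n) - real k) *\<^sub>R (w (Suc k) - w k)) =
      (\<Sum>k<n. if k < j then w (Suc k) - w k else 0)"
    using assms by (intro sum.cong) (auto simp: clamp01_def)
  also have "\<dots> = (\<Sum>k<j. w (Suc k) - w k)"
    using assms by (intro sum.mono_neutral_cong_right) auto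
  also have "\<dots> = w j - w 0" by (rule sum_lessThan_telescope)
  finally show ?thesis by (simp add: interp_def)
qed

text \<open>The cell [k / n, (k + 1) / n] meets the open interval from t to t' only if t - 1 / n < k
  / n < t'. The slopes of all other cells carry weight 0, so \<open>bound\<close> asks nothing of
  them.\<close>

lemma interp_increment:
  assumes n: "0 < n" and t: "0 \<le> t" "t \<le> t'" "t' \<le> 1"
    and bound: "\<And>k. k < n \<Longrightarrow> t - 1 / real n < real k / real n \<Longrightarrow> real k / real n < t' \<Longrightarrow>
       norm (real n *\<^sub>R (w (Suc k) - w k) - c) \<le> e"
  shows "norm (interp n w t' - interp n w t - (t' - t) *\<^sub>R c) \<le> e * (t' - t)"
proof -
  define b where "b k = clamp01 (real n * t' - real k) - clamp01 (real n * t - real k)" for k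
  have le: "real n * t \<le> real n * t'" using t by (intro mult_left_mono) auto
  have b0: "0 \<le> b k" for k using le by (auto simp: b_def clamp01_def)
  have n1: "real n * r \<le> real n" if "r \<le> 1" for r using that n by simp
  have bsum: "(\<Sum>k<n. b k) = real n * (t' - t)"
    unfolding b_def sum_subtractf using t n1
    by (subst (1 2) sum_clamp01) (auto simp: algebra_simps)
  have "interp n w t' - interp n w t = (\<Sum>k<n. b k *\<^sub>R (w (Suc k) - w k))"
    by (simp add: interp_def b_def sum_subtractf[symmetric] scaleR_diff_left[symmetric])
  moreover have "(t' - t) *\<^sub>R c = (\<Sum>k<n. b k *\<^sub>R ((1 / real n) *\<^sub>R c))"
    unfolding scaleR_sum_left[symmetric] bsum using n by simp
  ultimately have "interp n w t' - interp n w t - (t' - t) *\<^sub>R c =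
      (\<Sum>k<n. b k *\<^sub>R ((w (Suc k) - w k) - (1 / real n) *\<^sub>R c))"
    by (simp add: sum_subtractf[symmetric] scaleR_diff_right)
  also have "norm \<dots> \<le> (\<Sum>k<n. b k * (e / real n))"
  proof (rule order.trans[OF norm_sum], rule sum_mono)
    fix k assume k: "k \<in> {..<n}"
    show "norm (b k *\<^sub>R (w (Suc k) - w k - (1 / real n) *\<^sub>R c)) \<le> b k * (e / real n)"
    proof (cases "b k = 0")
      case False
      then have "t \<noteq> t'" by (auto simp: b_def)
      then have "real n * t < real n * t'" using t n by simp
      with False have "real k < real n * t'" "real n * t < real k + 1"
        by (auto simp: b_def clamp01_def min_def max_def split: if_splits)
      then have "real k / real n < t'" "t < (real k + 1) / real n"
        using n by (simp_all add: divide_less_eq less_divide_eq mult.commute)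
      then have "norm (real n *\<^sub>R (w (Suc k) - w k) - c) \<le> e"
        using k by (intro bound) (auto simp: add_divide_distrib)
      moreover have "w (Suc k) - w k - (1 / real n) *\<^sub>R c =
          (1 / real n) *\<^sub>R (real n *\<^sub>R (w (Suc k) - w k) - c)"
        using n by (simp add: scaleR_diff_right)
      ultimately have "norm (w (Suc k) - w k - (1 / real n) *\<^sub>R c) \<le> e / real n"
        using n by (simp add: divide_simps mult.commute)
      then show ?thesis using b0[of k] by (simp only: norm_scaleR abs_of_nonneg mult_left_mono)
    qed simp
  qed
  also have "\<dots> = e * (t' - t)"
    unfolding sum_distrib_right[symmetric] bsum using n by simp
  finally show ?thesis .
qed

text \<open>The field receives the step size as an argument, so that schemes with a step-dependent
  field such as symplectic Euler fit. The limiting equation has the field G 0.\<close>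

primrec one_step :: "(real \<Rightarrow> 'a \<Rightarrow> 'a) \<Rightarrow> nat \<Rightarrow> 'a \<Rightarrow> nat \<Rightarrow> 'a::real_normed_vector" where
  "one_step G n z 0 = z"
| "one_step G n z (Suc k) =
     one_step G n z k + (1 / real n) *\<^sub>R G (1 / real n) (one_step G n z k)"

lemma one_step_difference:
  "0 < n \<Longrightarrow> real n *\<^sub>R (one_step G n z (Suc k) - one_step G n z k) =
     G (1 / real n) (one_step G n z k)"
  by simp

lemma interp_increment':
  assumes n: "0 < n" and t: "t \<in> {0..1}" "t' \<in> {0..1}"
    and bound: "\<And>k. k < n \<Longrightarrow> \<bar>real k / real n - t\<bar> < \<bar>t' - t\<bar> + 1 / real n \<Longrightarrow>
       norm (real n *\<^sub>R (w (Suc k) - w k) - c) \<le> e"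
  shows "norm (interp n w t' - interp n w t - (t' - t) *\<^sub>R c) \<le> e * \<bar>t' - t\<bar>"
proof -
  have n0: "0 < 1 / real n" using n by simp
  show ?thesis
  proof (cases "t \<le> t'")
    case True
    then show ?thesis
      using interp_increment[OF n _ True, of w c e] t bound n0 by force
  next
    case False
    have "norm (interp n w t - interp n w t' - (t - t') *\<^sub>R c) \<le> e * (t - t')"
      by (rule interp_increment[OF n]) (use False t bound n0 in force)+
    moreover have "interp n w t' - interp n w t - (t' - t) *\<^sub>R c =
        - (interp n w t - interp n w t' - (t - t') *\<^sub>R c)"
      by (simp add: algebra_simps)
    ultimately show ?thesis using False by (metis abs_minus_commute abs_of_nonneg
        diff_ge_0_iff_ge nle_le norm_minus_cancel)
  qed
qed

text \<open>Peano's argument: the bound M makes the interpolants equi-Lipschitz, Arzela-Ascoli gives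
  a uniform limit along a subsequence, and the derivative of the limit is read off from the
  increments, which average values of the field near (0, u t).\<close>

lemma one_step_subsequence_limit:
  fixes G :: "real \<Rightarrow> 'a::euclidean_space \<Rightarrow> 'a"
  assumes G_cont: "continuous_on UNIV (\<lambda>(h, y). G h y)"
    and bound: "\<And>h y. norm (G h y) \<le> M"
    and r: "strict_mono r" "\<And>n. 0 < r n"
  obtains u k where "strict_mono (k :: nat \<Rightarrow> nat)" "u 0 = z" "continuous_on {0..1} u"
    "\<And>t. t \<in> {0..1} \<Longrightarrow> (u has_vector_derivative G 0 (u t)) (at t within {0..1})"
    "\<And>e. 0 < e \<Longrightarrow> \<exists>N. \<forall>n\<ge>N. \<forall>t\<in>{0..1}.
        norm (interp (r (k n)) (one_step G (r (k n)) z) t - u t) < e"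
proof -
  define F where "F n = interp (r n) (one_step G (r n) z)" for n
  have lip: "norm (F n t' - F n t) \<le> M * \<bar>t' - t\<bar>" if "t \<in> {0..1}" "t' \<in> {0..1}" for n t t'
    using interp_increment'[OF r(2)[of n] that, of "one_step G (r n) z" 0 M]
    unfolding one_step_difference[OF r(2)] F_def by (simp add: bound)
  have M0: "0 \<le> M" using bound[of 0 0] norm_ge_zero order_trans by blast
  have F0: "F n 0 = z" for n
    using interp_grid[of 0 "r n" "one_step G (r n) z"] r(2)[of n] by (simp add: F_def)
  obtain u k where uc: "continuous_on {0..1} u" and k: "strict_mono (k :: nat \<Rightarrow> nat)"
    and unif: "\<And>e. 0 < e \<Longrightarrow> \<exists>N. \<forall>n t. n \<ge> N \<and> t \<in> {0..1} \<longrightarrow> norm (F (k n) t - u t) < e"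
  proof (rule Arzela_Ascoli[of "{0..1::real}" F "norm z + M"])
    show "norm (F n t) \<le> norm z + M" if "t \<in> {0..1}" for n t
    proof -
      have "norm (F n t - z) \<le> M * \<bar>t\<bar>" using lip[of 0 t n] that by (simp add: F0)
      also have "\<dots> \<le> M * 1" using that M0 by (intro mult_left_mono) auto
      finally show ?thesis using norm_triangle_sub[of "F n t" z] by linarith
    qed
    show "\<exists>d>0. \<forall>n t'. t' \<in> {0..1} \<and> norm (t - t') < d \<longrightarrow> norm (F n t - F n t') < e"
      if "t \<in> {0..1}" "0 < e" for t e
    proof (intro exI[of _ "e / (M + 1)"] conjI allI impI)
      show "0 < e / (M + 1)" using that M0 by simp
      fix n t' assume t': "t' \<in> {0..1} \<and> norm (t - t') < e / (M + 1)"
      have "norm (F n t - F n t') \<le> M * \<bar>t - t'\<bar>" using lip that t' by blast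
      also have "\<dots> \<le> (M + 1) * \<bar>t - t'\<bar>" by (simp add: distrib_right)
      also have "\<dots> < (M + 1) * (e / (M + 1))" using t' M0 by (intro mult_strict_left_mono) auto
      finally show "norm (F n t - F n t') < e" using M0 by simp
    qed
  qed (auto simp: that)
  have conv: "(\<lambda>n. F (k n) t) \<longlonglongrightarrow> u t" if "t \<in> {0..1}" for t
    using unif that by (intro LIMSEQ_I) blast
  have rk: "n \<le> r (k n)" for n
    using seq_suble[OF r(1), of "k n"] seq_suble[OF k, of n] by linarith
  show ?thesis
  proof (rule that[OF k])
    show "u 0 = z"
      using conv[of 0] by (simp add: F0 LIMSEQ_const_iff)
    show "continuous_on {0..1} u" by (rule uc)
    show "(u has_vector_derivative G 0 (u t)) (at t within {0..1})" if t: "t \<in> {0..1}" for t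
      unfolding has_vector_derivative_def has_derivative_within_alt
    proof (intro conjI allI impI)
      show "bounded_linear (\<lambda>x. x *\<^sub>R G 0 (u t))" by (rule bounded_linear_scaleR_left)
      fix e :: real assume e: "0 < e"
      have "isCont (\<lambda>(h, y). G h y) (0, u t)"
        using G_cont by (simp add: continuous_on_eq_continuous_at)
      then obtain d where d: "0 < d"
        and Gd: "\<And>h y. dist (h, y) (0, u t) < d \<Longrightarrow> dist (G h y) (G 0 (u t)) < e"
        using e unfolding continuous_at_eps_delta by fastforce
      obtain d' where d': "0 < d'"
        and ud: "\<And>t'. t' \<in> {0..1} \<Longrightarrow> dist t' t < d' \<Longrightarrow> dist (u t') (u t) < d / 3"
        using uc t d unfolding continuous_on_iff by (metis divide_pos_pos zero_less_numeral)
      show "\<exists>d>0. \<forall>t'\<in>{0..1}. norm (t' - t) < d \<longrightarrow>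
          norm (u t' - u t - (t' - t) *\<^sub>R G 0 (u t)) \<le> e * norm (t' - t)"
      proof (intro exI[of _ "d' / 2"] conjI ballI impI)
        show "0 < d' / 2" using d' by simp
        fix t' assume t': "t' \<in> {0..1}" "norm (t' - t) < d' / 2"
        \<comment> \<open>Three contributions of d / 3 place (1 / m, iterate) within d of (0, u t):
          the step size, the distance of interpolant and u, and the modulus of continuity of u. The
          halved d' leaves room for one cell length 1 / m.\<close>
        obtain N1 where N1: "\<And>n t. n \<ge> N1 \<Longrightarrow> t \<in> {0..1} \<Longrightarrow> norm (F (k n) t - u t) < d / 3"
          using unif[of "d / 3"] d by auto
        obtain N2 where N2: "1 / real (Suc N2) < min (d / 3) (d' / 2)"
          using nat_approx_posE[of "min (d / 3) (d' / 2)"] d d' by auto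
        have "norm (F (k n) t' - F (k n) t - (t' - t) *\<^sub>R G 0 (u t)) \<le> e * \<bar>t' - t\<bar>"
          if n: "n \<ge> max N1 (Suc N2)" for n
          unfolding F_def
        proof (rule interp_increment'[OF r(2) t t'(1)])
          fix j
          define m where "m = r (k n)"
          have m0: "0 < m" unfolding m_def by (rule r(2))
          assume j: "j < r (k n)"
            "\<bar>real j / real (r (k n)) - t\<bar> < \<bar>t' - t\<bar> + 1 / real (r (k n))"
          have "1 / real m \<le> 1 / real (Suc N2)"
            using rk[of n] n by (intro divide_left_mono) (auto simp: m_def)
          then have m: "1 / real m < d / 3" "1 / real m < d' / 2" using N2 by auto
          have jm: "real j / real m \<in> {0..1}" using j by (auto simp: m_def)
          have "dist (real j / real m) t < d'"
            using j t'(2) m by (simp add: dist_real_def m_def)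
          then have "dist (u (real j / real m)) (u t) < d / 3" using ud jm by blast
          moreover have "dist (one_step G m z j) (u (real j / real m)) < d / 3"
            using N1[of n, OF _ jm] n interp_grid[of j m "one_step G m z"] j m0
            by (simp add: F_def m_def dist_norm)
          ultimately have "dist (one_step G m z j) (u t) < 2 * d / 3"
            using dist_triangle[of "one_step G m z j" "u t" "u (real j / real m)"] by linarith
          moreover have "dist (1 / real m, one_step G m z j) (0, u t) \<le>
              dist (1 / real m) 0 + dist (one_step G m z j) (u t)"
            by (simp add: dist_prod_def sqrt_sum_squares_le_sum)
          ultimately have "dist (1 / real m, one_step G m z j) (0, u t) < d"
            using m by simp
          then show "norm (real (r (k n)) *\<^sub>R (one_step G (r (k n)) z (Suc j) -
              one_step G (r (k n)) z j) - G 0 (u t)) \<le> e"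
            unfolding one_step_difference[OF r(2)] using Gd by (simp add: m_def dist_norm less_imp_le)
        qed
        then have "\<forall>\<^sub>F n in sequentially.
            norm (F (k n) t' - F (k n) t - (t' - t) *\<^sub>R G 0 (u t)) \<le> e * \<bar>t' - t\<bar>"
          unfolding eventually_sequentially by blast
        moreover have "(\<lambda>n. norm (F (k n) t' - F (k n) t - (t' - t) *\<^sub>R G 0 (u t))) \<longlonglongrightarrow>
            norm (u t' - u t - (t' - t) *\<^sub>R G 0 (u t))"
          by (intro tendsto_intros conv t t')
        ultimately show "norm (u t' - u t - (t' - t) *\<^sub>R G 0 (u t)) \<le> e * norm (t' - t)"
          by (simp add: tendsto_upperbound)
      qed
    qed
    show "\<exists>N. \<forall>n\<ge>N. \<forall>t\<in>{0..1}.
        norm (interp (r (k n)) (one_step G (r (k n)) z) t - u t) < e" if "0 < e" for e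
      using unif[OF that] unfolding F_def by blast
  qed
qed

text \<open>If the error stayed above e infinitely often, those indices would have a subsequence
  converging uniformly to a solution, which by \<open>unique\<close> is \<phi>. Uniqueness is only
  asked for solutions that start at z.\<close>

lemma one_step_converges:
  fixes G :: "real \<Rightarrow> 'a::euclidean_space \<Rightarrow> 'a"
  assumes G_cont: "continuous_on UNIV (\<lambda>(h, y). G h y)"
    and bound: "\<And>h y. norm (G h y) \<le> M"
    and unique: "\<And>u. u 0 = z \<Longrightarrow> continuous_on {0..1} u \<Longrightarrow>
      (\<And>t. t \<in> {0..1} \<Longrightarrow> (u has_vector_derivative G 0 (u t)) (at t within {0..1})) \<Longrightarrow>
      (\<And>t. t \<in> {0..1} \<Longrightarrow> u t = \<phi> t)"
    and e: "0 < e"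
  shows "\<forall>\<^sub>F n in sequentially. \<forall>j\<le>n. norm (one_step G n z j - \<phi> (real j / real n)) < e"
proof (rule ccontr)
  assume "\<not> ?thesis"
  then have "\<exists>\<^sub>F n in sequentially. \<not> (\<forall>j\<le>n. norm (one_step G n z j - \<phi> (real j / real n)) < e)"
    by (simp add: not_eventually)
  then have "\<exists>\<^sub>F n in sequentially. 0 < n \<and>
      \<not> (\<forall>j\<le>n. norm (one_step G n z j - \<phi> (real j / real n)) < e)"
    using eventually_gt_at_top[of 0] by (rule frequently_eventually_conj)
  then have "infinite {n. 0 < n \<and> \<not> (\<forall>j\<le>n. norm (one_step G n z j - \<phi> (real j / real n)) < e)}"
    by (simp add: frequently_cofinite cofinite_eq_sequentially[symmetric])
  from infinite_enumerate[OF this] obtain r :: "nat \<Rightarrow> nat" where r: "strict_mono r"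
    and r': "\<And>n. 0 < r n"
      "\<And>n. \<not> (\<forall>j\<le>r n. norm (one_step G (r n) z j - \<phi> (real j / real (r n))) < e)"
    by auto
  obtain u k where "strict_mono (k :: nat \<Rightarrow> nat)" "u 0 = z" "continuous_on {0..1} u"
    "\<And>t. t \<in> {0..1} \<Longrightarrow> (u has_vector_derivative G 0 (u t)) (at t within {0..1})"
    and lim: "\<And>e. 0 < e \<Longrightarrow> \<exists>N. \<forall>n\<ge>N. \<forall>t\<in>{0..1}.
        norm (interp (r (k n)) (one_step G (r (k n)) z) t - u t) < e"
    by (rule one_step_subsequence_limit[OF G_cont bound r r'(1), where z = z]) (rule that)
  then have u: "u t = \<phi> t" if "t \<in> {0..1}" for t using unique that by blast
  obtain n where n: "\<And>t. t \<in> {0..1} \<Longrightarrow>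
      norm (interp (r (k n)) (one_step G (r (k n)) z) t - u t) < e"
    using lim[OF e] by blast
  have "norm (one_step G (r (k n)) z j - \<phi> (real j / real (r (k n)))) < e" if "j \<le> r (k n)" for j
    using n[of "real j / real (r (k n))"] u[of "real j / real (r (k n))"] that r'(1)[of "k n"]
    by (simp add: interp_grid)
  then show False using r'(2)[of "k n"] by blast
qed

section \<open>Convergence of the symplectic Euler scheme\<close>

text \<open>Serves to extend a solution on an interval to the whole line. Closedness of both pieces
  reduces the derivative at a junction to derivatives within each piece.\<close>

lemma ode_glue:
  assumes f: "\<And>t. t \<in> S \<Longrightarrow> (f has_vector_derivative F (f t)) (at t within S)"
    and h: "\<And>t. t \<in> T \<Longrightarrow> (h has_vector_derivative F (h t)) (at t within T)"
    and closed: "closed S" "closed T"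
    and connect: "\<And>t. t \<in> S \<Longrightarrow> t \<in> T \<Longrightarrow> f t = h t"
    and t: "t \<in> S \<union> T"
  shows "((\<lambda>t. if t \<in> S then f t else h t) has_vector_derivative
      F (if t \<in> S then f t else h t)) (at t within S \<union> T)"
proof -
  have "((\<lambda>t. if t \<in> S then f t else h t) has_vector_derivative
      (if t \<in> S then F (f t) else F (h t))) (at t within S \<union> T)"
    by (rule has_vector_derivative_If_within_closures[OF t refl])
      (use f h closed connect in \<open>auto simp: Un_absorb2\<close>)
  then show ?thesis by (simp add: if_distrib cong: if_cong)
qed

locale hamiltonian_flow =
  fixes g dg :: "real \<Rightarrow> real" and a ad :: "real \<Rightarrow> real \<Rightarrow> real \<Rightarrow> real"
  assumes g_deriv: "(g has_real_derivative dg x) (at x)"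
    and dg_cont: "continuous_on UNIV dg"
    and a_solves: "((\<lambda>s. a s y0 y0') has_real_derivative ad t y0 y0') (at t)"
    and ad_solves: "((\<lambda>s. ad s y0 y0') has_real_derivative - dg (a t y0 y0')) (at t)"
    and a_init: "a 0 y0 y0' = y0" and ad_init: "ad 0 y0 y0' = y0'"
    and a_unique: "(\<And>t. (y has_real_derivative y' t) (at t)) \<Longrightarrow>
        (\<And>t. (y' has_real_derivative - dg (y t)) (at t)) \<Longrightarrow> y t = a t (y 0) (y' 0)"
begin

definition flow :: "real \<Rightarrow> real \<times> real \<Rightarrow> real \<times> real" where
  "flow s z = (a s (fst z) (snd z), ad s (fst z) (snd z))"

definition vf :: "real \<times> real \<Rightarrow> real \<times> real" where
  "vf z = (snd z, - dg (fst z))"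

lemma flow_0 [simp]: "flow 0 z = z"
  by (simp add: flow_def a_init ad_init)

lemma flow_deriv: "((\<lambda>s. flow s z) has_vector_derivative vf (flow s z)) (at s)"
  unfolding flow_def vf_def
  using a_solves ad_solves
  by (auto intro!: has_vector_derivative_Pair
      simp: has_real_derivative_iff_has_vector_derivative[symmetric])

text \<open>The locale determines the position only; the velocity follows as its derivative.\<close>

lemma flow_unique:
  assumes u: "\<And>t. (u has_vector_derivative vf (u t)) (at t)"
  shows "u t = flow t (u 0)"
proof -
  have y: "((\<lambda>t. fst (u t)) has_real_derivative snd (u t)) (at t)" for t
    using bounded_linear.has_vector_derivative[OF bounded_linear_fst u[of t]]
    by (simp add: has_real_derivative_iff_has_vector_derivative vf_def)
  have y': "((\<lambda>t. snd (u t)) has_real_derivative - dg (fst (u t))) (at t)" for t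
    using bounded_linear.has_vector_derivative[OF bounded_linear_snd u[of t]]
    by (simp add: has_real_derivative_iff_has_vector_derivative vf_def)
  have eq: "fst (u t) = a t (fst (u 0)) (snd (u 0))" for t
    by (rule a_unique[OF y y'])
  have "snd (u t) = ad t (fst (u 0)) (snd (u 0))"
    by (rule DERIV_unique[OF y a_solves[of "fst (u 0)" "snd (u 0)" t, folded eq]])
  with eq[of t] show ?thesis by (simp add: flow_def prod_eq_iff)
qed

text \<open>The equation is autonomous, so a time-shifted trajectory is the trajectory of the
  shifted starting point.\<close>

lemma flow_flow: "flow s (flow r z) = flow (s + r) z"
proof -
  have "((\<lambda>s. flow (s + r) z) has_vector_derivative vf (flow (t + r) z)) (at t)" for t
  proof -
    have "((\<lambda>s. s + r) has_vector_derivative 1) (at t)"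
      by (auto intro!: derivative_eq_intros simp flip: has_real_derivative_iff_has_vector_derivative)
    from vector_diff_chain_at[OF this flow_deriv[of z]] show ?thesis by (simp add: o_def)
  qed
  from flow_unique[of "\<lambda>s. flow (s + r) z", OF this, of s] show ?thesis by simp
qed

lemma flow_inverse [simp]: "flow (- s) (flow s z) = z" "flow s (flow (- s) z) = z"
  by (simp_all add: flow_flow)

lemma scaled_flow_deriv:
  "((\<lambda>t. flow (s * (t - c)) z) has_vector_derivative s *\<^sub>R vf (flow (s * (t - c)) z)) (at t within S)"
proof -
  have "((\<lambda>t. s * (t - c)) has_vector_derivative s) (at t)"
    by (auto intro!: derivative_eq_intros simp flip: has_real_derivative_iff_has_vector_derivative)
  from vector_diff_chain_at[OF this flow_deriv[of z]] show ?thesis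
    by (simp add: o_def has_vector_derivative_at_within)
qed

lemma scaled_flow_continuous: "continuous_on S (\<lambda>t. flow (s * t) z)"
proof (rule continuous_on_vector_derivative)
  show "((\<lambda>t. flow (s * t) z) has_vector_derivative s *\<^sub>R vf (flow (s * t) z)) (at t within S)" for t
    using scaled_flow_deriv[of s 0 z t S] by simp
qed

text \<open>The uniqueness at hand concerns solutions on all of R. A solution on {0..c} is therefore
  continued by flow pieces to the left of 0 and to the right of c, and time is divided by s. For s =
  0 this rescaling is impossible, but then u is constant.\<close>

lemma flow_unique_interval:
  assumes c: "0 \<le> c"
    and u: "\<And>t. t \<in> {0..c} \<Longrightarrow> (u has_vector_derivative s *\<^sub>R vf (u t)) (at t within {0..c})"
    and t: "t \<in> {0..c}"
  shows "u t = flow (s * t) (u 0)"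
proof (cases "s = 0")
  case True
  then have "u t = u 0"
    using has_vector_derivative_zero_constant[of "{0..c}" u] u c t
    by (metis atLeastAtMost_iff convex_real_interval(5) order_refl scaleR_zero_left)
  with True show ?thesis by simp
next
  case s: False
  define U1 where "U1 t = (if t \<in> {..0} then flow (s * (t - 0)) (u 0) else u t)" for t
  have "{..0} \<union> {0..c} = {..c}" using c by auto
  then have U1: "(U1 has_vector_derivative s *\<^sub>R vf (U1 t)) (at t within {..c})" if "t \<in> {..c}" for t
    using ode_glue[of "{..0}" "\<lambda>t. flow (s * (t - 0)) (u 0)" "\<lambda>z. s *\<^sub>R vf z" "{0..c}" u t,
        OF scaled_flow_deriv u] that
    unfolding U1_def by auto
  define U where "U t = (if t \<in> {..c} then U1 t else flow (s * (t - c)) (U1 c))" for t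
  have "{..c} \<union> {c..} = UNIV" by auto
  then have U: "(U has_vector_derivative s *\<^sub>R vf (U t)) (at t)" for t
    using ode_glue[of "{..c}" U1 "\<lambda>z. s *\<^sub>R vf z" "{c..}" "\<lambda>t. flow (s * (t - c)) (U1 c)" t,
        OF U1 scaled_flow_deriv]
    unfolding U_def by auto
  have "((\<lambda>r. U (r / s)) has_vector_derivative vf (U (r / s))) (at r)" for r
  proof -
    have "((\<lambda>r. r / s) has_vector_derivative 1 / s) (at r)"
      using s
      by (auto intro!: derivative_eq_intros simp flip: has_real_derivative_iff_has_vector_derivative)
    from vector_diff_chain_at[OF this U] s show ?thesis by (simp add: o_def)
  qed
  from flow_unique[of "\<lambda>r. U (r / s)", OF this, of "s * t"] s
  have "U t = flow (s * t) (U 0)" by simp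
  with t c show ?thesis by (auto simp: U_def U1_def split: if_splits)
qed

section \<open>The cut-off vector field and the symplectic Euler scheme\<close>

definition cutoff :: "real \<Rightarrow> real \<Rightarrow> real" where
  "cutoff R y = max (- R) (min R y)"

lemma cutoff_eq [simp]: "\<bar>y\<bar> \<le> R \<Longrightarrow> cutoff R y = y"
  by (auto simp: cutoff_def)

lemma abs_cutoff_le: "0 \<le> R \<Longrightarrow> \<bar>cutoff R y\<bar> \<le> R"
  by (auto simp: cutoff_def)

lemma continuous_on_cutoff [continuous_intros]:
  "continuous_on S f \<Longrightarrow> continuous_on S (\<lambda>x. cutoff R (f x))"
  unfolding cutoff_def by (intro continuous_intros)

text \<open>
  The argument of \<^term>\<open>dg\<close> depends on h in such a way that, inside the ball, an explicit one-step
  scheme with this field and h = 1 / n is the symplectic Euler scheme with step s / n.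
\<close>

definition cut_field :: "real \<Rightarrow> real \<Rightarrow> real \<Rightarrow> real \<times> real \<Rightarrow> real \<times> real" where
  "cut_field R s h z = s *\<^sub>R (cutoff R (snd z),
     - dg (cutoff R (fst z + h * s * cutoff R (snd z))))"

lemma cut_field_0: "norm z \<le> R \<Longrightarrow> cut_field R s 0 z = s *\<^sub>R vf z"
  using norm_fst_le[of "fst z" "snd z"] norm_snd_le[of "snd z" "fst z"]
  by (simp add: cut_field_def vf_def)

lemma continuous_on_dg [continuous_intros]:
  "continuous_on S f \<Longrightarrow> continuous_on S (\<lambda>x. dg (f x))"
  by (rule continuous_on_compose2[OF dg_cont]) auto

lemma cut_field_continuous: "continuous_on UNIV (\<lambda>(h, z). cut_field R s h z)"
  unfolding cut_field_def case_prod_beta by (intro continuous_intros)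

lemma cut_field_bounded:
  assumes "0 \<le> R"
  obtains M where "\<And>h z. norm (cut_field R s h z) \<le> M"
proof -
  have "compact (dg ` {- R..R})"
    by (intro compact_continuous_image continuous_on_subset[OF dg_cont]) auto
  then obtain B where B: "\<forall>y\<in>{- R..R}. \<bar>dg y\<bar> \<le> B"
    by (auto dest!: compact_imp_bounded simp: bounded_iff)
  have "norm (cut_field R s h z) \<le> \<bar>s\<bar> * (R + B)" for h z
  proof -
    have "norm (cut_field R s h z) \<le> \<bar>s\<bar> * (\<bar>cutoff R (snd z)\<bar> +
        \<bar>dg (cutoff R (fst z + h * s * cutoff R (snd z)))\<bar>)"
      unfolding cut_field_def norm_scaleR
      by (intro mult_left_mono order.trans[OF norm_Pair_le]) auto
    also have "\<dots> \<le> \<bar>s\<bar> * (R + B)"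
      using abs_cutoff_le[OF assms]
      by (intro mult_left_mono add_mono B[rule_format]) (auto simp: abs_le_iff minus_le_iff)
    finally show ?thesis .
  qed
  then show ?thesis by (rule that)
qed

text \<open>
  Cutting off the vector field outside a large ball does not create further solutions from
  this initial value: up to the first exit from the ball such a solution solves the original
  equation, hence is the flow, which stays strictly inside.
\<close>

lemma cut_field_unique:
  assumes u0: "u 0 = z" and uc: "continuous_on {0..1} u"
    and u: "\<And>t. t \<in> {0..1} \<Longrightarrow> (u has_vector_derivative cut_field R s 0 (u t)) (at t within {0..1})"
    and R: "\<And>t. t \<in> {0..1} \<Longrightarrow> norm (flow (s * t) z) < R"
    and t: "t \<in> {0..1}"
  shows "u t = flow (s * t) z"
proof -
  have inside: "u t = flow (s * t) z"
    if c: "c \<in> {0..1}" "\<And>t. t \<in> {0..c} \<Longrightarrow> norm (u t) \<le> R" "t \<in> {0..c}" for c t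
  proof -
    have "(u has_vector_derivative s *\<^sub>R vf (u t)) (at t within {0..c})" if "t \<in> {0..c}" for t
    proof -
      have "(u has_vector_derivative cut_field R s 0 (u t)) (at t within {0..c})"
        by (rule has_vector_derivative_within_subset[OF u]) (use that c in auto)
      then show ?thesis using cut_field_0[OF c(2)[OF that]] by simp
    qed
    from flow_unique_interval[where u = u and c = c and s = s and t = t, OF _ this] c u0 show ?thesis by auto
  qed
  \<comment> \<open>\<open>A\<close> is compact, so there is a first exit time c. Agreement with the
    flow on {0..<c} extends to c by continuity, where it contradicts the strict bound
    \<open>R\<close>.\<close>
  define A where "A = {t \<in> {0..1}. R \<le> norm (u t)}"
  have "A = {}"
  proof (rule ccontr)
    assume "A \<noteq> {}"
    have "A = {0..1} \<inter> (\<lambda>t. norm (u t)) -` {R..}" by (auto simp: A_def)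
    moreover have "closed \<dots>"
      by (intro continuous_closed_preimage continuous_intros uc)
    ultimately have "compact A"
      by (metis A_def bounded_subset compact_eq_bounded_closed compact_Icc mem_Collect_eq subsetI)
    then obtain c where c: "c \<in> A" "\<And>t. t \<in> A \<Longrightarrow> c \<le> t"
      using compact_attains_inf \<open>A \<noteq> {}\<close> by metis
    have "norm (u 0) < R" using R[of 0] u0 by simp
    then have "0 < c" using c(1) by (auto simp: A_def less_le)
    have before: "u t - flow (s * t) z = 0" if "t \<in> {0..<c}" for t
    proof -
      have "u t = flow (s * t) z"
      proof (rule inside[of t])
        show "t \<in> {0..1}" using that c(1) by (auto simp: A_def)
        show "norm (u r) \<le> R" if "r \<in> {0..t}" for r
          using c(2)[of r] that \<open>t \<in> {0..<c}\<close> c(1) by (force simp: A_def not_le)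
      qed (use that in auto)
      then show ?thesis by simp
    qed
    have cl: "closure {0..<c} = {0..c}" using \<open>0 < c\<close> by (rule closure_atLeastLessThan)
    have "u c - flow (s * c) z = 0"
    proof (rule continuous_constant_on_closure[of "{0..<c}" "\<lambda>t. u t - flow (s * t) z"])
      show "continuous_on (closure {0..<c}) (\<lambda>t. u t - flow (s * t) z)"
        unfolding cl using c(1)
        by (intro continuous_on_diff scaled_flow_continuous continuous_on_subset[OF uc]) (auto simp: A_def)
      show "c \<in> closure {0..<c}" unfolding cl using \<open>0 < c\<close> by simp
    qed (rule before)
    then show False using c(1) R[of c] by (auto simp: A_def)
  qed
  then have "norm (u t) \<le> R" if "t \<in> {0..1}" for t using that by (auto simp: A_def)
  then show ?thesis using inside[of 1 t] t by auto
qed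

text \<open>The force is evaluated at the updated position. With the old position the step would in
  general not preserve area.\<close>

definition sympl_step :: "real \<Rightarrow> real \<times> real \<Rightarrow> real \<times> real" where
  "sympl_step h z = (fst z + h * snd z, snd z - h * dg (fst z + h * snd z))"

text \<open>Inside the ball both cutoffs are inactive: the argument of \<open>dg\<close> is the
  position of the next iterate, so the bound on iterate Suc k justifies the step that produces
  it.\<close>

lemma one_step_cut_field:
  assumes n: "0 < n" and k: "k \<le> n"
    and R: "\<And>j. j \<le> n \<Longrightarrow> norm (one_step (cut_field R s) n z j) \<le> R"
  shows "one_step (cut_field R s) n z k = (sympl_step (s / real n) ^^ k) z"
  using k
proof (induction k)
  case (Suc k)
  define w where "w = one_step (cut_field R s) n z"
  have small: "\<bar>fst (w j)\<bar> \<le> R" "\<bar>snd (w j)\<bar> \<le> R" if "j \<le> n" for j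
    using norm_fst_le[of "fst (w j)" "snd (w j)"] norm_snd_le[of "snd (w j)" "fst (w j)"] R[OF that]
    unfolding w_def by simp_all
  have step: "w (Suc k) = w k + (1 / real n) *\<^sub>R cut_field R s (1 / real n) (w k)"
    by (simp add: w_def)
  have cut: "cutoff R (snd (w k)) = snd (w k)" using small(2)[of k] Suc.prems by simp
  have f: "fst (w (Suc k)) = fst (w k) + s / real n * snd (w k)"
    unfolding step cut_field_def using cut by simp
  moreover have "snd (w (Suc k)) = snd (w k) - s / real n * dg (fst (w (Suc k)))"
  proof -
    have "cutoff R (fst (w k) + 1 / real n * s * snd (w k)) = fst (w (Suc k))"
      using f small(1)[OF Suc.prems] by simp
    then show ?thesis
      unfolding step cut_field_def using cut by simp
  qed
  ultimately have "w (Suc k) = sympl_step (s / real n) (w k)"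
    by (simp add: sympl_step_def prod_eq_iff)
  then show ?case using Suc by (simp add: w_def)
qed simp

lemma symplectic_euler_converges:
  "(\<lambda>n. (sympl_step (s / real n) ^^ n) z) \<longlonglongrightarrow> flow s z"
proof (rule tendstoI)
  fix e :: real assume e: "0 < e"
  have "continuous_on {0..1} (\<lambda>t. flow (s * t) z)"
    by (rule scaled_flow_continuous)
  then have "bounded ((\<lambda>t. flow (s * t) z) ` {0..1})"
    by (intro compact_imp_bounded compact_continuous_image) auto
  then obtain B where "\<forall>t\<in>{0..1}. norm (flow (s * t) z) \<le> B"
    unfolding bounded_iff by auto
  then have B: "norm (flow (s * t) z) \<le> B" if "t \<in> {0..1}" for t using that by blast
  \<comment> \<open>The margin 1 keeps the trajectory strictly inside the ball, and also keeps in
    the ball all iterates that are within \<open>min e 1\<close> of it.\<close>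
  define R where "R = B + 1"
  have "0 \<le> R" using order.trans[OF norm_ge_zero B[of 0]] by (simp add: R_def)
  then obtain M where M: "\<And>h z. norm (cut_field R s h z) \<le> M"
    by (rule cut_field_bounded[where s = s]) (rule that)
  have "\<forall>\<^sub>F n in sequentially. \<forall>j\<le>n.
      norm (one_step (cut_field R s) n z j - flow (s * (real j / real n)) z) < min e 1"
  proof (rule one_step_converges[OF cut_field_continuous M])
    show "u t = flow (s * t) z" if "u 0 = z" "continuous_on {0..1} u"
      "\<And>t. t \<in> {0..1} \<Longrightarrow> (u has_vector_derivative cut_field R s 0 (u t)) (at t within {0..1})"
      "t \<in> {0..1}" for u t
    proof (rule cut_field_unique[OF that(1-3) _ that(4)])
      show "norm (flow (s * t) z) < R" if "t \<in> {0..1}" for t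
        using B[OF that] by (simp add: R_def)
    qed
  qed (use e in auto)
  then show "\<forall>\<^sub>F n in sequentially. dist ((sympl_step (s / real n) ^^ n) z) (flow s z) < e"
    using eventually_gt_at_top[of 0]
  proof eventually_elim
    case (elim n)
    have "norm (one_step (cut_field R s) n z j) \<le> R" if "j \<le> n" for j
    proof -
      have "norm (flow (s * (real j / real n)) z) \<le> B" using that elim by (intro B) auto
      then show ?thesis
        using elim that norm_triangle_sub[of "one_step (cut_field R s) n z j"
          "flow (s * (real j / real n)) z"] unfolding R_def by fastforce
    qed
    then have "one_step (cut_field R s) n z n = (sympl_step (s / real n) ^^ n) z"
      using elim by (intro one_step_cut_field) auto
    then show ?case using elim by (auto simp: dist_norm)
  qed
qed

end

section \<open>Liouville's theorem\<close>

lemma borel_measurable_fst_snd [measurable (raw)]: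
  fixes f :: "'a \<Rightarrow> real \<times> real"
  assumes "f \<in> borel_measurable M"
  shows "(\<lambda>x. fst (f x)) \<in> borel_measurable M" "(\<lambda>x. snd (f x)) \<in> borel_measurable M"
  using borel_measurable_continuous_on[OF _ assms, of fst]
    borel_measurable_continuous_on[OF _ assms, of snd]
  by (simp_all add: continuous_on_fst continuous_on_snd)

lemma nn_integral_indicator_comp:
  assumes T: "T \<in> measurable M N" and A: "A \<in> sets N"
  shows "(\<integral>\<^sup>+x. indicator A (T x) \<partial>M) = emeasure (distr M N T) A"
  using assms by (subst nn_integral_distr[OF T, symmetric]) simp_all

lemma distr_lborel_eqI:
  fixes T :: "real \<times> real \<Rightarrow> real \<times> real"
  assumes [measurable]: "T \<in> borel_measurable borel"
    and eq: "\<And>f :: real \<times> real \<Rightarrow> ennreal. f \<in> borel_measurable borel \<Longrightarrow>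
      (\<integral>\<^sup>+z. f (T z) \<partial>lborel) = (\<integral>\<^sup>+z. f z \<partial>lborel)"
  shows "distr lborel borel T = lborel"
proof (rule measure_eqI)
  fix A assume "A \<in> sets (distr lborel borel T)"
  then have [measurable]: "A \<in> sets borel" by simp
  have "emeasure (distr lborel borel T) A = (\<integral>\<^sup>+z. indicator A (T z) \<partial>lborel)"
    by (subst nn_integral_indicator_comp[of T lborel borel]) auto
  also have "\<dots> = emeasure lborel A" by (subst eq) auto
  finally show "emeasure (distr lborel borel T) A = emeasure lborel A" .
qed simp

lemma nn_integral_lborel_translation:
  assumes "f \<in> borel_measurable borel"
  shows "(\<integral>\<^sup>+x. f (x + t) \<partial>lborel) = (\<integral>\<^sup>+x. f x \<partial>(lborel :: real measure))"
  using nn_integral_real_affine[OF assms, of 1 t] by (simp add: add.commute)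

lemma borel_measurable_pair_sections:
  fixes f :: "real \<times> real \<Rightarrow> 'c::topological_space"
  assumes "f \<in> borel_measurable borel"
  shows "f \<in> borel_measurable (lborel \<Otimes>\<^sub>M lborel)"
    "(\<lambda>x. f (x, p)) \<in> borel_measurable borel" "(\<lambda>p. f (x, p)) \<in> borel_measurable borel"
  using assms by (simp_all add: lborel_prod)

text \<open>Tonelli with the sheared coordinate innermost: for fixed p the shear is a translation by
  \<phi> p. Measurability of \<phi> is enough, no smoothness enters.\<close>

lemma distr_lborel_shear_fst:
  assumes [measurable]: "\<phi> \<in> borel_measurable borel"
  shows "distr lborel borel (\<lambda>z :: real \<times> real. (fst z + \<phi> (snd z), snd z)) = lborel"
proof (rule distr_lborel_eqI)
  show [measurable]: "(\<lambda>z :: real \<times> real. (fst z + \<phi> (snd z), snd z)) \<in> borel_measurable borel"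
    by (intro borel_measurable_Pair) measurable
  fix f :: "real \<times> real \<Rightarrow> ennreal"
  assume f [measurable]: "f \<in> borel_measurable borel"
  have m: "(\<lambda>z. f (fst z + \<phi> (snd z), snd z)) \<in> borel_measurable (lborel \<Otimes>\<^sub>M lborel)"
    by (simp add: lborel_prod)
  have "(\<integral>\<^sup>+z. f (fst z + \<phi> (snd z), snd z) \<partial>lborel) =
      (\<integral>\<^sup>+p. \<integral>\<^sup>+x. f (x + \<phi> p, p) \<partial>lborel \<partial>lborel)"
    using lborel_pair.nn_integral_snd[OF m] by (simp add: lborel_prod)
  also have "\<dots> = (\<integral>\<^sup>+p. \<integral>\<^sup>+x. f (x, p) \<partial>lborel \<partial>lborel)"
  proof (rule nn_integral_cong)
    fix p
    show "(\<integral>\<^sup>+x. f (x + \<phi> p, p) \<partial>lborel) = (\<integral>\<^sup>+x. f (x, p) \<partial>lborel)"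
      by (rule nn_integral_lborel_translation[OF borel_measurable_pair_sections(2)[OF f]])
  qed
  also have "\<dots> = (\<integral>\<^sup>+z. f z \<partial>lborel)"
    using lborel_pair.nn_integral_snd[OF borel_measurable_pair_sections(1)[OF f]]
    by (simp add: lborel_prod)
  finally show "(\<integral>\<^sup>+z. f (fst z + \<phi> (snd z), snd z) \<partial>lborel) = (\<integral>\<^sup>+z. f z \<partial>lborel)" .
qed

lemma distr_lborel_shear_snd:
  assumes [measurable]: "\<phi> \<in> borel_measurable borel"
  shows "distr lborel borel (\<lambda>z :: real \<times> real. (fst z, snd z + \<phi> (fst z))) = lborel"
proof (rule distr_lborel_eqI)
  show [measurable]: "(\<lambda>z :: real \<times> real. (fst z, snd z + \<phi> (fst z))) \<in> borel_measurable borel"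
    by (intro borel_measurable_Pair) measurable
  fix f :: "real \<times> real \<Rightarrow> ennreal"
  assume f [measurable]: "f \<in> borel_measurable borel"
  have m: "(\<lambda>z. f (fst z, snd z + \<phi> (fst z))) \<in> borel_measurable (lborel \<Otimes>\<^sub>M lborel)"
    by (simp add: lborel_prod)
  have "(\<integral>\<^sup>+z. f (fst z, snd z + \<phi> (fst z)) \<partial>lborel) =
      (\<integral>\<^sup>+x. \<integral>\<^sup>+p. f (x, p + \<phi> x) \<partial>lborel \<partial>lborel)"
    using lborel.nn_integral_fst[OF m] by (simp add: lborel_prod)
  also have "\<dots> = (\<integral>\<^sup>+x. \<integral>\<^sup>+p. f (x, p) \<partial>lborel \<partial>lborel)"
  proof (rule nn_integral_cong)
    fix x
    show "(\<integral>\<^sup>+p. f (x, p + \<phi> x) \<partial>lborel) = (\<integral>\<^sup>+p. f (x, p) \<partial>lborel)"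
      by (rule nn_integral_lborel_translation[OF borel_measurable_pair_sections(3)[OF f]])
  qed
  also have "\<dots> = (\<integral>\<^sup>+z. f z \<partial>lborel)"
    using lborel.nn_integral_fst[OF borel_measurable_pair_sections(1)[OF f]]
    by (simp add: lborel_prod)
  finally show "(\<integral>\<^sup>+z. f (fst z, snd z + \<phi> (fst z)) \<partial>lborel) = (\<integral>\<^sup>+z. f z \<partial>lborel)" .
qed

context hamiltonian_flow
begin

lemma dg_measurable [measurable]: "dg \<in> borel_measurable borel"
  by (rule borel_measurable_continuous_onI) (rule dg_cont)

lemma g_measurable [measurable]: "g \<in> borel_measurable borel"
  by (rule borel_measurable_continuous_onI)
    (meson DERIV_isCont continuous_at_imp_continuous_on g_deriv)

lemma sympl_step_measurable:
  assumes [measurable]: "h \<in> borel_measurable M" "q \<in> borel_measurable M"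
  shows "(\<lambda>x. sympl_step (h x) (q x)) \<in> borel_measurable M"
  unfolding sympl_step_def by (intro borel_measurable_Pair) measurable

text \<open>A pointwise limit of Euler iterates, which are measurable in time and state together.
  Both arguments may vary with x because later the time is sqrt \<nu> * t with \<nu> integrated
  out.\<close>

lemma flow_measurable:
  assumes [measurable]: "r \<in> borel_measurable M" "q \<in> borel_measurable M"
  shows "(\<lambda>x. flow (r x) (q x)) \<in> borel_measurable M"
proof (rule borel_measurable_LIMSEQ_metric[OF _ symplectic_euler_converges])
  fix n :: nat
  have "(\<lambda>x. (sympl_step (r x / real n) ^^ k) (q x)) \<in> borel_measurable M" for k
    by (induction k) (auto intro!: sympl_step_measurable)
  then show "(\<lambda>x. (sympl_step (r x / real n) ^^ n) (q x)) \<in> borel_measurable M" .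
qed

lemma flow_measurable' [measurable]: "flow s \<in> borel_measurable borel"
  using flow_measurable[of "\<lambda>_. s" borel "\<lambda>z. z"] by simp

lemma distr_sympl_step: "distr lborel borel (sympl_step h) = lborel"
proof -
  define S1 S2 where "S1 z = (fst z + h * snd z, snd z)" and "S2 z = (fst z, snd z + - h * dg (fst z))"
    for z :: "real \<times> real"
  have [measurable]: "S1 \<in> borel_measurable borel" "S2 \<in> borel_measurable borel"
    unfolding S1_def S2_def by (intro borel_measurable_Pair; measurable)+
  have "sympl_step h = S2 \<circ> S1"
    by (auto simp: sympl_step_def S1_def S2_def)
  then have "distr lborel borel (sympl_step h) = distr (distr lborel borel S1) borel S2"
    by (simp add: distr_distr)
  also have "distr lborel borel S1 = lborel"
    unfolding S1_def by (rule distr_lborel_shear_fst) measurable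
  also have "distr lborel borel S2 = lborel"
    unfolding S2_def by (rule distr_lborel_shear_snd) measurable
  finally show ?thesis .
qed

lemma distr_sympl_step_power: "distr lborel borel (sympl_step h ^^ n) = lborel"
proof (induction n)
  case 0
  then show ?case by (simp add: distr_id2 id_def)
next
  case (Suc n)
  have [measurable]: "sympl_step h \<in> borel_measurable borel"
    using sympl_step_measurable[of "\<lambda>_. h" borel "\<lambda>z. z"] by simp
  have [measurable]: "(sympl_step h ^^ n) \<in> borel_measurable borel"
    by (induction n) (auto simp: id_def comp_def)
  have "distr lborel borel (sympl_step h ^^ Suc n) =
      distr (distr lborel borel (sympl_step h ^^ n)) borel (sympl_step h)"
    by (simp add: distr_distr)
  also have "\<dots> = lborel" by (simp add: Suc distr_sympl_step)
  finally show ?case .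
qed

text \<open>
  The indicator of an open set is lower semicontinuous, so Fatou's lemma passes from the
  measure preserving symplectic Euler scheme to its limit, at the price of an inequality.
\<close>

lemma emeasure_flow_vimage_open:
  assumes U: "open U"
  shows "emeasure lborel (flow s -` U) \<le> emeasure lborel U"
proof -
  have [measurable]: "U \<in> sets borel" using U by simp
  define T where "T n = sympl_step (s / real n) ^^ n" for n
  have T [measurable]: "T n \<in> borel_measurable borel" for n
  proof -
    have "(\<lambda>z. (sympl_step (s / real n) ^^ k) z) \<in> borel_measurable borel" for k
      by (induction k) (auto intro!: sympl_step_measurable)
    then show ?thesis by (simp add: T_def)
  qed
  have "emeasure lborel (flow s -` U) = (\<integral>\<^sup>+z. indicator U (flow s z) \<partial>lborel)"
    by (subst nn_integral_indicator_comp[of _ _ borel]) (auto simp: emeasure_distr)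
  also have "\<dots> \<le> (\<integral>\<^sup>+z. liminf (\<lambda>n. indicator U (T n z)) \<partial>lborel)"
  proof (rule nn_integral_mono)
    fix z
    show "(indicator U (flow s z) :: ennreal) \<le> liminf (\<lambda>n. indicator U (T n z))"
    proof (cases "flow s z \<in> U")
      case True
      then have "\<forall>\<^sub>F n in sequentially. T n z \<in> U"
        unfolding T_def using topological_tendstoD[OF symplectic_euler_converges U] by blast
      then have "\<forall>\<^sub>F n in sequentially. (1 :: ennreal) \<le> indicator U (T n z)"
        by eventually_elim simp
      then have "1 \<le> liminf (\<lambda>n. indicator U (T n z) :: ennreal)"
        by (rule Liminf_bounded)
      with True show ?thesis by simp
    qed simp
  qed
  also have "\<dots> \<le> liminf (\<lambda>n. \<integral>\<^sup>+z. indicator U (T n z) \<partial>lborel)"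
    by (rule nn_integral_liminf) measurable
  also have "\<dots> = emeasure lborel U"
  proof -
    have "(\<integral>\<^sup>+z. indicator U (T n z) \<partial>lborel) = emeasure lborel U" for n
      using distr_sympl_step_power[of n "s / real n"]
      by (subst nn_integral_indicator_comp[of _ _ borel]) (auto simp: T_def[symmetric])
    then show ?thesis by (simp add: Liminf_const)
  qed
  finally show ?thesis .
qed

text \<open>Outer regularity of Lebesgue measure passes from open sets to Borel sets. One inequality
  is enough for \<open>liouville\<close>, where it is applied to the inverse flow as well.\<close>

lemma emeasure_flow_vimage_le:
  assumes B [measurable]: "B \<in> sets borel"
  shows "emeasure lborel (flow s -` B) \<le> emeasure lborel B"
proof (rule ennreal_le_epsilon)
  fix e :: real assume "0 < e"
  then obtain U where U: "open U" "B \<subseteq> U" and e: "emeasure lborel (U - B) < e"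
    using outer_regular_lborel[OF B] by blast
  have [measurable]: "U \<in> sets borel" using U(1) by simp
  have "emeasure lborel (flow s -` B) \<le> emeasure lborel (flow s -` U)"
    using measurable_sets[OF flow_measurable' \<open>U \<in> sets borel\<close>, of s] U(2)
    by (intro emeasure_mono) auto
  also have "\<dots> \<le> emeasure lborel U" by (rule emeasure_flow_vimage_open[OF U(1)])
  also have "\<dots> = emeasure lborel (B \<union> (U - B))" using U(2) by (simp add: Un_absorb1)
  also have "\<dots> \<le> emeasure lborel B + emeasure lborel (U - B)"
    by (rule emeasure_subadditive) auto
  also have "\<dots> \<le> emeasure lborel B + ennreal e" using e by (intro add_left_mono) simp
  finally show "emeasure lborel (flow s -` B) \<le> emeasure lborel B + ennreal e" .
qed

theorem liouville: "distr lborel borel (flow s) = lborel"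
proof (rule measure_eqI)
  fix B assume "B \<in> sets (distr lborel borel (flow s))"
  then have [measurable]: "B \<in> sets borel" by simp
  have B': "flow s -` B \<in> sets borel"
    using measurable_sets[OF flow_measurable' \<open>B \<in> sets borel\<close>, of s] by simp
  have "flow (- s) -` (flow s -` B) = B"
    unfolding vimage_def by simp
  then have "emeasure lborel B \<le> emeasure lborel (flow s -` B)"
    using emeasure_flow_vimage_le[OF B', of "- s"] by simp
  then have "emeasure lborel (flow s -` B) = emeasure lborel B"
    using emeasure_flow_vimage_le[of B s] by (intro antisym) auto
  then show "emeasure (distr lborel borel (flow s)) B = emeasure lborel B"
    by (subst emeasure_distr) auto
qed simp

section \<open>Conservation of energy and invariance of the Gibbs measure\<close>

definition energy :: "real \<times> real \<Rightarrow> real" where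
  "energy z = g (fst z) + (snd z)\<^sup>2 / 2"

lemma energy_flow: "energy (flow s z) = energy z"
proof -
  have "((\<lambda>s. energy (flow s z)) has_real_derivative 0) (at t)" for t
    unfolding energy_def flow_def fst_conv snd_conv power2_eq_square
    by (rule DERIV_cong[OF DERIV_add[OF DERIV_chain2[OF g_deriv a_solves]
          DERIV_cdivide[OF DERIV_mult[OF ad_solves ad_solves]]]]) simp
  from DERIV_isconst_all[of "\<lambda>s. energy (flow s z)" s 0] this show ?thesis by simp
qed

text \<open>The law of (sqrt \<nu> * X, P) is this measure for every \<nu>. After rescaling, the
  parameter \<nu> survives only in the speed of time and a prefactor sqrt \<nu>.\<close>

definition gibbs :: "(real \<times> real) measure" where
  "gibbs = density lborel (\<lambda>y. exp (- g y)) \<Otimes>\<^sub>M N01"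

lemma sets_gibbs [measurable_cong, simp]: "sets gibbs = sets borel"
proof -
  have "sets gibbs = sets (borel \<Otimes>\<^sub>M borel)"
    unfolding gibbs_def by (intro sets_pair_measure_cong) auto
  also have "\<dots> = sets (borel :: (real \<times> real) measure)"
    by (simp only: borel_prod)
  finally show ?thesis .
qed

lemma space_gibbs [simp]: "space gibbs = UNIV"
  using sets_eq_imp_space_eq[OF sets_gibbs] by simp

lemma gibbs_density: "gibbs = density lborel (\<lambda>z. ennreal (exp (- energy z) / sqrt (2 * pi)))"
proof -
  interpret N: prob_space N01 by (rule prob_space_N01)
  have "gibbs = density (lborel \<Otimes>\<^sub>M lborel)
      (\<lambda>(x, y). ennreal (exp (- g x)) * ennreal (std_normal_density y))"
    unfolding gibbs_def N01_def
    by (rule pair_measure_density)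
      (auto intro: lborel.sigma_finite_measure_axioms N.sigma_finite_measure_axioms[unfolded N01_def])
  also have "(\<lambda>(x, y). ennreal (exp (- g x)) * ennreal (std_normal_density y)) =
      (\<lambda>z. ennreal (exp (- energy z) / sqrt (2 * pi)))"
    by (auto simp: fun_eq_iff energy_def normal_density_def exp_add[symmetric] exp_diff exp_minus
        ennreal_mult[symmetric] divide_simps)
  finally show ?thesis by (simp add: lborel_prod)
qed

theorem gibbs_invariant: "distr gibbs borel (flow s) = gibbs"
proof (rule measure_eqI)
  have [measurable]: "energy \<in> borel_measurable borel" unfolding energy_def by measurable
  define \<rho> where "\<rho> z = ennreal (exp (- energy z) / sqrt (2 * pi))" for z
  have [measurable]: "\<rho> \<in> borel_measurable borel" unfolding \<rho>_def by measurable
  have \<rho>: "\<rho> (flow s z) = \<rho> z" for z by (simp add: \<rho>_def energy_flow)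
  have G: "gibbs = density lborel \<rho>" unfolding gibbs_density \<rho>_def ..
  fix B assume "B \<in> sets (distr gibbs borel (flow s))"
  then have B [measurable]: "B \<in> sets borel" by simp
  have "emeasure (distr gibbs borel (flow s)) B = emeasure gibbs (flow s -` B)"
    by (subst emeasure_distr) auto
  also have "\<dots> = (\<integral>\<^sup>+z. \<rho> z * indicator (flow s -` B) z \<partial>lborel)"
    unfolding G using measurable_sets[OF flow_measurable' B, of s]
    by (subst emeasure_density) auto
  also have "\<dots> = (\<integral>\<^sup>+z. \<rho> (flow s z) * indicator B (flow s z) \<partial>lborel)"
    by (auto simp: \<rho> intro!: nn_integral_cong split: split_indicator)
  also have "\<dots> = (\<integral>\<^sup>+z. \<rho> z * indicator B z \<partial>distr lborel borel (flow s))"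
    by (subst nn_integral_distr) auto
  also have "\<dots> = emeasure gibbs B"
    unfolding liouville G by (subst emeasure_density) auto
  finally show "emeasure (distr gibbs borel (flow s)) B = emeasure gibbs B" .
qed simp

end

section \<open>The stationary process\<close>

text \<open>\<open>Vfun\<close> groups its variables as (X, (P, \<nu>)), whereas stationarity
  concerns the pair (X, P) at fixed \<nu>; this regrouping makes Fubini applicable.\<close>

lemma distr_pair_assoc:
  assumes A: "prob_space A" and B: "prob_space B" and C: "prob_space C"
  shows "distr (A \<Otimes>\<^sub>M (B \<Otimes>\<^sub>M C)) ((A \<Otimes>\<^sub>M B) \<Otimes>\<^sub>M C) (\<lambda>(x, y, w). ((x, y), w)) =
    (A \<Otimes>\<^sub>M B) \<Otimes>\<^sub>M C" (is "distr ?L ?R ?f = _")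
proof (rule measure_eqI)
  interpret B: prob_space B by fact
  interpret C: prob_space C by fact
  interpret BC: prob_space "B \<Otimes>\<^sub>M C" by (rule prob_space_pair[OF B C])
  fix X assume "X \<in> sets (distr ?L ?R ?f)"
  then have X [measurable]: "X \<in> sets ?R" by simp
  define f where "f = (indicator X :: _ \<Rightarrow> ennreal)"
  have [measurable]: "f \<in> borel_measurable ?R" by (simp add: f_def)
  have "emeasure (distr ?L ?R ?f) X =
      (\<integral>\<^sup>+v. f ((fst v, fst (snd v)), snd (snd v)) \<partial>?L)"
    unfolding f_def
    by (subst nn_integral_indicator_comp) (auto simp: case_prod_beta')
  also have "\<dots> = (\<integral>\<^sup>+x. \<integral>\<^sup>+v. f ((x, fst v), snd v) \<partial>(B \<Otimes>\<^sub>M C) \<partial>A)"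
    by (subst BC.nn_integral_fst[symmetric]) auto
  also have "\<dots> = (\<integral>\<^sup>+x. \<integral>\<^sup>+y. \<integral>\<^sup>+w. f ((x, y), w) \<partial>C \<partial>B \<partial>A)"
    by (intro nn_integral_cong, subst C.nn_integral_fst[symmetric]) auto
  also have "\<dots> = (\<integral>\<^sup>+v. \<integral>\<^sup>+w. f (v, w) \<partial>C \<partial>(A \<Otimes>\<^sub>M B))"
    by (subst B.nn_integral_fst[symmetric]) auto
  also have "\<dots> = (\<integral>\<^sup>+v. f v \<partial>?R)"
    by (rule C.nn_integral_fst) simp
  finally show "emeasure (distr ?L ?R ?f) X =
      emeasure ?R X"
    by (simp add: f_def)
qed simp

locale gibbs_flow = hamiltonian_flow +
  assumes g_norm: "has_bochner_integral lborel (\<lambda>y. exp (- g y)) 1"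
    and dg_square: "integrable lborel (\<lambda>y. (dg y)\<^sup>2 * exp (- g y))"
begin

definition \<pi>1 :: "real measure" where
  "\<pi>1 = density lborel (\<lambda>y. exp (- g y))"

lemma sets_\<pi>1 [measurable_cong, simp]: "sets \<pi>1 = sets borel"
  by (simp add: \<pi>1_def)

lemma prob_space_\<pi>1: "prob_space \<pi>1"
proof
  have "emeasure \<pi>1 (space \<pi>1) = (\<integral>\<^sup>+y. ennreal (exp (- g y)) \<partial>lborel)"
    unfolding \<pi>1_def by (subst emeasure_density) auto
  also have "\<dots> = ennreal 1"
    using g_norm by (subst nn_integral_eq_integral) (auto simp: has_bochner_integral_iff)
  finally show "emeasure \<pi>1 (space \<pi>1) = 1" by simp
qed

lemma gibbs_pair: "gibbs = \<pi>1 \<Otimes>\<^sub>M N01"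
  by (simp add: gibbs_def \<pi>1_def)

sublocale G: prob_space gibbs
  unfolding gibbs_pair by (rule prob_space_pair[OF prob_space_\<pi>1 prob_space_N01])

lemma gibbs_measurable_pair:
  "f \<in> borel_measurable borel \<Longrightarrow> f \<in> borel_measurable (\<pi>1 \<Otimes>\<^sub>M N01)"
  unfolding gibbs_pair[symmetric] measurable_cong_sets[OF sets_gibbs refl] .

lemma integrable_gibbs_flow:
  fixes f :: "real \<times> real \<Rightarrow> 'b::{banach, second_countable_topology}"
  assumes [measurable]: "f \<in> borel_measurable borel"
  shows "integrable gibbs (\<lambda>z. f (flow s z)) \<longleftrightarrow> integrable gibbs f"
proof -
  have "integrable (distr gibbs borel (flow s)) f \<longleftrightarrow> integrable gibbs (\<lambda>z. f (flow s z))"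
    by (rule integrable_distr_eq) auto
  then show ?thesis by (simp add: gibbs_invariant)
qed

lemma integral_gibbs_flow:
  fixes f :: "real \<times> real \<Rightarrow> 'b::{banach, second_countable_topology}"
  assumes [measurable]: "f \<in> borel_measurable borel"
  shows "(\<integral>z. f (flow s z) \<partial>gibbs) = (\<integral>z. f z \<partial>gibbs)"
proof -
  have "(\<integral>z. f z \<partial>distr gibbs borel (flow s)) = (\<integral>z. f (flow s z) \<partial>gibbs)"
    by (rule integral_distr) auto
  then show ?thesis by (simp add: gibbs_invariant)
qed

text \<open>The rate of change of the potential g along the trajectory. A coordinate with parameter
  \<nu> contributes sqrt \<nu> * Y (sqrt \<nu> * t) to the sum in \<open>Dd\<close>.\<close>

definition Y :: "real \<Rightarrow> real \<times> real \<Rightarrow> real" where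
  "Y s z = dg (fst (flow s z)) * snd (flow s z)"

lemma Y_measurable [measurable]:
  assumes [measurable]: "r \<in> borel_measurable M" "q \<in> borel_measurable M"
  shows "(\<lambda>x. Y (r x) (q x)) \<in> borel_measurable M"
proof -
  have [measurable]: "(\<lambda>x. flow (r x) (q x)) \<in> borel_measurable M"
    by (rule flow_measurable) fact+
  show ?thesis unfolding Y_def by measurable
qed

lemma Y_flow: "Y s (flow r z) = Y (s + r) z"
  by (simp add: Y_def flow_flow)

lemma Y_0: "Y 0 z = dg (fst z) * snd z"
  by (simp add: Y_def)

lemma Y0_flow: "Y 0 (flow s z) = Y s z"
  by (simp add: Y_flow)

lemma Y_continuous: "continuous_on UNIV (\<lambda>s. Y s z)"
proof -
  have "continuous_on UNIV (\<lambda>s. flow s z)"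
    using scaled_flow_continuous[of UNIV 1 z] by simp
  then show ?thesis unfolding Y_def by (intro continuous_intros)
qed

lemma Y_square_integrable: "integrable gibbs (\<lambda>z. (Y s z)\<^sup>2)"
proof -
  interpret N: prob_space N01 by (rule prob_space_N01)
  have N2: "integrable N01 (\<lambda>p. p\<^sup>2)"
    unfolding N01_def by (rule integrable_std_normal_distribution_moment)
  have dg2: "integrable \<pi>1 (\<lambda>x. (dg x)\<^sup>2)"
    unfolding \<pi>1_def using dg_square by (subst integrable_density) (auto simp: mult.commute)
  have "integrable gibbs (\<lambda>z. (Y 0 z)\<^sup>2)"
  proof (rule integrableI_bounded)
    have "(\<integral>\<^sup>+z. norm ((Y 0 z)\<^sup>2) \<partial>gibbs) = (\<integral>\<^sup>+x. \<integral>\<^sup>+p. ennreal ((dg x)\<^sup>2) * ennreal (p\<^sup>2) \<partial>N01 \<partial>\<pi>1)"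
      unfolding gibbs_pair
      by (subst N.nn_integral_fst[symmetric])
        (auto simp: Y_0 power_mult_distrib ennreal_mult' intro!: gibbs_measurable_pair)
    also have "\<dots> = (\<integral>\<^sup>+x. ennreal ((dg x)\<^sup>2) \<partial>\<pi>1) * (\<integral>\<^sup>+p. ennreal (p\<^sup>2) \<partial>N01)"
      by (simp add: nn_integral_cmult nn_integral_multc)
    also have "\<dots> < \<infinity>"
      using N2 dg2 by (subst (1 2) nn_integral_eq_integral) (auto simp flip: ennreal_mult')
    finally show "(\<integral>\<^sup>+z. norm ((Y 0 z)\<^sup>2) \<partial>gibbs) < \<infinity>" .
  qed measurable
  then show ?thesis
    using integrable_gibbs_flow[of "\<lambda>z. (Y 0 z)\<^sup>2" s] by (simp add: Y0_flow)
qed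

lemma Y_integrable: "integrable gibbs (Y s)"
  by (rule G.square_integrable_imp_integrable[OF _ Y_square_integrable]) measurable

text \<open>At time 0 the momentum is centred and independent of the position; invariance carries
  this to every time.\<close>

lemma Y_expectation: "(\<integral>z. Y s z \<partial>gibbs) = 0"
proof -
  interpret N: prob_space N01 by (rule prob_space_N01)
  interpret P: prob_space \<pi>1 by (rule prob_space_\<pi>1)
  interpret pair_sigma_finite \<pi>1 N01 ..
  have "(\<integral>z. Y 0 z \<partial>gibbs) = (\<integral>x. \<integral>p. Y 0 (x, p) \<partial>N01 \<partial>\<pi>1)"
    using integral_fst'[of "Y 0"] Y_integrable[of 0] by (simp add: gibbs_pair)
  also have "\<dots> = 0"
    using integral_std_normal_distribution_moment_odd[of 1] by (simp add: Y_0 N01_def)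
  finally show ?thesis
    using integral_gibbs_flow[of "Y 0" s] by (simp add: Y0_flow)
qed

definition autocov :: "real \<Rightarrow> real" where
  "autocov s = (\<integral>z. Y 0 z * Y s z \<partial>gibbs)"

lemma Y_prod_integrable: "integrable gibbs (\<lambda>z. Y s z * Y r z)"
proof (rule Bochner_Integration.integrable_bound)
  show "integrable gibbs (\<lambda>z. (Y s z)\<^sup>2 + (Y r z)\<^sup>2)"
    using Y_square_integrable by simp
  show "AE z in gibbs. norm (Y s z * Y r z) \<le> norm ((Y s z)\<^sup>2 + (Y r z)\<^sup>2)"
  proof (rule AE_I2)
    fix z
    have "2 * \<bar>Y s z\<bar> * \<bar>Y r z\<bar> \<le> (Y s z)\<^sup>2 + (Y r z)\<^sup>2"
      using sum_squares_bound[of "\<bar>Y s z\<bar>" "\<bar>Y r z\<bar>"] by simp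
    moreover have "0 \<le> \<bar>Y s z\<bar> * \<bar>Y r z\<bar>" by simp
    ultimately have "\<bar>Y s z\<bar> * \<bar>Y r z\<bar> \<le> (Y s z)\<^sup>2 + (Y r z)\<^sup>2" by linarith
    then show "norm (Y s z * Y r z) \<le> norm ((Y s z)\<^sup>2 + (Y r z)\<^sup>2)"
      by (simp add: abs_mult)
  qed
qed measurable

lemma Y_prod_expectation: "(\<integral>z. Y s z * Y r z \<partial>gibbs) = autocov (r - s)"
  using integral_gibbs_flow[of "\<lambda>z. Y 0 z * Y (r - s) z" s] by (simp add: autocov_def Y_flow)

lemma autocov_minus: "autocov (- s) = autocov s"
  using Y_prod_expectation[of s 0] by (simp add: autocov_def mult.commute)

lemma autocov_0: "autocov 0 = (\<integral>z. (Y s z)\<^sup>2 \<partial>gibbs)"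
  using Y_prod_expectation[of s s] by (simp add: power2_eq_square)

lemma autocov_0_nonneg: "0 \<le> autocov 0"
  unfolding autocov_0[of 0] by simp

lemma expectation_Y_sum_diff:
  "(\<integral>z. (Y 0 z + Y s z)\<^sup>2 \<partial>gibbs) = 2 * autocov 0 + 2 * autocov s"
  "(\<integral>z. (Y 0 z - Y s z)\<^sup>2 \<partial>gibbs) = 2 * autocov 0 - 2 * autocov s"
  using Y_square_integrable[of 0] Y_square_integrable[of s] Y_prod_integrable[of 0 s] autocov_0[of 0] autocov_0[of s]
  by (simp_all add: power2_sum power2_diff autocov_def mult.assoc)

lemma Y_sum_diff_integrable:
  "integrable gibbs (\<lambda>z. (Y 0 z + Y s z)\<^sup>2)" "integrable gibbs (\<lambda>z. (Y 0 z - Y s z)\<^sup>2)"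
  using Y_square_integrable[of 0] Y_square_integrable[of s] Y_prod_integrable[of 0 s]
  by (simp_all add: power2_sum power2_diff mult.assoc)

lemma abs_autocov_le: "\<bar>autocov s\<bar> \<le> autocov 0"
proof -
  have "0 \<le> 2 * autocov 0 + 2 * autocov s" "0 \<le> 2 * autocov 0 - 2 * autocov s"
    unfolding expectation_Y_sum_diff[symmetric] by simp_all
  then show ?thesis by linarith
qed

text \<open>
  No uniform integrability is needed: by Fatou's lemma both 2 autocov(0) + 2 autocov(s) and
  2 autocov(0) - 2 autocov(s), second moments of the sum and of the difference, are lower semicontinuous.
\<close>

lemma autocov_continuous: "continuous_on UNIV autocov"
proof -
  have key: "\<forall>\<^sub>F n in sequentially. l - e < \<integral>z. (f (x n) z)\<^sup>2 \<partial>gibbs"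
    if x: "x \<longlonglongrightarrow> s" and e: "0 < e" and f: "\<And>z. continuous_on UNIV (\<lambda>s. f s z)"
      and int: "\<And>s. integrable gibbs (\<lambda>z. (f s z)\<^sup>2)" and l: "l = (\<integral>z. (f s z)\<^sup>2 \<partial>gibbs)"
    for x s e l and f :: "real \<Rightarrow> real \<times> real \<Rightarrow> real"
  proof -
    have int': "(\<integral>\<^sup>+z. ennreal ((f s z)\<^sup>2) \<partial>gibbs) = ennreal (\<integral>z. (f s z)\<^sup>2 \<partial>gibbs)" for s
      by (rule nn_integral_eq_integral[OF int]) simp
    have "ennreal l = (\<integral>\<^sup>+z. ennreal ((f s z)\<^sup>2) \<partial>gibbs)" by (simp add: l int')
    also have "\<dots> = (\<integral>\<^sup>+z. liminf (\<lambda>n. ennreal ((f (x n) z)\<^sup>2)) \<partial>gibbs)"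
    proof (rule nn_integral_cong)
      fix z
      have "(\<lambda>n. f (x n) z) \<longlonglongrightarrow> f s z"
        by (rule continuous_on_tendsto_compose[OF f x]) auto
      then have "(\<lambda>n. ennreal ((f (x n) z)\<^sup>2)) \<longlonglongrightarrow> ennreal ((f s z)\<^sup>2)"
        by (intro tendsto_ennrealI tendsto_power)
      then show "ennreal ((f s z)\<^sup>2) = liminf (\<lambda>n. ennreal ((f (x n) z)\<^sup>2))"
        by (rule lim_imp_Liminf[OF sequentially_bot, symmetric])
    qed
    also have "\<dots> \<le> liminf (\<lambda>n. \<integral>\<^sup>+z. ennreal ((f (x n) z)\<^sup>2) \<partial>gibbs)"
      by (rule nn_integral_liminf) (use int in \<open>auto intro: borel_measurable_integrable\<close>)
    also have "\<dots> = liminf (\<lambda>n. ennreal (\<integral>z. (f (x n) z)\<^sup>2 \<partial>gibbs))" by (simp add: int')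
    finally have le: "ennreal l \<le> liminf (\<lambda>n. ennreal (\<integral>z. (f (x n) z)\<^sup>2 \<partial>gibbs))" .
    show ?thesis
    \<comment> \<open>Negative numbers are split off because \<open>ennreal\<close> maps them to
      0.\<close>
    proof (cases "l - e < 0")
      case True
      then have "l - e < \<integral>z. (f (x n) z)\<^sup>2 \<partial>gibbs" for n
        by (rule less_le_trans) simp
      then show ?thesis by simp
    next
      case False
      then have "ennreal (l - e) < ennreal l" using e by (simp add: ennreal_less_iff)
      then have "ennreal (l - e) < liminf (\<lambda>n. ennreal (\<integral>z. (f (x n) z)\<^sup>2 \<partial>gibbs))"
        using le by (rule less_le_trans)
      then have "\<forall>\<^sub>F n in sequentially. ennreal (l - e) < ennreal (\<integral>z. (f (x n) z)\<^sup>2 \<partial>gibbs)"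
        by (rule less_LiminfD)
      then show ?thesis using False by (auto simp: ennreal_less_iff elim: eventually_mono)
    qed
  qed
  show ?thesis
    unfolding continuous_on_sequentially
  proof (intro allI ballI impI)
    fix x :: "nat \<Rightarrow> real" and s
    assume "(\<forall>n. x n \<in> UNIV) \<and> x \<longlonglongrightarrow> s"
    then have x: "x \<longlonglongrightarrow> s" by simp
    show "(autocov \<circ> x) \<longlonglongrightarrow> autocov s"
    proof (rule tendstoI)
      fix e :: real assume "0 < e"
      \<comment> \<open>The second moments of sum and difference contain autocov s with factors 2
        and -2, so lower bounds with tolerance 2 * e give a two-sided bound with tolerance
        e.\<close>
      then have e: "0 < 2 * e" by simp
      have f: "continuous_on UNIV (\<lambda>s. Y 0 z + Y s z)" "continuous_on UNIV (\<lambda>s. Y 0 z - Y s z)" for z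
        by (intro continuous_intros Y_continuous)+
      show "\<forall>\<^sub>F n in sequentially. dist ((autocov \<circ> x) n) (autocov s) < e"
        using key[OF x e f(1) Y_sum_diff_integrable(1) refl] key[OF x e f(2) Y_sum_diff_integrable(2) refl]
        unfolding expectation_Y_sum_diff
        by eventually_elim (auto simp: dist_real_def)
    qed
  qed
qed

lemma autocov_measurable [measurable]: "autocov \<in> borel_measurable borel"
  by (rule borel_measurable_continuous_onI[OF autocov_continuous])

text \<open>Fubini. Joint integrability follows from the bound of a product by the sum of squares:
  by stationarity the inner integral is at most \<bar>\<nu>\<bar> * (2 * autocov 0), whatever the
  time, and \<nu> is integrable.\<close>

lemma Vfun_eq:
  assumes \<mu>: "prob_space \<mu>" and [measurable_cong]: "sets \<mu> = sets borel"
    and int: "integrable \<mu> (\<lambda>\<nu>. \<nu>)"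
  shows "Vfun g dg a ad \<mu> t = (\<integral>\<nu>. \<nu> * autocov (sqrt \<nu> * t) \<partial>\<mu>)"
proof -
  interpret \<mu>: prob_space \<mu> by fact
  interpret pair_sigma_finite gibbs \<mu> ..
  define F where "F z \<nu> = \<nu> * (Y 0 z * Y (sqrt \<nu> * t) z)" for z \<nu>
  have sp: "sets (gibbs \<Otimes>\<^sub>M \<mu>) = sets (borel \<Otimes>\<^sub>M borel)"
    by (intro sets_pair_measure_cong) (simp_all add: assms)
  have F_meas [measurable]: "case_prod F \<in> borel_measurable (gibbs \<Otimes>\<^sub>M \<mu>)"
    unfolding F_def case_prod_beta' by measurable
  have F_bound: "ennreal (norm (F z \<nu>)) \<le> ennreal (\<bar>\<nu>\<bar> * (Y 0 z)\<^sup>2) + ennreal (\<bar>\<nu>\<bar> * (Y (sqrt \<nu> * t) z)\<^sup>2)" for z \<nu>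
  proof -
    have "2 * \<bar>Y 0 z\<bar> * \<bar>Y (sqrt \<nu> * t) z\<bar> \<le> (Y 0 z)\<^sup>2 + (Y (sqrt \<nu> * t) z)\<^sup>2"
      using sum_squares_bound[of "\<bar>Y 0 z\<bar>" "\<bar>Y (sqrt \<nu> * t) z\<bar>"] by simp
    moreover have "0 \<le> \<bar>Y 0 z\<bar> * \<bar>Y (sqrt \<nu> * t) z\<bar>" by simp
    ultimately have "\<bar>Y 0 z\<bar> * \<bar>Y (sqrt \<nu> * t) z\<bar> \<le> (Y 0 z)\<^sup>2 + (Y (sqrt \<nu> * t) z)\<^sup>2" by linarith
    then have "norm (F z \<nu>) \<le> \<bar>\<nu>\<bar> * ((Y 0 z)\<^sup>2 + (Y (sqrt \<nu> * t) z)\<^sup>2)"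
      unfolding F_def real_norm_def abs_mult by (rule mult_left_mono) simp
    then show ?thesis
      by (simp add: distrib_left ennreal_leI flip: ennreal_plus)
  qed
  have Y2: "(\<integral>\<^sup>+z. ennreal (\<bar>\<nu>\<bar> * (Y s z)\<^sup>2) \<partial>gibbs) = ennreal (\<bar>\<nu>\<bar> * autocov 0)" for \<nu> s
    using Y_square_integrable[of s] autocov_0[of s] by (subst nn_integral_eq_integral) auto
  have "integrable (gibbs \<Otimes>\<^sub>M \<mu>) (case_prod F)"
  proof (rule integrableI_bounded)
    have "(\<integral>\<^sup>+v. norm (case_prod F v) \<partial>(gibbs \<Otimes>\<^sub>M \<mu>)) = (\<integral>\<^sup>+\<nu>. \<integral>\<^sup>+z. norm (F z \<nu>) \<partial>gibbs \<partial>\<mu>)"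
      by (subst nn_integral_snd[symmetric]) auto
    also have "\<dots> \<le> (\<integral>\<^sup>+\<nu>. \<integral>\<^sup>+z. ennreal (\<bar>\<nu>\<bar> * (Y 0 z)\<^sup>2) + ennreal (\<bar>\<nu>\<bar> * (Y (sqrt \<nu> * t) z)\<^sup>2) \<partial>gibbs \<partial>\<mu>)"
      by (intro nn_integral_mono F_bound)
    also have "\<dots> = (\<integral>\<^sup>+\<nu>. ennreal (\<bar>\<nu>\<bar> * autocov 0) + ennreal (\<bar>\<nu>\<bar> * autocov 0) \<partial>\<mu>)"
      by (subst nn_integral_add) (auto simp: Y2)
    also have "\<dots> = (\<integral>\<^sup>+\<nu>. ennreal (\<bar>\<nu>\<bar> * (2 * autocov 0)) \<partial>\<mu>)"
      using autocov_0_nonneg by (intro nn_integral_cong) (simp flip: ennreal_plus)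
    also have "\<dots> < \<infinity>"
      using int autocov_0_nonneg by (subst nn_integral_eq_integral) auto
    finally show "(\<integral>\<^sup>+v. norm (case_prod F v) \<partial>(gibbs \<Otimes>\<^sub>M \<mu>)) < \<infinity>" .
  qed simp
  then have "(\<integral>\<nu>. \<integral>z. F z \<nu> \<partial>gibbs \<partial>\<mu>) = (\<integral>v. case_prod F v \<partial>(gibbs \<Otimes>\<^sub>M \<mu>))"
    by (rule integral_snd)
  also have "\<dots> = (\<integral>v. case_prod F v \<partial>distr (\<pi>1 \<Otimes>\<^sub>M (N01 \<Otimes>\<^sub>M \<mu>)) ((\<pi>1 \<Otimes>\<^sub>M N01) \<Otimes>\<^sub>M \<mu>) (\<lambda>(x, y, w). ((x, y), w)))"
    unfolding distr_pair_assoc[OF prob_space_\<pi>1 prob_space_N01 \<mu>] gibbs_pair ..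
  also have "\<dots> = (\<integral>(x, p, \<nu>). F (x, p) \<nu> \<partial>(\<pi>1 \<Otimes>\<^sub>M (N01 \<Otimes>\<^sub>M \<mu>)))"
    using F_meas by (subst integral_distr) (auto simp: gibbs_pair case_prod_beta')
  also have "\<dots> = Vfun g dg a ad \<mu> t"
    unfolding Vfun_def \<pi>1_def[symmetric]
    by (intro Bochner_Integration.integral_cong) (auto simp: F_def Y_def flow_def a_init ad_init mult_ac)
  finally show ?thesis by (simp add: F_def autocov_def)
qed

end

section \<open>A strong law of large numbers\<close>

lemma cesaro_null:
  fixes x :: "nat \<Rightarrow> real"
  assumes "x \<longlonglongrightarrow> 0"
  shows "(\<lambda>n. (\<Sum>i<n. x i) / real n) \<longlonglongrightarrow> 0"
proof (rule LIMSEQ_I)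
  fix e :: real assume e: "0 < e"
  then obtain N where N: "\<And>i. i \<ge> N \<Longrightarrow> \<bar>x i\<bar> < e / 2"
    using LIMSEQ_D[OF assms, of "e / 2"] by auto
  define B where "B = (\<Sum>i<N. \<bar>x i\<bar>)"
  have "(\<lambda>n. B / real n) \<longlonglongrightarrow> 0" by real_asymp
  then obtain N' where N': "\<And>n. n \<ge> N' \<Longrightarrow> \<bar>B / real n\<bar> < e / 2"
    using LIMSEQ_D[of "\<lambda>n. B / real n" 0 "e / 2"] e by auto
  have "norm ((\<Sum>i<n. x i) / real n - 0) < e" if n: "n \<ge> max (Suc N) N'" for n
  proof -
    have "\<bar>\<Sum>i<n. x i\<bar> \<le> (\<Sum>i<n. \<bar>x i\<bar>)" by (rule sum_abs)
    also have "\<dots> = B + (\<Sum>i\<in>{N..<n}. \<bar>x i\<bar>)"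
      unfolding B_def using n
      by (subst sum.atLeastLessThan_concat[of 0 N n, symmetric, unfolded atLeast0LessThan]) auto
    also have "(\<Sum>i\<in>{N..<n}. \<bar>x i\<bar>) \<le> (\<Sum>i\<in>{N..<n}. e / 2)"
      by (intro sum_mono) (use N in \<open>auto intro: less_imp_le\<close>)
    also have "\<dots> \<le> real n * (e / 2)"
      using e n by (auto intro!: mult_right_mono)
    finally have "\<bar>\<Sum>i<n. x i\<bar> / real n \<le> (B + real n * (e / 2)) / real n"
      by (intro divide_right_mono) auto
    also have "\<dots> = B / real n + e / 2" using n by (simp add: add_divide_distrib)
    also have "\<dots> < e" using N'[of n] n by linarith
    finally show ?thesis by simp
  qed
  then show "\<exists>no. \<forall>n\<ge>no. norm ((\<Sum>i<n. x i) / real n - 0) < e" by blast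
qed

text \<open>The ratio of consecutive m-th powers tends to 1, so monotonicity fills the gaps.\<close>

lemma mean_converges_from_powers:
  fixes x :: "nat \<Rightarrow> real"
  assumes nonneg: "\<And>i. 0 \<le> x i" and m: "0 < m"
    and lim: "(\<lambda>k. (\<Sum>i<k ^ m. x i) / real (k ^ m)) \<longlonglongrightarrow> c"
  shows "(\<lambda>n. (\<Sum>i<n. x i) / real n) \<longlonglongrightarrow> c"
proof -
  define S where "S n = (\<Sum>i<n. x i)" for n
  have S_mono: "S i \<le> S j" if "i \<le> j" for i j
    unfolding S_def using that nonneg by (intro sum_mono2) auto
  have S0: "0 \<le> S n" for n unfolding S_def by (intro sum_nonneg nonneg)
  \<comment> \<open>The largest integer whose m-th power is at most n. Since the terms are
    nonnegative, S n lies between S at r^m and S at (r + 1)^m.\<close>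
  define r where "r n = nat \<lfloor>root m (real n)\<rfloor>" for n
  have r_le: "r n ^ m \<le> n" for n
  proof -
    have "real (r n) \<le> root m (real n)"
      unfolding r_def by (rule of_nat_floor) (simp add: real_root_ge_zero)
    then have "real (r n) ^ m \<le> root m (real n) ^ m" by (rule power_mono) simp
    also have "\<dots> = real n" using m by simp
    finally show ?thesis by (simp flip: of_nat_power)
  qed
  have r_gt: "n < (r n + 1) ^ m" for n
  proof -
    have "root m (real n) < real (r n + 1)"
      using real_root_ge_zero[of "real n" m] unfolding r_def by linarith
    then have "root m (real n) ^ m < real (r n + 1) ^ m"
      using m by (intro power_strict_mono) auto
    then have "real n < real ((r n + 1) ^ m)" using m by simp
    then show ?thesis by (simp only: of_nat_less_iff)
  qed
  have r_lim: "filterlim r at_top sequentially"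
  proof (rule filterlim_at_top[THEN iffD2], rule allI)
    fix Z
    show "\<forall>\<^sub>F n in sequentially. Z \<le> r n"
      unfolding eventually_sequentially
    proof (intro exI[of _ "Z ^ m"] allI impI)
      fix n assume "Z ^ m \<le> n"
      with r_gt[of n] have "Z ^ m < (r n + 1) ^ m" by linarith
      then have "Z < r n + 1" by (rule power_less_imp_less_base) simp
      then show "Z \<le> r n" by simp
    qed
  qed
  have ratio: "(\<lambda>k. (real k / real (k + 1)) ^ m) \<longlonglongrightarrow> 1"
  proof -
    have "(\<lambda>k. real k / real (k + 1)) \<longlonglongrightarrow> 1" by real_asymp
    from tendsto_power[OF this, of m] show ?thesis by simp
  qed
  have ratio': "(\<lambda>k. (real (k + 1) / real k) ^ m) \<longlonglongrightarrow> 1"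
  proof -
    have "(\<lambda>k. real (k + 1) / real k) \<longlonglongrightarrow> 1" by real_asymp
    from tendsto_power[OF this, of m] show ?thesis by simp
  qed
  have lim0: "(\<lambda>k. S (k ^ m) / real (k ^ m)) \<longlonglongrightarrow> c" using lim by (simp add: S_def)
  have lim1: "(\<lambda>k. S ((k + 1) ^ m) / real ((k + 1) ^ m)) \<longlonglongrightarrow> c"
    using LIMSEQ_ignore_initial_segment[OF lim0, of 1] by simp
  have lower: "(\<lambda>k. S (k ^ m) / real (k ^ m) * (real k / real (k + 1)) ^ m) \<longlonglongrightarrow> c"
    using tendsto_mult[OF lim0 ratio] by simp
  have upper: "(\<lambda>k. S ((k + 1) ^ m) / real ((k + 1) ^ m) * (real (k + 1) / real k) ^ m) \<longlonglongrightarrow> c"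
    using tendsto_mult[OF lim1 ratio'] by simp
  have r_pos: "\<forall>\<^sub>F n in sequentially. 0 < r n"
    using filterlim_at_top[THEN iffD1, OF r_lim, rule_format, of 1] by eventually_elim simp
  have "(\<lambda>n. S n / real n) \<longlonglongrightarrow> c"
  proof (rule tendsto_sandwich[OF _ _ filterlim_compose[OF lower r_lim] filterlim_compose[OF upper r_lim]])
    show "\<forall>\<^sub>F n in sequentially. S (r n ^ m) / real (r n ^ m) * (real (r n) / real (r n + 1)) ^ m \<le> S n / real n"
      using r_pos eventually_gt_at_top[of 0]
    proof eventually_elim
      case (elim n)
      have "S (r n ^ m) / real (r n ^ m) * (real (r n) / real (r n + 1)) ^ m =
          S (r n ^ m) / real ((r n + 1) ^ m)"
        using elim by (simp add: power_divide)
      also have "\<dots> \<le> S n / real n"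
        using S_mono[OF r_le[of n]] S0 r_gt[of n] elim
        by (intro frac_le) (auto simp: of_nat_le_iff simp del: of_nat_power intro: less_imp_le)
      finally show ?case .
    qed
    show "\<forall>\<^sub>F n in sequentially. S n / real n \<le>
        S ((r n + 1) ^ m) / real ((r n + 1) ^ m) * (real (r n + 1) / real (r n)) ^ m"
      using r_pos eventually_gt_at_top[of 0]
    proof eventually_elim
      case (elim n)
      have "S n / real n \<le> S ((r n + 1) ^ m) / real (r n ^ m)"
        using S_mono[of n "(r n + 1) ^ m"] S0 r_gt[of n] r_le[of n] elim
        by (intro frac_le) (auto simp: of_nat_le_iff simp del: of_nat_power intro: less_imp_le)
      also have "\<dots> = S ((r n + 1) ^ m) / real ((r n + 1) ^ m) * (real (r n + 1) / real (r n)) ^ m"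
        using elim by (simp add: power_divide del: of_nat_Suc)
      finally show ?case .
    qed
  qed
  then show ?thesis by (simp add: S_def)
qed

context prob_space
begin

lemma expectation_square_sum_indep:
  fixes X :: "nat \<Rightarrow> 'a \<Rightarrow> real"
  assumes indep: "indep_vars (\<lambda>_. borel) X UNIV"
    and sq: "\<And>i. integrable M (\<lambda>\<omega>. (X i \<omega>)\<^sup>2)" and zero: "\<And>i. expectation (X i) = 0"
  shows "integrable M (\<lambda>\<omega>. (\<Sum>i<n. X i \<omega>)\<^sup>2)"
    and "expectation (\<lambda>\<omega>. (\<Sum>i<n. X i \<omega>)\<^sup>2) = (\<Sum>i<n. expectation (\<lambda>\<omega>. (X i \<omega>)\<^sup>2))"
proof -
  have rv: "random_variable borel (X i)" for i
    using indep by (auto simp: indep_vars_def)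
  have int: "integrable M (X i)" for i
    using square_integrable_imp_integrable[OF rv sq] by simp
  have prod2: "(\<Prod>k\<in>{i, j}. f k) = f i * f j" if "i \<noteq> j" for i j :: nat and f :: "nat \<Rightarrow> real"
    using that by simp
  have off_int: "integrable M (\<lambda>\<omega>. X i \<omega> * X j \<omega>)"
    and off: "expectation (\<lambda>\<omega>. X i \<omega> * X j \<omega>) = 0" if "i \<noteq> j" for i j
    using indep_vars_integrable[OF _ indep_vars_subset[OF indep], of "{i, j}"]
      indep_vars_lebesgue_integral[OF _ indep_vars_subset[OF indep], of "{i, j}"] int zero
    unfolding prod2[OF that] by auto
  have int2: "integrable M (\<lambda>\<omega>. X i \<omega> * X j \<omega>)" for i j
    using off_int[of i j] sq[of i] by (cases "i = j") (auto simp: power2_eq_square)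
  have eq: "(\<Sum>i<n. X i \<omega>)\<^sup>2 = (\<Sum>i<n. \<Sum>j<n. X i \<omega> * X j \<omega>)" for \<omega>
    by (simp add: power2_eq_square sum_product)
  show "integrable M (\<lambda>\<omega>. (\<Sum>i<n. X i \<omega>)\<^sup>2)"
    unfolding eq using int2 by auto
  have "expectation (\<lambda>\<omega>. (\<Sum>i<n. X i \<omega>)\<^sup>2) = (\<Sum>i<n. \<Sum>j<n. expectation (\<lambda>\<omega>. X i \<omega> * X j \<omega>))"
    unfolding eq using int2 by (simp add: Bochner_Integration.integral_sum)
  also have "\<dots> = (\<Sum>i<n. \<Sum>j<n. if j = i then expectation (\<lambda>\<omega>. (X i \<omega>)\<^sup>2) else 0)"
    using off by (intro sum.cong) (auto simp: power2_eq_square)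
  finally show "expectation (\<lambda>\<omega>. (\<Sum>i<n. X i \<omega>)\<^sup>2) = (\<Sum>i<n. expectation (\<lambda>\<omega>. (X i \<omega>)\<^sup>2))"
    by simp
qed

text \<open>
  Truncation at level i + 1 and Chebyshev's inequality along the times k ^ m, with m so large
  that the bounds are summable.
\<close>

theorem slln_nonneg:
  fixes X :: "nat \<Rightarrow> 'a \<Rightarrow> real"
  assumes indep: "indep_vars (\<lambda>_. borel) X UNIV"
    and ident: "\<And>i. distr M borel (X i) = distr M borel (X 0)"
    and nonneg: "\<And>i \<omega>. 0 \<le> X i \<omega>"
    and p: "1 < p" and moment: "integrable M (\<lambda>\<omega>. X 0 \<omega> powr p)"
  shows "AE \<omega> in M. (\<lambda>n. (\<Sum>i<n. X i \<omega>) / real n) \<longlonglongrightarrow> expectation (X 0)"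
proof -
  have rv [measurable]: "random_variable borel (X i)" for i
    using indep by (auto simp: indep_vars_def)
  have ident_int: "integrable M (\<lambda>\<omega>. h (X i \<omega>)) \<longleftrightarrow> integrable M (\<lambda>\<omega>. h (X 0 \<omega>))"
    and ident_exp: "expectation (\<lambda>\<omega>. h (X i \<omega>)) = expectation (\<lambda>\<omega>. h (X 0 \<omega>))"
    if [measurable]: "h \<in> borel_measurable borel" for h :: "real \<Rightarrow> real" and i
    using integrable_distr_eq[OF rv that, of i] integrable_distr_eq[OF rv that, of 0]
      integral_distr[OF rv that, of i] integral_distr[OF rv that, of 0] ident[of i] by simp_all
  \<comment> \<open>Capping the exponent at 2 keeps 2 - q nonnegative, so that a value x truncated
    at i + 1 satisfies x^2 \<le> (i + 1)^(2 - q) * x^q.\<close>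
  define q where "q = min p 2"
  have q: "1 < q" "q \<le> 2" using p by (auto simp: q_def)
  have q_moment0: "integrable M (\<lambda>\<omega>. X 0 \<omega> powr q)"
  proof (rule Bochner_Integration.integrable_bound)
    show "integrable M (\<lambda>\<omega>. 1 + X 0 \<omega> powr p)" using moment by simp
    show "AE \<omega> in M. norm (X 0 \<omega> powr q) \<le> norm (1 + X 0 \<omega> powr p)"
    proof (rule AE_I2)
      fix \<omega>
      have "X 0 \<omega> powr q \<le> 1 + X 0 \<omega> powr p"
      proof (cases "X 0 \<omega> \<le> 1")
        case True
        then have "X 0 \<omega> powr q \<le> 1" using nonneg q by (intro powr_le1) auto
        then show ?thesis by (smt (verit) powr_ge_zero)
      next
        case False
        then have "X 0 \<omega> powr q \<le> X 0 \<omega> powr p" by (intro powr_mono) (auto simp: q_def)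
        then show ?thesis by simp
      qed
      then show "norm (X 0 \<omega> powr q) \<le> norm (1 + X 0 \<omega> powr p)"
        by (smt (verit) powr_ge_zero real_norm_def)
    qed
  qed measurable
  define C where "C = expectation (\<lambda>\<omega>. X 0 \<omega> powr q)"
  have C0: "0 \<le> C" unfolding C_def by simp
  have q_moment: "integrable M (\<lambda>\<omega>. X i \<omega> powr q)" "expectation (\<lambda>\<omega>. X i \<omega> powr q) = C" for i
    using ident_int[of "\<lambda>x. x powr q" i] ident_exp[of "\<lambda>x. x powr q" i] q_moment0
    by (auto simp: C_def)
  have X_int: "integrable M (X 0)"
  proof (rule Bochner_Integration.integrable_bound)
    show "integrable M (\<lambda>\<omega>. 1 + X 0 \<omega> powr q)" using q_moment0 by simp
    show "AE \<omega> in M. norm (X 0 \<omega>) \<le> norm (1 + X 0 \<omega> powr q)"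
    proof (rule AE_I2)
      fix \<omega>
      have "X 0 \<omega> \<le> 1 + X 0 \<omega> powr q"
      proof (cases "X 0 \<omega> \<le> 1")
        case True
        then show ?thesis by (smt (verit) powr_ge_zero)
      next
        case False
        then have "X 0 \<omega> powr 1 \<le> X 0 \<omega> powr q" using q by (intro powr_mono) auto
        with False show ?thesis by simp
      qed
      then show "norm (X 0 \<omega>) \<le> norm (1 + X 0 \<omega> powr q)" using nonneg[of 0 \<omega>] by simp
    qed
  qed measurable
  define c where "c = expectation (X 0)"
  define T where "T i x = (if x \<le> real (Suc i) then x else 0)" for i and x :: real
  have T_meas [measurable]: "T i \<in> borel_measurable borel" for i unfolding T_def by measurable
  have T_bd: "0 \<le> T i (X j \<omega>)" "T i (X j \<omega>) \<le> X j \<omega>" "T i (X j \<omega>) \<le> real (Suc i)" for i j \<omega>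
    using nonneg by (auto simp: T_def)
  have T_int: "integrable M (\<lambda>\<omega>. T i (X j \<omega>))" for i j
    by (rule integrable_const_bound[of _ "real (Suc i)"]) (use T_bd in auto)
  have T_sq_int: "integrable M (\<lambda>\<omega>. (T i (X j \<omega>))\<^sup>2)" for i j
    by (rule integrable_const_bound[of _ "(real (Suc i))\<^sup>2"]) (use T_bd in \<open>auto intro!: power_mono\<close>)
  define b where "b i = expectation (\<lambda>\<omega>. T i (X i \<omega>))" for i
  have b_lim: "b \<longlonglongrightarrow> c"
  proof -
    have "(\<lambda>i. expectation (\<lambda>\<omega>. T i (X 0 \<omega>))) \<longlonglongrightarrow> c"
      unfolding c_def
    proof (rule integral_dominated_convergence[where w = "X 0"])
      show "AE \<omega> in M. (\<lambda>i. T i (X 0 \<omega>)) \<longlonglongrightarrow> X 0 \<omega>"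
      proof (rule AE_I2)
        fix \<omega>
        obtain N where "X 0 \<omega> \<le> real N" using real_arch_simple by blast
        then have "\<forall>\<^sub>F i in sequentially. T i (X 0 \<omega>) = X 0 \<omega>"
          unfolding eventually_sequentially T_def by (intro exI[of _ N]) auto
        then show "(\<lambda>i. T i (X 0 \<omega>)) \<longlonglongrightarrow> X 0 \<omega>" by (rule tendsto_eventually)
      qed
    qed (use X_int T_bd in auto)
    moreover have "b i = expectation (\<lambda>\<omega>. T i (X 0 \<omega>))" for i
      unfolding b_def by (rule ident_exp[OF T_meas])
    then have "b = (\<lambda>i. expectation (\<lambda>\<omega>. T i (X 0 \<omega>)))" ..
    ultimately show ?thesis by simp
  qed
  define Z where "Z i \<omega> = T i (X i \<omega>) - b i" for i \<omega>
  have Z_rv [measurable]: "random_variable borel (Z i)" for i unfolding Z_def by measurable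
  have Z_indep: "indep_vars (\<lambda>_. borel) Z UNIV"
    unfolding Z_def
    by (rule indep_vars_compose2[OF indep, of "\<lambda>i x. T i x - b i"]) measurable
  have Z_zero: "expectation (Z i) = 0" for i
    unfolding Z_def using T_int by (simp add: b_def prob_space)
  have Z_sq: "integrable M (\<lambda>\<omega>. (Z i \<omega>)\<^sup>2)" for i
    unfolding Z_def power2_diff using T_int T_sq_int by simp
  have Z_var: "expectation (\<lambda>\<omega>. (Z i \<omega>)\<^sup>2) \<le> real (Suc i) powr (2 - q) * C" for i
  proof -
    have "expectation (\<lambda>\<omega>. (Z i \<omega>)\<^sup>2) = expectation (\<lambda>\<omega>. (T i (X i \<omega>))\<^sup>2) - (b i)\<^sup>2"
      unfolding Z_def b_def by (rule variance_eq[OF T_int T_sq_int])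
    also have "\<dots> \<le> expectation (\<lambda>\<omega>. (T i (X i \<omega>))\<^sup>2)" by simp
    also have "\<dots> \<le> expectation (\<lambda>\<omega>. real (Suc i) powr (2 - q) * X i \<omega> powr q)"
    proof (rule integral_mono)
      fix \<omega>
      show "(T i (X i \<omega>))\<^sup>2 \<le> real (Suc i) powr (2 - q) * X i \<omega> powr q"
      proof (cases "X i \<omega> \<le> real (Suc i) \<and> X i \<omega> \<noteq> 0")
        case True
        then have pos: "0 < X i \<omega>" using nonneg[of i \<omega>] by simp
        have "(X i \<omega>)\<^sup>2 = X i \<omega> powr (2 - q) * X i \<omega> powr q"
          using pos by (simp flip: powr_add powr_numeral)
        also have "\<dots> \<le> real (Suc i) powr (2 - q) * X i \<omega> powr q"
          using True pos q by (intro mult_right_mono powr_mono2) auto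
        finally show ?thesis using True by (simp add: T_def)
      qed (auto simp: T_def)
    qed (use T_sq_int q_moment in auto)
    also have "\<dots> = real (Suc i) powr (2 - q) * C" by (simp add: q_moment)
    finally show ?thesis .
  qed
  define S where "S n \<omega> = (\<Sum>i<n. Z i \<omega>)" for n \<omega>
  have S_rv [measurable]: "random_variable borel (S n)" for n unfolding S_def by measurable
  have S_var: "expectation (\<lambda>\<omega>. (S n \<omega>)\<^sup>2) \<le> real n powr (3 - q) * C" if n: "0 < n" for n
  proof -
    have "expectation (\<lambda>\<omega>. (S n \<omega>)\<^sup>2) = (\<Sum>i<n. expectation (\<lambda>\<omega>. (Z i \<omega>)\<^sup>2))"
      unfolding S_def by (rule expectation_square_sum_indep(2)[OF Z_indep Z_sq Z_zero])
    also have "\<dots> \<le> (\<Sum>i<n. real n powr (2 - q) * C)"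
    proof (rule sum_mono)
      fix i assume "i \<in> {..<n}"
      then have "real (Suc i) powr (2 - q) \<le> real n powr (2 - q)"
        using q by (intro powr_mono2) auto
      then show "expectation (\<lambda>\<omega>. (Z i \<omega>)\<^sup>2) \<le> real n powr (2 - q) * C"
        using Z_var[of i] C0 by (meson mult_right_mono order_trans)
    qed
    also have "\<dots> = (real n powr 1 * real n powr (2 - q)) * C" using n by simp
    also have "real n powr 1 * real n powr (2 - q) = real n powr (3 - q)"
      unfolding powr_add[symmetric] by simp
    finally show ?thesis .
  qed
  \<comment> \<open>Along n = k^m the Chebyshev bound is a constant times n^(1 - q) = k^(- m * (q -
    1)). The choice of m makes the exponent at most -2.\<close>
  obtain m :: nat where m: "2 / (q - 1) \<le> real m" using real_arch_simple by blast
  have m0: "0 < m" using m q by (auto intro: gr0I simp: not_le)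
  have mq: "2 \<le> real m * (q - 1)" using m q by (simp add: divide_le_eq)
  have AE1: "AE \<omega> in M. (\<lambda>k. S (k ^ m) \<omega> / real (k ^ m)) \<longlonglongrightarrow> 0"
  proof -
    let ?A = "\<lambda>j k. {\<omega> \<in> space M.
        real (k ^ m) / real (Suc j) \<le> \<bar>S (k ^ m) \<omega>\<bar>}"
    have "AE \<omega> in M. \<forall>\<^sub>F k in sequentially. \<omega> \<in> space M - ?A j k" for j
    proof (rule borel_cantelli_AE1)
      show "summable (\<lambda>k. prob (?A j k))"
      proof (rule summable_comparison_test_ev)
        show "summable (\<lambda>k. C * (real (Suc j))\<^sup>2 * inverse (real k ^ 2))"
          by (intro summable_mult inverse_power_summable) simp
        show "\<forall>\<^sub>F k in sequentially. norm (prob (?A j k))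
            \<le> C * (real (Suc j))\<^sup>2 * inverse (real k ^ 2)"
          using eventually_gt_at_top[of 0]
        proof eventually_elim
          case (elim k)
          define n where "n = k ^ m"
          have n: "0 < n" using elim by (simp add: n_def)
          have "prob {\<omega> \<in> space M. real n / real (Suc j) \<le> \<bar>S n \<omega>\<bar>} \<le>
              expectation (\<lambda>\<omega>. (S n \<omega>)\<^sup>2) / (real n / real (Suc j))\<^sup>2"
            using n expectation_square_sum_indep(1)[OF Z_indep Z_sq Z_zero, of n]
            by (intro second_moment_method) (auto simp: S_def[abs_def])
          also have "\<dots> \<le> (real n powr (3 - q) * C) / (real n / real (Suc j))\<^sup>2"
            by (intro divide_right_mono S_var n) simp
          also have "\<dots> = C * (real (Suc j))\<^sup>2 * (real n powr (3 - q) / (real n)\<^sup>2)"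
            by (simp add: power_divide mult_ac)
          also have "real n powr (3 - q) / (real n)\<^sup>2 = real n powr (1 - q)"
          proof -
            have "(real n)\<^sup>2 = real n powr 2" using n by simp
            then show ?thesis by (simp only: flip: powr_diff) simp
          qed
          also have "\<dots> = real k powr (- (real m * (q - 1)))"
            using elim by (simp add: n_def powr_powr algebra_simps flip: powr_realpow)
          also have "\<dots> \<le> real k powr (- 2)"
            using elim mq by (intro powr_mono) auto
          also have "\<dots> = inverse (real k ^ 2)"
            using elim by (simp add: powr_minus)
          finally show ?case using C0 by (simp add: n_def mult_left_mono)
        qed
      qed
    qed (auto simp: emeasure_eq_measure)
    then have "AE \<omega> in M. \<forall>j. \<forall>\<^sub>F k in sequentially. \<omega> \<in> space M - ?A j k"
      by (simp add: AE_all_countable)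
    then show ?thesis
    proof eventually_elim
      case (elim \<omega>)
      show ?case
      proof (rule tendstoI)
        fix e :: real assume "0 < e"
        then obtain j where j: "1 / real (Suc j) < e" using nat_approx_posE by blast
        show "\<forall>\<^sub>F k in sequentially. dist (S (k ^ m) \<omega> / real (k ^ m)) 0 < e"
          using elim[rule_format, of j] eventually_gt_at_top[of 0]
        proof eventually_elim
          case (elim k)
          then have "\<bar>S (k ^ m) \<omega>\<bar> < real (k ^ m) * (1 / real (Suc j))" by auto
          also have "\<dots> < real (k ^ m) * e" using j elim by (intro mult_strict_left_mono) auto
          finally show ?case using elim by (simp add: divide_less_eq mult.commute)
        qed
      qed
    qed
  qed
  \<comment> \<open>Markov's inequality for the q-th power bounds the tails by C * (i + 1)^(-q),
    summable because q > 1. Almost surely only finitely many terms are changed by the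
    truncation.\<close>
  have AE2: "AE \<omega> in M. \<forall>\<^sub>F i in sequentially. T i (X i \<omega>) = X i \<omega>"
  proof -
    let ?B = "\<lambda>i. {\<omega> \<in> space M. real (Suc i) powr q \<le> X i \<omega> powr q}"
    have "AE \<omega> in M. \<forall>\<^sub>F i in sequentially. \<omega> \<in> space M - ?B i"
    proof (rule borel_cantelli_AE1)
      show "summable (\<lambda>i. prob (?B i))"
      proof (rule summable_comparison_test)
        have "summable (\<lambda>i. real i powr (- q))"
          using q by (subst summable_real_powr_iff) simp
        then show "summable (\<lambda>i. C * real (Suc i) powr (- q))"
          by (intro summable_mult) (subst summable_Suc_iff)
        have "prob (?B i) \<le> C * real (Suc i) powr (- q)" for i
        proof -
          have "prob (?B i) \<le>
              expectation (\<lambda>\<omega>. X i \<omega> powr q) / real (Suc i) powr q"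
            by (rule integral_Markov_inequality_measure[where A = "{}"]) (auto simp: q_moment)
          then show ?thesis by (simp add: q_moment powr_minus divide_inverse)
        qed
        then show "\<exists>N. \<forall>i\<ge>N. norm (prob (?B i))
            \<le> C * real (Suc i) powr (- q)"
          by simp
      qed
    qed (auto simp: emeasure_eq_measure)
    then show ?thesis
    proof eventually_elim
      case (elim \<omega>)
      then show ?case
      proof eventually_elim
        case (elim i)
        then have "X i \<omega> powr q < real (Suc i) powr q" by auto
        then have "X i \<omega> < real (Suc i)"
          using q nonneg[of i \<omega>] by (meson not_le powr_mono2 of_nat_0_le_iff less_imp_le zero_less_one less_trans)
        then show ?case by (simp add: T_def)
      qed
    qed
  qed
  show ?thesis
    using AE1 AE2
  proof eventually_elim
    case (elim \<omega>)
    \<comment> \<open>Here X i = Z i + W i + c: the centred truncated part is controlled by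
      \<open>AE1\<close>, and W, collecting the truncation error and the drift of the truncated
      means, is a null sequence.\<close>
    define W where "W i = (X i \<omega> - T i (X i \<omega>)) + (b i - c)" for i
    have "W \<longlonglongrightarrow> 0 + 0"
      unfolding W_def
    proof (rule tendsto_add)
      show "(\<lambda>i. X i \<omega> - T i (X i \<omega>)) \<longlonglongrightarrow> 0"
        using elim(2) by (intro tendsto_eventually) (auto elim: eventually_mono)
      show "(\<lambda>i. b i - c) \<longlonglongrightarrow> 0" using b_lim by (simp add: LIM_zero)
    qed
    then have W: "(\<lambda>n. (\<Sum>i<n. W i) / real n) \<longlonglongrightarrow> 0" using cesaro_null by simp
    have km: "filterlim (\<lambda>k. k ^ m) at_top sequentially"
    proof (rule filterlim_at_top_mono[OF filterlim_ident])
      show "\<forall>\<^sub>F k in sequentially. k \<le> k ^ m"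
      proof (intro always_eventually allI)
        fix k :: nat
        show "k \<le> k ^ m" using m0 by (cases "k = 0") (auto simp: self_le_power)
      qed
    qed
    have "(\<lambda>k. S (k ^ m) \<omega> / real (k ^ m) + (\<Sum>i<k ^ m. W i) / real (k ^ m) + c) \<longlonglongrightarrow> 0 + 0 + c"
      by (intro tendsto_add elim(1) filterlim_compose[OF W km] tendsto_const)
    moreover have "\<forall>\<^sub>F k in sequentially. S (k ^ m) \<omega> / real (k ^ m) + (\<Sum>i<k ^ m. W i) / real (k ^ m) + c =
        (\<Sum>i<k ^ m. X i \<omega>) / real (k ^ m)"
      using eventually_gt_at_top[of 0]
    proof eventually_elim
      case (elim k)
      define n where "n = k ^ m"
      have n: "0 < n" using elim by (simp add: n_def)
      have "(\<Sum>i<n. X i \<omega>) = (\<Sum>i<n. Z i \<omega> + W i + c)"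
        by (intro sum.cong) (auto simp: Z_def W_def)
      also have "\<dots> = S n \<omega> + (\<Sum>i<n. W i) + real n * c" by (simp add: sum.distrib S_def)
      finally show ?case using n by (simp add: n_def[symmetric] add_divide_distrib)
    qed
    ultimately have "(\<lambda>k. (\<Sum>i<k ^ m. X i \<omega>) / real (k ^ m)) \<longlonglongrightarrow> c"
      by (simp add: tendsto_cong)
    then show ?case
      unfolding c_def by (rule mean_converges_from_powers[OF nonneg m0])
  qed
qed

end

section \<open>Averages along the random sequence\<close>

text \<open>Coordinates of the product measure are independent with law \<mu>, and the linear bound
  passes the p-th moment of \<mu> on to f. The bounds hold for all real x, including the null set x
  \<le> 0.\<close>

lemma slln_dominated:
  fixes \<mu> :: "real measure"
  assumes \<mu>: "prob_space \<mu>" and sets [measurable_cong]: "sets \<mu> = sets borel"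
    and pos: "AE x in \<mu>. 0 < x"
    and p: "1 < p" and moment: "integrable \<mu> (\<lambda>x. x powr p)"
    and f [measurable]: "f \<in> borel_measurable borel"
    and bounds: "\<And>x. 0 \<le> f x" "\<And>x. f x \<le> B * max 0 x"
  shows "AE \<nu> in (\<Pi>\<^sub>M i\<in>(UNIV :: nat set). \<mu>).
    (\<lambda>n. (\<Sum>i<n. f (\<nu> i)) / real n) \<longlonglongrightarrow> (\<integral>x. f x \<partial>\<mu>)"
proof -
  define Q where "Q = (\<Pi>\<^sub>M i\<in>(UNIV :: nat set). \<mu>)"
  interpret \<mu>: prob_space \<mu> by fact
  interpret product_prob_space "\<lambda>_ :: nat. \<mu>" UNIV ..
  interpret Q: prob_space Q unfolding Q_def by (rule prob_space_PiM[OF \<mu>])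
  have coord: "(\<lambda>\<nu>. \<nu> i) \<in> measurable Q \<mu>" for i
    unfolding Q_def by (rule measurable_component_singleton) simp
  have coord_distr: "distr Q \<mu> (\<lambda>\<nu>. \<nu> i) = \<mu>" for i
    unfolding Q_def by (rule PiM_component) simp
  have "Q.indep_vars (\<lambda>_. \<mu>) (\<lambda>i \<nu>. \<nu> i) UNIV"
  proof (subst Q.indep_vars_iff_distr_eq_PiM)
    have "distr Q (\<Pi>\<^sub>M i\<in>UNIV. \<mu>) (\<lambda>\<nu>. \<lambda>i\<in>UNIV. \<nu> i) = Q"
      unfolding Q_def restrict_UNIV by (rule distr_id)
    then show "distr Q (\<Pi>\<^sub>M i\<in>UNIV. \<mu>) (\<lambda>\<nu>. \<lambda>i\<in>UNIV. \<nu> i) =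
        (\<Pi>\<^sub>M i\<in>UNIV. distr Q \<mu> (\<lambda>\<nu>. \<nu> i))"
      unfolding coord_distr by (simp only: Q_def)
  qed (use coord in auto)
  then have indep: "Q.indep_vars (\<lambda>_. borel) (\<lambda>i \<nu>. f (\<nu> i)) UNIV"
    by (rule Q.indep_vars_compose2[where Y = "\<lambda>_. f"]) simp
  have distr_f: "distr Q borel (\<lambda>\<nu>. f (\<nu> i)) = distr \<mu> borel f" for i
  proof -
    have "distr (distr Q \<mu> (\<lambda>\<nu>. \<nu> i)) borel f = distr Q borel (f \<circ> (\<lambda>\<nu>. \<nu> i))"
      by (rule distr_distr) (use coord in auto)
    then show ?thesis by (simp add: coord_distr comp_def)
  qed
  have "0 \<le> B" using bounds(1)[of 1] bounds(2)[of 1] by simp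
  have f_moment: "integrable \<mu> (\<lambda>x. f x powr p)"
  proof (rule Bochner_Integration.integrable_bound)
    show "integrable \<mu> (\<lambda>x. B powr p * x powr p)" using moment by simp
    show "AE x in \<mu>. norm (f x powr p) \<le> norm (B powr p * x powr p)"
      using pos
    proof eventually_elim
      case (elim x)
      have "f x powr p \<le> (B * x) powr p"
        using bounds[of x] elim p by (intro powr_mono2) auto
      then show ?case using \<open>0 \<le> B\<close> elim by (simp add: powr_mult)
    qed
  qed measurable
  have moment': "integrable Q (\<lambda>\<nu>. f (\<nu> 0) powr p)"
    using f_moment integrable_distr_eq[OF coord[of 0], of "\<lambda>x. f x powr p"]
    by (simp add: coord_distr)
  have "Q.expectation (\<lambda>\<nu>. f (\<nu> 0)) = (\<integral>x. f x \<partial>\<mu>)"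
    using integral_distr[OF coord[of 0], of f] by (simp add: coord_distr)
  then show ?thesis
    using Q.slln_nonneg[OF indep _ bounds(1) p moment'] distr_f unfolding Q_def by simp
qed

text \<open>The quotient of x n by n + 1 is a difference of consecutive averages, up to a factor
  tending to 1, and so tends to 0. The finitely many early terms are bounded by S N, which is
  absorbed by taking n large.\<close>

lemma mean_converges_max:
  fixes x :: "nat \<Rightarrow> real"
  assumes nonneg: "\<And>i. 0 \<le> x i" and mean: "(\<lambda>n. (\<Sum>i<n. x i) / real n) \<longlonglongrightarrow> m"
    and e: "0 < e"
  shows "\<forall>\<^sub>F n in sequentially. \<forall>i<n. x i \<le> e * real n"
proof -
  define S where "S n = (\<Sum>i<n. x i)" for n
  have S: "(\<lambda>n. S n / real n) \<longlonglongrightarrow> m" using mean by (simp add: S_def)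
  have "(\<lambda>n. S (Suc n) / real (Suc n) - S n / real n * (real n / real (Suc n))) \<longlonglongrightarrow> m - m * 1"
  proof (intro tendsto_diff tendsto_mult S)
    show "(\<lambda>n. S (Suc n) / real (Suc n)) \<longlonglongrightarrow> m" using S by (rule LIMSEQ_Suc)
    show "(\<lambda>n. real n / real (Suc n)) \<longlonglongrightarrow> 1" by (rule LIMSEQ_n_over_Suc_n)
  qed
  then have "\<forall>\<^sub>F n in sequentially. S (Suc n) / real (Suc n) - S n / real n * (real n / real (Suc n)) < e"
    using e by (intro order_tendstoD(2)) auto
  then have "\<forall>\<^sub>F n in sequentially. x n \<le> e * real (Suc n)"
    using eventually_gt_at_top[of 0]
  proof eventually_elim
    case (elim n)
    then have "x n / real (Suc n) < e"
      by (simp add: S_def add_divide_distrib del: of_nat_Suc)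
    then show ?case by (simp add: divide_less_eq mult.commute del: of_nat_Suc)
  qed
  then obtain N where N: "\<And>n. n \<ge> N \<Longrightarrow> x n \<le> e * real (Suc n)"
    unfolding eventually_sequentially by blast
  obtain N' where N': "S N / e \<le> real N'" using real_arch_simple by blast
  show ?thesis
    unfolding eventually_sequentially
  proof (intro exI[of _ N'] allI impI)
    fix n i assume n: "N' \<le> n" and i: "i < n"
    show "x i \<le> e * real n"
    proof (cases "i < N")
      case True
      then have "x i \<le> S N" unfolding S_def by (intro member_le_sum) (use nonneg in auto)
      also have "\<dots> \<le> e * real N'" using N' e by (simp add: divide_le_eq mult.commute)
      also have "\<dots> \<le> e * real n" using n e by simp
      finally show ?thesis .
    next
      case False
      then have "x i \<le> e * real (Suc i)" by (intro N) simp
      also have "\<dots> \<le> e * real n" using i e by (intro mult_left_mono) auto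
      finally show ?thesis .
    qed
  qed
qed

text \<open>
  The exceptional set of the law of large numbers must not depend on the uncountable time
  parameter: rational times suffice, because large values of the sequence contribute little
  and on bounded values the integrand is equicontinuous in time.
\<close>

lemma mean_converges_all_times:
  fixes c :: "real \<Rightarrow> real" and \<nu> :: "nat \<Rightarrow> real" and \<mu> :: "real measure"
  assumes c_cont: "continuous_on UNIV c" and c_bound: "\<And>s. \<bar>c s\<bar> \<le> c0"
    and pos: "\<And>i. 0 < \<nu> i"
    and [measurable_cong]: "sets \<mu> = sets borel"
    and \<mu>_pos: "AE x in \<mu>. 0 < x" and int: "integrable \<mu> (\<lambda>x. x)"
    and rat: "\<And>q. q \<in> \<rat> \<Longrightarrow> (\<lambda>n. (\<Sum>i<n. \<nu> i * c (sqrt (\<nu> i) * q)) / real n)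
        \<longlonglongrightarrow> (\<integral>x. x * c (sqrt x * q) \<partial>\<mu>)"
    and mean: "(\<lambda>n. (\<Sum>i<n. \<nu> i) / real n) \<longlonglongrightarrow> (\<integral>x. x \<partial>\<mu>)"
    and tail: "\<And>K :: nat. (\<lambda>n. (\<Sum>i<n. if real K < \<nu> i then \<nu> i else 0) / real n)
        \<longlonglongrightarrow> (\<integral>x. (if real K < x then x else 0) \<partial>\<mu>)"
  shows "(\<lambda>n. (\<Sum>i<n. \<nu> i * c (sqrt (\<nu> i) * t)) / real n) \<longlonglongrightarrow> (\<integral>x. x * c (sqrt x * t) \<partial>\<mu>)"
proof (rule tendstoI)
  fix e :: real assume e: "0 < e"
  have [measurable]: "c \<in> borel_measurable borel"
    by (rule borel_measurable_continuous_onI[OF c_cont])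
  have c0: "0 \<le> c0" using c_bound[of 0] by linarith
  define m where "m = (\<integral>x. x \<partial>\<mu>)"
  have m: "0 \<le> m" unfolding m_def using \<mu>_pos by (intro integral_nonneg_AE) auto
  have tail_int: "integrable \<mu> (\<lambda>x. if real K < x then x else 0)" for K
    by (rule Bochner_Integration.integrable_bound[OF int]) (auto intro!: AE_I2)
  have "(\<lambda>K. \<integral>x. (if real K < x then x else 0) \<partial>\<mu>) \<longlonglongrightarrow> (\<integral>x. 0 \<partial>\<mu>)"
  proof (rule integral_dominated_convergence[where w = "\<lambda>x. \<bar>x\<bar>"])
    show "AE x in \<mu>. (\<lambda>K. if real K < x then x else 0) \<longlonglongrightarrow> 0"
    proof (rule AE_I2)
      fix x :: real
      obtain N where "x \<le> real N" using real_arch_simple by blast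
      then have "\<forall>\<^sub>F K in sequentially. (if real K < x then x else 0) = 0"
        unfolding eventually_sequentially by (intro exI[of _ N]) auto
      then show "(\<lambda>K. if real K < x then x else 0) \<longlonglongrightarrow> 0" by (rule tendsto_eventually)
    qed
    show "integrable \<mu> (\<lambda>x. \<bar>x\<bar>)" using int by simp
    show "AE x in \<mu>. norm (if real K < x then x else 0) \<le> \<bar>x\<bar>" for K
      by (rule AE_I2) simp
    show "(\<lambda>x. if real K < x then x else 0) \<in> borel_measurable \<mu>" for K by measurable
  qed simp
  then have "\<forall>\<^sub>F K in sequentially. (\<integral>x. (if real K < x then x else 0) \<partial>\<mu>) < e / (16 * (c0 + 1))"
    using e c0 by (intro order_tendstoD(2)) auto
  then obtain K :: nat where K: "(\<integral>x. (if real K < x then x else 0) \<partial>\<mu>) < e / (16 * (c0 + 1))"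
    unfolding eventually_sequentially by blast
  define \<tau> where "\<tau> = (\<integral>x. (if real K < x then x else 0) \<partial>\<mu>)"
  have \<tau>: "0 \<le> \<tau>" unfolding \<tau>_def by (intro integral_nonneg_AE AE_I2) auto
  define \<eta> where "\<eta> = e / (16 * (m + 1))"
  have \<eta>: "0 < \<eta>" using e m by (simp add: \<eta>_def)
  \<comment> \<open>For 0 < x \<le> K and times of modulus at most \<bar>t\<bar> + 1, the arguments
    of c stay in [-L, L], where one modulus of continuity serves all x. In r below, the bound 1
    keeps q among these times and the other bound makes sqrt x * (q - t) smaller than
    \<rho>.\<close>
  define L where "L = sqrt (real K) * (\<bar>t\<bar> + 1)"
  have "uniformly_continuous_on {-L..L} c"
    by (intro compact_uniformly_continuous continuous_on_subset[OF c_cont]) auto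
  then obtain \<rho> where \<rho>: "0 < \<rho>"
    and uc: "\<And>s s'. s \<in> {-L..L} \<Longrightarrow> s' \<in> {-L..L} \<Longrightarrow> \<bar>s' - s\<bar> < \<rho> \<Longrightarrow> \<bar>c s' - c s\<bar> < \<eta>"
    using \<eta> unfolding uniformly_continuous_on_def dist_real_def by metis
  define r where "r = min 1 (\<rho> / (sqrt (real K) + 1))"
  have r: "0 < r" using \<rho> by (simp add: r_def add_nonneg_pos)
  obtain q where q: "q \<in> \<rat>" "t < q" "q < t + r"
    using Rats_dense_in_real[of t "t + r"] r by auto
  \<comment> \<open>Bounds the change of the integrand when t is replaced by q: \<eta> * x by
    uniform continuity for x \<le> K, a further 2 * c0 * x by boundedness for x > K. Its integral is
    at most e / 16 + e / 8, and the three comparisons in the end cost less than e / 4 each.\<close>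
  define B where "B x = \<eta> * x + 2 * c0 * (if real K < x then x else 0)" for x
  have close: "\<bar>x * c (sqrt x * t) - x * c (sqrt x * q)\<bar> \<le> B x" if x: "0 < x" for x
  proof -
    have eq: "\<bar>x * c (sqrt x * t) - x * c (sqrt x * q)\<bar> = x * \<bar>c (sqrt x * t) - c (sqrt x * q)\<bar>"
      using x by (simp add: abs_mult flip: right_diff_distrib)
    show ?thesis
    proof (cases "real K < x")
      case True
      have "\<bar>c (sqrt x * t) - c (sqrt x * q)\<bar> \<le> 2 * c0"
        using c_bound[of "sqrt x * t"] c_bound[of "sqrt x * q"] by linarith
      then have "x * \<bar>c (sqrt x * t) - c (sqrt x * q)\<bar> \<le> x * (2 * c0)"
        using x by (intro mult_left_mono) auto
      moreover have "B x = \<eta> * x + x * (2 * c0)" using True by (simp add: B_def)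
      moreover have "0 \<le> \<eta> * x" using \<eta> x by simp
      ultimately show ?thesis unfolding eq by linarith
    next
      case False
      have sx: "0 \<le> sqrt x" "sqrt x \<le> sqrt (real K)" using False x by auto
      have in_L: "sqrt x * y \<in> {-L..L}" if "\<bar>y\<bar> \<le> \<bar>t\<bar> + 1" for y
      proof -
        have "\<bar>sqrt x * y\<bar> \<le> L"
          unfolding L_def abs_mult using sx that by (intro mult_mono) auto
        then show ?thesis by auto
      qed
      have "\<bar>sqrt x * t - sqrt x * q\<bar> = sqrt x * (q - t)"
        using sx q by (simp add: abs_mult right_diff_distrib[symmetric])
      also have "\<dots> \<le> sqrt (real K) * (\<rho> / (sqrt (real K) + 1))"
        using sx q by (intro mult_mono) (auto simp: r_def)
      also have "\<dots> < \<rho>"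
        using \<rho> by (simp add: divide_less_eq add_nonneg_pos distrib_left mult.commute)
      finally have "\<bar>c (sqrt x * t) - c (sqrt x * q)\<bar> < \<eta>"
        using q by (intro uc in_L) (auto simp: r_def)
      then have "x * \<bar>c (sqrt x * t) - c (sqrt x * q)\<bar> \<le> x * \<eta>"
        using x by (intro mult_left_mono) auto
      moreover have "B x = x * \<eta>" using False by (simp add: B_def)
      ultimately show ?thesis unfolding eq by linarith
    qed
  qed
  have B_int: "integrable \<mu> B" unfolding B_def using int tail_int by simp
  have B_val: "(\<integral>x. B x \<partial>\<mu>) = \<eta> * m + 2 * c0 * \<tau>"
    unfolding B_def m_def \<tau>_def using int tail_int by simp
  have cancel: "a * k * (b / (d * k)) = a * b / d" if "k \<noteq> 0" for a b d k :: real
    using that by simp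
  have "\<eta> * m \<le> e / 16"
  proof -
    have "\<eta> * m \<le> \<eta> * (m + 1)" using \<eta> by simp
    also have "\<dots> = e / 16"
      using cancel[of "m + 1" 1 e 16] m by (simp add: \<eta>_def mult.commute)
    finally show ?thesis .
  qed
  moreover have "2 * c0 * \<tau> \<le> e / 8"
  proof -
    have "2 * c0 * \<tau> \<le> 2 * (c0 + 1) * (e / (16 * (c0 + 1)))"
      using K c0 \<tau> by (intro mult_mono) (auto simp: \<tau>_def)
    also have "\<dots> = e / 8" using cancel[of "c0 + 1" 2 e 16] c0 by simp
    finally show ?thesis .
  qed
  ultimately have B_small: "(\<integral>x. B x \<partial>\<mu>) < e / 4" using e unfolding B_val by linarith
  have h_int: "integrable \<mu> (\<lambda>x. x * c (sqrt x * s))" for s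
  proof (rule Bochner_Integration.integrable_bound)
    show "integrable \<mu> (\<lambda>x. c0 * x)" using int by simp
    show "AE x in \<mu>. norm (x * c (sqrt x * s)) \<le> norm (c0 * x)"
    proof (rule AE_I2)
      fix x :: real
      have "\<bar>x\<bar> * \<bar>c (sqrt x * s)\<bar> \<le> \<bar>x\<bar> * c0" by (intro mult_left_mono c_bound) simp
      then show "norm (x * c (sqrt x * s)) \<le> norm (c0 * x)"
        using c0 by (simp add: abs_mult mult.commute)
    qed
  qed measurable
  have V_close: "\<bar>(\<integral>x. x * c (sqrt x * t) \<partial>\<mu>) - (\<integral>x. x * c (sqrt x * q) \<partial>\<mu>)\<bar> < e / 4"
  proof -
    have "\<bar>(\<integral>x. x * c (sqrt x * t) \<partial>\<mu>) - (\<integral>x. x * c (sqrt x * q) \<partial>\<mu>)\<bar> =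
        \<bar>\<integral>x. x * c (sqrt x * t) - x * c (sqrt x * q) \<partial>\<mu>\<bar>"
      using h_int by simp
    also have "\<dots> \<le> (\<integral>x. \<bar>x * c (sqrt x * t) - x * c (sqrt x * q)\<bar> \<partial>\<mu>)"
      by (rule integral_abs_bound)
    also have "\<dots> \<le> (\<integral>x. B x \<partial>\<mu>)"
      using \<mu>_pos close by (intro integral_mono_AE) (use h_int B_int in auto)
    finally show ?thesis using B_small by linarith
  qed
  have "(\<lambda>n. \<eta> * ((\<Sum>i<n. \<nu> i) / real n) +
      2 * c0 * ((\<Sum>i<n. if real K < \<nu> i then \<nu> i else 0) / real n)) \<longlonglongrightarrow> (\<integral>x. B x \<partial>\<mu>)"
    unfolding B_val m_def \<tau>_def by (intro tendsto_intros mean tail)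
  then have "\<forall>\<^sub>F n in sequentially. \<eta> * ((\<Sum>i<n. \<nu> i) / real n) +
      2 * c0 * ((\<Sum>i<n. if real K < \<nu> i then \<nu> i else 0) / real n) < e / 4"
    using B_small by (rule order_tendstoD(2))
  moreover have "\<forall>\<^sub>F n in sequentially. dist ((\<Sum>i<n. \<nu> i * c (sqrt (\<nu> i) * q)) / real n)
      (\<integral>x. x * c (sqrt x * q) \<partial>\<mu>) < e / 4"
    using e by (intro tendstoD[OF rat[OF q(1)]]) simp
  ultimately show "\<forall>\<^sub>F n in sequentially. dist ((\<Sum>i<n. \<nu> i * c (sqrt (\<nu> i) * t)) / real n)
      (\<integral>x. x * c (sqrt x * t) \<partial>\<mu>) < e"
  proof eventually_elim
    case (elim n)
    have "\<bar>(\<Sum>i<n. \<nu> i * c (sqrt (\<nu> i) * t)) / real n - (\<Sum>i<n. \<nu> i * c (sqrt (\<nu> i) * q)) / real n\<bar> =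
        \<bar>\<Sum>i<n. \<nu> i * c (sqrt (\<nu> i) * t) - \<nu> i * c (sqrt (\<nu> i) * q)\<bar> / real n"
      by (simp add: sum_subtractf diff_divide_distrib[symmetric])
    also have "\<dots> \<le> (\<Sum>i<n. B (\<nu> i)) / real n"
      by (intro divide_right_mono order.trans[OF sum_abs] sum_mono close pos) simp
    also have "\<dots> = \<eta> * ((\<Sum>i<n. \<nu> i) / real n) +
      2 * c0 * ((\<Sum>i<n. if real K < \<nu> i then \<nu> i else 0) / real n)"
      by (simp only: B_def sum.distrib sum_distrib_left[symmetric] add_divide_distrib times_divide_eq_right)
    finally show ?case using elim V_close unfolding dist_real_def by linarith
  qed
qed

text \<open>The upper bound on exp (- x) passes through 1 / (1 + x), using (1 - x + x^2) * (1 + x) =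
  1 + x^3.\<close>

lemma abs_one_minus_exp_le:
  fixes x :: real
  assumes "0 \<le> x"
  shows "\<bar>1 - x - exp (- x)\<bar> \<le> x\<^sup>2"
proof -
  have "1 - x \<le> exp (- x)" using exp_ge_add_one_self[of "- x"] by simp
  moreover have "exp (- x) \<le> 1 - x + x\<^sup>2"
  proof -
    have "exp (- x) \<le> 1 / (1 + x)"
      using exp_ge_add_one_self[of x] assms by (simp add: exp_minus inverse_eq_divide frac_le)
    also have "\<dots> \<le> 1 - x + x\<^sup>2"
    proof -
      have "1 \<le> 1 + x ^ 3" using assms by simp
      also have "\<dots> = (1 - x + x\<^sup>2) * (1 + x)"
        by (simp add: algebra_simps power2_eq_square power3_eq_cube)
      finally show ?thesis using assms by (simp add: divide_le_eq)
    qed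
    finally show ?thesis .
  qed
  ultimately show ?thesis by linarith
qed

text \<open>The initial law lists all positions before all momenta. Iterated integration factorises
  over the coordinates in each block, and Fubini then reassembles one pair per coordinate; the bound
  1 supplies integrability throughout.\<close>

lemma integral_pair_PiM_prod:
  fixes F :: "nat \<Rightarrow> 'a \<times> 'b \<Rightarrow> complex"
  assumes A: "\<And>i. prob_space (A i)" and B: "\<And>i. prob_space (B i)"
    and F [measurable]: "\<And>i. F i \<in> borel_measurable (A i \<Otimes>\<^sub>M B i)"
    and bound: "\<And>i z. norm (F i z) \<le> 1"
  shows "(\<integral>z. (\<Prod>i<d. F i (fst z i, snd z i)) \<partial>(Pi\<^sub>M {..<d} A \<Otimes>\<^sub>M Pi\<^sub>M {..<d} B)) =
    (\<Prod>i<d. \<integral>z. F i z \<partial>(A i \<Otimes>\<^sub>M B i))"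
proof -
  let ?P = "Pi\<^sub>M {..<d} A \<Otimes>\<^sub>M Pi\<^sub>M {..<d} B"
  interpret A: prob_space "A i" for i by (rule A)
  interpret B: prob_space "B i" for i by (rule B)
  interpret PA: product_sigma_finite A ..
  interpret PB: product_sigma_finite B ..
  interpret PiA: prob_space "Pi\<^sub>M {..<d} A" by (rule prob_space_PiM) (rule A)
  interpret PiB: prob_space "Pi\<^sub>M {..<d} B" by (rule prob_space_PiM) (rule B)
  interpret P: pair_prob_space "Pi\<^sub>M {..<d} A" "Pi\<^sub>M {..<d} B" ..
  have AB: "pair_prob_space (A i) (B i)" for i by unfold_locales
  have comp: "(\<lambda>z. F i (fst z i, snd z i)) \<in> borel_measurable ?P"
    if "i < d" for i
  proof (rule measurable_compose[OF measurable_Pair F])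
    show "(\<lambda>z. fst z i) \<in> measurable ?P (A i)"
      using that by (intro measurable_compose[OF measurable_fst measurable_component_singleton]) simp
    show "(\<lambda>z. snd z i) \<in> measurable ?P (B i)"
      using that by (intro measurable_compose[OF measurable_snd measurable_component_singleton]) simp
  qed
  have int: "integrable ?P (\<lambda>z. \<Prod>i<d. F i (fst z i, snd z i))"
  proof (rule P.integrable_const_bound[of _ 1])
    show "AE z in ?P. norm (\<Prod>i<d. F i (fst z i, snd z i)) \<le> 1"
      unfolding prod_norm[symmetric] by (intro AE_I2 prod_le_1) (auto simp: bound)
    show "(\<lambda>z. \<Prod>i<d. F i (fst z i, snd z i)) \<in> borel_measurable ?P"
      by (intro borel_measurable_prod comp) simp
  qed
  have Fint: "integrable (A i \<Otimes>\<^sub>M B i) (F i)" for i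
  proof -
    interpret pair_prob_space "A i" "B i" by (rule AB)
    show ?thesis by (rule integrable_const_bound[of _ 1]) (auto simp: bound)
  qed
  have Fx: "integrable (A i) (\<lambda>x. F i (x, y))" if "y \<in> space (B i)" for i y
    by (rule A.integrable_const_bound[of _ 1])
      (auto simp: bound intro!: measurable_compose[OF measurable_Pair2'[OF that] F])
  have "(\<integral>z. (\<Prod>i<d. F i (fst z i, snd z i)) \<partial>?P) =
      (\<integral>y. \<integral>x. (\<Prod>i<d. F i (x i, y i)) \<partial>Pi\<^sub>M {..<d} A \<partial>Pi\<^sub>M {..<d} B)"
    using P.integral_snd[of "\<lambda>x y. \<Prod>i<d. F i (x i, y i)"] int by (simp add: case_prod_beta')
  also have "\<dots> = (\<integral>y. (\<Prod>i<d. \<integral>x. F i (x, y i) \<partial>A i) \<partial>Pi\<^sub>M {..<d} B)"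
    by (intro Bochner_Integration.integral_cong refl PA.product_integral_prod Fx)
      (auto simp: space_PiM PiE_iff)
  also have "\<dots> = (\<Prod>i<d. \<integral>y. \<integral>x. F i (x, y) \<partial>A i \<partial>B i)"
  proof (rule PB.product_integral_prod)
    fix i
    interpret pair_prob_space "A i" "B i" by (rule AB)
    show "integrable (B i) (\<lambda>y. \<integral>x. F i (x, y) \<partial>A i)"
      using integrable_snd[of "\<lambda>x y. F i (x, y)"] Fint[of i] by simp
  qed simp
  also have "\<dots> = (\<Prod>i<d. \<integral>z. F i z \<partial>(A i \<Otimes>\<^sub>M B i))"
  proof (rule prod.cong[OF refl])
    fix i
    interpret pair_prob_space "A i" "B i" by (rule AB)
    show "(\<integral>y. \<integral>x. F i (x, y) \<partial>A i \<partial>B i) = (\<integral>z. F i z \<partial>(A i \<Otimes>\<^sub>M B i))"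
      using integral_snd[of "\<lambda>x y. F i (x, y)"] Fint[of i] by simp
  qed
  finally show ?thesis .
qed

section \<open>Convergence of the finite-dimensional distributions\<close>

context gibbs_flow
begin

section \<open>Rescaling the initial law and factorising the characteristic function\<close>

lemma distr_pi_nu:
  assumes \<nu>: "0 < \<nu>"
  shows "distr (density lborel (pi_nu g \<nu>)) borel (\<lambda>x. sqrt \<nu> * x) = \<pi>1" (is "?D = _")
proof (rule measure_eqI)
  fix A assume "A \<in> sets (?D)"
  then have A [measurable]: "A \<in> sets borel" by simp
  have [measurable]: "pi_nu g \<nu> \<in> borel_measurable borel" unfolding pi_nu_def by measurable
  define f where "f y = ennreal (exp (- g y)) * indicator A y" for y
  have [measurable]: "f \<in> borel_measurable borel" unfolding f_def by measurable
  have "emeasure (?D) A =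
      (\<integral>\<^sup>+x. indicator A (sqrt \<nu> * x) \<partial>density lborel (pi_nu g \<nu>))"
    by (subst nn_integral_indicator_comp[of _ _ borel]) auto
  also have "\<dots> = (\<integral>\<^sup>+x. ennreal (sqrt \<nu>) * f (0 + sqrt \<nu> * x) \<partial>lborel)"
    using \<nu> by (subst nn_integral_density)
      (auto simp: f_def pi_nu_def ennreal_mult mult.assoc intro!: nn_integral_cong)
  also have "\<dots> = (\<integral>\<^sup>+y. f y \<partial>lborel)"
    using \<nu> nn_integral_real_affine[of f "sqrt \<nu>" 0] by (simp add: nn_integral_cmult)
  also have "\<dots> = emeasure \<pi>1 A"
    unfolding \<pi>1_def f_def by (subst emeasure_density) auto
  finally show "emeasure (?D) A = emeasure \<pi>1 A" .
qed simp

lemma prob_space_pi_nu: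
  assumes "0 < \<nu>"
  shows "prob_space (density lborel (pi_nu g \<nu>))"
proof (rule prob_space_distrD)
  show "(\<lambda>x. sqrt \<nu> * x) \<in> measurable (density lborel (pi_nu g \<nu>)) borel" by simp
  show "prob_space (distr (density lborel (pi_nu g \<nu>)) borel (\<lambda>x. sqrt \<nu> * x))"
    unfolding distr_pi_nu[OF assms] by (rule prob_space_\<pi>1)
qed

lemma prob_space_init_law:
  assumes "\<And>i. 0 < \<nu> i"
  shows "prob_space (init_law g \<nu> d)"
  unfolding init_law_def
  by (intro prob_space_pair prob_space_PiM prob_space_pi_nu prob_space_N01 assms)

lemma Dd_eq:
  assumes "\<And>i. 0 < \<nu> i"
  shows "Dd dg a ad \<nu> d t z =
    (\<Sum>i<d. sqrt (\<nu> i) * Y (sqrt (\<nu> i) * t) (sqrt (\<nu> i) * fst z i, snd z i)) / sqrt (real d)"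
proof -
  have "sqrt (\<nu> i) \<noteq> 0" for i using assms[of i] by simp
  then show ?thesis
    by (simp add: Dd_def flowX_def flowP_def Y_def flow_def mult.assoc)
qed

lemma init_law_components:
  assumes "i < d"
  shows "(\<lambda>z. fst z i) \<in> borel_measurable (init_law g \<nu> d)"
    "(\<lambda>z. snd z i) \<in> borel_measurable (init_law g \<nu> d)"
proof -
  have "(\<lambda>z. fst z i) \<in> measurable (init_law g \<nu> d) (density lborel (pi_nu g (\<nu> i)))"
    unfolding init_law_def using assms
    by (intro measurable_compose[OF measurable_fst measurable_component_singleton]) simp
  then show "(\<lambda>z. fst z i) \<in> borel_measurable (init_law g \<nu> d)" by simp
  have "(\<lambda>z. snd z i) \<in> measurable (init_law g \<nu> d) N01"
    unfolding init_law_def using assms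
    by (intro measurable_compose[OF measurable_snd measurable_component_singleton]) simp
  then show "(\<lambda>z. snd z i) \<in> borel_measurable (init_law g \<nu> d)"
    by (simp add: measurable_cong_sets[OF refl N01_sets])
qed

lemma Dvec_measurable:
  assumes "\<And>i. 0 < \<nu> i"
  shows "Dvec dg a ad \<nu> d n t \<in> borel_measurable (init_law g \<nu> d)"
  unfolding borel_measurable_fun_iff
proof
  fix j
  have "(\<lambda>z. (\<Sum>i<d. sqrt (\<nu> i) * Y (sqrt (\<nu> i) * t j) (sqrt (\<nu> i) * fst z i, snd z i)) / sqrt (real d))
      \<in> borel_measurable (init_law g \<nu> d)"
    by (intro borel_measurable_divide borel_measurable_sum borel_measurable_times borel_measurable_const
        Y_measurable borel_measurable_Pair init_law_components) auto
  then show "(\<lambda>z. Dvec dg a ad \<nu> d n t z j) \<in> borel_measurable (init_law g \<nu> d)"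
    unfolding Dvec_def Dd_eq[OF assms] by (cases "j < n") auto
qed

text \<open>The contribution of a coordinate with parameter x to the linear combination with
  coefficients u of the D(t_j), before division by sqrt d. It is a function on the space of
  \<open>gibbs\<close>, common to all coordinates.\<close>

definition W :: "nat \<Rightarrow> (nat \<Rightarrow> real) \<Rightarrow> (nat \<Rightarrow> real) \<Rightarrow> real \<Rightarrow> real \<times> real \<Rightarrow> real" where
  "W n t u x z = sqrt x * (\<Sum>j<n. u j * Y (sqrt x * t j) z)"

lemma W_measurable [measurable]: "W n t u x \<in> borel_measurable borel"
  unfolding W_def by measurable

lemma integral_pi_nu_pair:
  fixes f :: "real \<times> real \<Rightarrow> complex"
  assumes \<nu>: "0 < \<nu>" and f [measurable]: "f \<in> borel_measurable borel"
  shows "(\<integral>v. f (sqrt \<nu> * fst v, snd v) \<partial>(density lborel (pi_nu g \<nu>) \<Otimes>\<^sub>M N01)) = (\<integral>z. f z \<partial>gibbs)"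
proof -
  let ?A = "density lborel (pi_nu g \<nu>)"
  interpret N: prob_space N01 by (rule prob_space_N01)
  have id: "distr N01 borel (\<lambda>p. p) = N01"
    by (rule distr_id2) simp
  have "distr ?A borel (\<lambda>x. sqrt \<nu> * x) \<Otimes>\<^sub>M distr N01 borel (\<lambda>p. p) =
      distr (?A \<Otimes>\<^sub>M N01) (borel \<Otimes>\<^sub>M borel) (\<lambda>(x, p). (sqrt \<nu> * x, p))"
    by (rule pair_measure_distr)
      (simp_all add: id measurable_cong_sets[OF N01_sets refl] N.sigma_finite_measure_axioms)
  then have "gibbs = distr (?A \<Otimes>\<^sub>M N01) (borel \<Otimes>\<^sub>M borel) (\<lambda>(x, p). (sqrt \<nu> * x, p))"
    by (simp only: gibbs_pair distr_pi_nu[OF \<nu>] id)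
  then have "(\<integral>z. f z \<partial>gibbs) =
      (\<integral>z. f z \<partial>distr (?A \<Otimes>\<^sub>M N01) (borel \<Otimes>\<^sub>M borel) (\<lambda>(x, p). (sqrt \<nu> * x, p)))"
    by simp
  also have "\<dots> = (\<integral>v. f (sqrt \<nu> * fst v, snd v) \<partial>(?A \<Otimes>\<^sub>M N01))"
    by (subst integral_distr) (auto simp: case_prod_beta' borel_prod)
  finally show ?thesis by simp
qed

lemma char_Dvec:
  assumes \<nu>: "\<And>i. 0 < \<nu> i"
  shows "(\<integral>x. cis (\<Sum>j<n. u j * x j) \<partial>distr (init_law g \<nu> d) borel (Dvec dg a ad \<nu> d n t)) =
    (\<Prod>i<d. \<integral>z. cis (W n t u (\<nu> i) z / sqrt (real d)) \<partial>gibbs)"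
proof -
  let ?P = "\<lambda>i. density lborel (pi_nu g (\<nu> i)) \<Otimes>\<^sub>M N01"
  let ?Y = "\<lambda>i j z. Y (sqrt (\<nu> i) * t j) (sqrt (\<nu> i) * fst z i, snd z i)"
  define F where "F i v = cis (W n t u (\<nu> i) (sqrt (\<nu> i) * fst v, snd v) / sqrt (real d))"
    for i and v :: "real \<times> real"
  have F: "F i \<in> borel_measurable (?P i)" for i
  proof -
    have "sets (?P i) = sets (borel \<Otimes>\<^sub>M borel)"
      by (intro sets_pair_measure_cong) auto
    then have eq: "sets (?P i) = sets (borel :: (real \<times> real) measure)"
      by (simp only: borel_prod)
    have "F i \<in> borel_measurable borel" unfolding F_def W_def by measurable
    then show ?thesis using measurable_cong_sets[OF eq refl] by blast
  qed
  have "(\<integral>x. cis (\<Sum>j<n. u j * x j) \<partial>distr (init_law g \<nu> d) borel (Dvec dg a ad \<nu> d n t)) =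
      (\<integral>z. cis (\<Sum>j<n. u j * Dvec dg a ad \<nu> d n t z j) \<partial>init_law g \<nu> d)"
    by (rule integral_distr[OF Dvec_measurable[OF \<nu>]]) measurable
  also have "\<dots> = (\<integral>z. (\<Prod>i<d. F i (fst z i, snd z i)) \<partial>init_law g \<nu> d)"
  proof (intro Bochner_Integration.integral_cong refl)
    fix z :: "(nat \<Rightarrow> real) \<times> (nat \<Rightarrow> real)"
    have "(\<Sum>j<n. u j * Dvec dg a ad \<nu> d n t z j) =
        (\<Sum>j<n. \<Sum>i<d. u j * (sqrt (\<nu> i) * ?Y i j z) / sqrt (real d))"
      by (simp add: Dvec_def Dd_eq[OF \<nu>] sum_distrib_left sum_divide_distrib)
    also have "\<dots> = (\<Sum>i<d. \<Sum>j<n. u j * (sqrt (\<nu> i) * ?Y i j z) / sqrt (real d))"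
      by (rule sum.swap)
    also have "\<dots> = (\<Sum>i<d. W n t u (\<nu> i) (sqrt (\<nu> i) * fst z i, snd z i) / sqrt (real d))"
      by (intro sum.cong refl) (simp add: W_def sum_distrib_left sum_divide_distrib mult_ac)
    finally show "cis (\<Sum>j<n. u j * Dvec dg a ad \<nu> d n t z j) = (\<Prod>i<d. F i (fst z i, snd z i))"
      by (simp add: cis_sum F_def)
  qed
  also have "\<dots> = (\<Prod>i<d. \<integral>v. F i v \<partial>(?P i))"
    unfolding init_law_def
    by (rule integral_pair_PiM_prod) (auto simp: F_def[abs_def] intro: prob_space_pi_nu prob_space_N01 \<nu> F[unfolded F_def])
  also have "\<dots> = (\<Prod>i<d. \<integral>z. cis (W n t u (\<nu> i) z / sqrt (real d)) \<partial>gibbs)"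
  proof (rule prod.cong[OF refl])
    fix i
    have "(\<lambda>z. cis (W n t u (\<nu> i) z / sqrt (real d))) \<in> borel_measurable borel" by measurable
    from integral_pi_nu_pair[OF \<nu> this, of i]
    show "(\<integral>v. F i v \<partial>(?P i)) =
        (\<integral>z. cis (W n t u (\<nu> i) z / sqrt (real d)) \<partial>gibbs)"
      by (simp add: F_def)
  qed
  finally show ?thesis .
qed

definition var_W :: "nat \<Rightarrow> (nat \<Rightarrow> real) \<Rightarrow> (nat \<Rightarrow> real) \<Rightarrow> real \<Rightarrow> real" where
  "var_W n t u x = (\<Sum>k<n. \<Sum>j<n. u k * (x * autocov (sqrt x * (t j - t k))) * u j)"

lemma W_moments:
  assumes x: "0 < x"
  shows "integrable gibbs (W n t u x)" "integrable gibbs (\<lambda>z. (W n t u x z)\<^sup>2)"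
    "(\<integral>z. W n t u x z \<partial>gibbs) = 0" "(\<integral>z. (W n t u x z)\<^sup>2 \<partial>gibbs) = var_W n t u x"
proof -
  show "integrable gibbs (W n t u x)" "(\<integral>z. W n t u x z \<partial>gibbs) = 0"
    unfolding W_def using Y_integrable Y_expectation by auto
  have eq: "(W n t u x z)\<^sup>2 =
      (\<Sum>k<n. \<Sum>j<n. x * u k * u j * (Y (sqrt x * t k) z * Y (sqrt x * t j) z))" for z
    using x unfolding W_def power_mult_distrib power2_eq_square[of "sum _ _"] sum_product
    by (simp add: sum_distrib_left mult_ac)
  show "integrable gibbs (\<lambda>z. (W n t u x z)\<^sup>2)"
    unfolding eq using Y_prod_integrable by auto
  show "(\<integral>z. (W n t u x z)\<^sup>2 \<partial>gibbs) = var_W n t u x"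
    unfolding eq using Y_prod_integrable
    by (simp add: Bochner_Integration.integral_sum Y_prod_expectation var_W_def right_diff_distrib mult_ac)
qed

lemma var_W_bound:
  assumes "0 < x"
  shows "0 \<le> var_W n t u x" "var_W n t u x \<le> x * (\<Sum>k<n. \<Sum>j<n. \<bar>u k\<bar> * autocov 0 * \<bar>u j\<bar>)"
proof -
  show "0 \<le> var_W n t u x" unfolding W_moments(4)[OF assms, symmetric] by simp
  have "var_W n t u x \<le> (\<Sum>k<n. \<Sum>j<n. x * (\<bar>u k\<bar> * autocov 0 * \<bar>u j\<bar>))"
    unfolding var_W_def
  proof (intro sum_mono)
    fix k j
    have "u k * (x * autocov (sqrt x * (t j - t k))) * u j \<le> \<bar>u k * (x * autocov (sqrt x * (t j - t k))) * u j\<bar>"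
      by simp
    also have "\<dots> = x * (\<bar>u k\<bar> * \<bar>autocov (sqrt x * (t j - t k))\<bar> * \<bar>u j\<bar>)"
      using assms by (simp add: abs_mult mult_ac)
    also have "\<dots> \<le> x * (\<bar>u k\<bar> * autocov 0 * \<bar>u j\<bar>)"
      using assms by (intro mult_left_mono mult_right_mono abs_autocov_le) auto
    finally show "u k * (x * autocov (sqrt x * (t j - t k))) * u j \<le> x * (\<bar>u k\<bar> * autocov 0 * \<bar>u j\<bar>)" .
  qed
  then show "var_W n t u x \<le> x * (\<Sum>k<n. \<Sum>j<n. \<bar>u k\<bar> * autocov 0 * \<bar>u j\<bar>)"
    by (simp add: sum_distrib_left)
qed

section \<open>Lindeberg bounds and second-order approximation of the factors\<close>

text \<open>The shape of the error term in \<open>char_approx3'\<close>.\<close>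

definition \<psi> :: "real \<Rightarrow> real \<Rightarrow> real" where
  "\<psi> \<rho> x = min (6 * x\<^sup>2) (\<rho> * \<bar>x\<bar> ^ 3)"

lemma \<psi>_measurable [measurable]: "\<psi> \<rho> \<in> borel_measurable borel"
  unfolding \<psi>_def by measurable

lemma \<psi>_nonneg: "0 \<le> \<rho> \<Longrightarrow> 0 \<le> \<psi> \<rho> x"
  by (simp add: \<psi>_def)

lemma \<psi>_mono:
  assumes "0 \<le> \<rho>" "\<bar>x\<bar> \<le> \<bar>y\<bar>"
  shows "\<psi> \<rho> x \<le> \<psi> \<rho> y"
proof -
  have "x\<^sup>2 \<le> y\<^sup>2" using assms(2) by (simp only: abs_le_square_iff)
  moreover have "\<bar>x\<bar> ^ 3 \<le> \<bar>y\<bar> ^ 3" using assms(2) by (rule power_mono) simp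
  ultimately show ?thesis
    unfolding \<psi>_def using assms(1) by (intro min.mono mult_left_mono) auto
qed

text \<open>\<psi> is not subadditive, but it is monotone in \<bar>x\<bar>, and n times the largest
  \<bar>y j\<bar> dominates the sum; hence the factor n. The bound separates the times, so that
  stationarity applies to each.\<close>

lemma \<psi>_sum:
  assumes \<rho>: "0 \<le> \<rho>"
  shows "\<psi> \<rho> (\<Sum>j<n. y j) \<le> (\<Sum>j<n. \<psi> \<rho> (real n * y j))"
proof (cases "n = 0")
  case True
  then show ?thesis by (simp add: \<psi>_def)
next
  case False
  define A where "A = (\<lambda>i. \<bar>y i\<bar>) ` {..<n}"
  have A: "finite A" "A \<noteq> {}" using False by (auto simp: A_def)
  from Max_in[OF A] obtain j where j1: "j < n" and j2: "Max A = \<bar>y j\<bar>"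
    by (auto simp: A_def)
  have j: "j < n" "\<bar>y i\<bar> \<le> \<bar>y j\<bar>" if "i < n" for i
  proof -
    have "\<bar>y i\<bar> \<in> A" using that by (auto simp: A_def)
    from Max_ge[OF A(1) this] show "\<bar>y i\<bar> \<le> \<bar>y j\<bar>" by (simp only: j2)
  qed (rule j1)
  have "\<bar>\<Sum>j<n. y j\<bar> \<le> (\<Sum>i<n. \<bar>y i\<bar>)" by (rule sum_abs)
  also have "\<dots> \<le> (\<Sum>i<n. \<bar>y j\<bar>)" by (intro sum_mono j) simp
  finally have "\<psi> \<rho> (\<Sum>j<n. y j) \<le> \<psi> \<rho> (real n * y j)"
    by (intro \<psi>_mono \<rho>) (simp add: abs_mult)
  also have "\<dots> \<le> (\<Sum>j<n. \<psi> \<rho> (real n * y j))"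
    using j1 \<rho> by (intro member_le_sum) (auto intro: \<psi>_nonneg)
  finally show ?thesis .
qed

lemma \<psi>_integrable:
  assumes "0 \<le> \<rho>"
  shows "integrable gibbs (\<lambda>z. \<psi> \<rho> (b * Y s z))"
proof (rule Bochner_Integration.integrable_bound)
  show "integrable gibbs (\<lambda>z. 6 * b\<^sup>2 * (Y s z)\<^sup>2)" using Y_square_integrable by simp
  show "AE z in gibbs. norm (\<psi> \<rho> (b * Y s z)) \<le> norm (6 * b\<^sup>2 * (Y s z)\<^sup>2)"
    using \<psi>_nonneg[OF assms] by (intro AE_I2) (simp add: \<psi>_def power_mult_distrib)
qed measurable

definition lindeberg :: "nat \<Rightarrow> (nat \<Rightarrow> real) \<Rightarrow> real \<Rightarrow> real" where
  "lindeberg n u \<rho> = (\<Sum>j<n. \<integral>z. \<psi> \<rho> (real n * u j * Y 0 z) \<partial>gibbs)"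

text \<open>Dominated convergence: the cubic branch of \<psi> gives the pointwise limit and the
  quadratic branch the integrable majorant.\<close>

lemma lindeberg_null: "(\<lambda>m. lindeberg n u (1 / real (Suc m))) \<longlonglongrightarrow> 0"
  unfolding lindeberg_def
proof (rule tendsto_null_sum)
  fix j
  have "(\<lambda>m. \<integral>z. \<psi> (1 / real (Suc m)) (real n * u j * Y 0 z) \<partial>gibbs) \<longlonglongrightarrow> (\<integral>z. 0 \<partial>gibbs)"
  proof (rule integral_dominated_convergence[where w = "\<lambda>z. 6 * (real n * u j)\<^sup>2 * (Y 0 z)\<^sup>2"])
    show "integrable gibbs (\<lambda>z. 6 * (real n * u j)\<^sup>2 * (Y 0 z)\<^sup>2)" using Y_square_integrable by simp
    show "AE z in gibbs. (\<lambda>m. \<psi> (1 / real (Suc m)) (real n * u j * Y 0 z)) \<longlonglongrightarrow> 0"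
    proof (rule AE_I2)
      fix z
      define y where "y = real n * u j * Y 0 z"
      have "(\<lambda>m. min (6 * y\<^sup>2) (1 / real (Suc m) * \<bar>y\<bar> ^ 3)) \<longlonglongrightarrow> min (6 * y\<^sup>2) (0 * \<bar>y\<bar> ^ 3)"
        by (intro tendsto_min tendsto_mult tendsto_const LIMSEQ_inverse_real_of_nat[unfolded inverse_eq_divide])
      then show "(\<lambda>m. \<psi> (1 / real (Suc m)) (real n * u j * Y 0 z)) \<longlonglongrightarrow> 0"
        by (simp add: \<psi>_def y_def[symmetric])
    qed
    show "AE z in gibbs. norm (\<psi> (1 / real (Suc m)) (real n * u j * Y 0 z))
        \<le> 6 * (real n * u j)\<^sup>2 * (Y 0 z)\<^sup>2" for m
      using \<psi>_nonneg[of "1 / real (Suc m)"]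
      by (intro AE_I2) (simp add: \<psi>_def power_mult_distrib del: of_nat_Suc)
  qed measurable
  then show "(\<lambda>m. \<integral>z. \<psi> (1 / real (Suc m)) (real n * u j * Y 0 z) \<partial>gibbs) \<longlonglongrightarrow> 0" by simp
qed

text \<open>Stationarity makes the Lindeberg bound uniform in the times sqrt x * t j.\<close>

lemma W_lindeberg:
  assumes x: "0 < x" and \<theta>: "0 \<le> \<theta>" "sqrt x * \<theta> \<le> \<rho>"
  shows "(\<integral>z. min (6 * (W n t u x z)\<^sup>2) (\<theta> * \<bar>W n t u x z\<bar> ^ 3) \<partial>gibbs) \<le> x * lindeberg n u \<rho>"
proof -
  have \<rho>: "0 \<le> \<rho>" using x \<theta> by (intro order.trans[OF _ \<theta>(2)]) simp
  have le: "min (6 * (W n t u x z)\<^sup>2) (\<theta> * \<bar>W n t u x z\<bar> ^ 3) \<le>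
      (\<Sum>j<n. x * \<psi> \<rho> (real n * u j * Y (sqrt x * t j) z))" for z
  proof -
    define w where "w = (\<Sum>j<n. u j * Y (sqrt x * t j) z)"
    have Ww: "W n t u x z = sqrt x * w" by (simp add: W_def w_def)
    have 1: "6 * (sqrt x * w)\<^sup>2 = x * (6 * w\<^sup>2)" using x by (simp add: power_mult_distrib)
    \<comment> \<open>Of the three factors sqrt x, two form the x that is pulled out and the third
      joins \<theta>, which is the product bounded by \<rho>.\<close>
    have "\<theta> * \<bar>sqrt x * w\<bar> ^ 3 = x * (sqrt x * \<theta> * \<bar>w\<bar> ^ 3)"
    proof -
      have "sqrt x ^ 3 = x * sqrt x" using x by (simp add: power3_eq_cube)
      then show ?thesis using x by (simp add: abs_mult power_mult_distrib mult_ac)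
    qed
    also have "\<dots> \<le> x * (\<rho> * \<bar>w\<bar> ^ 3)"
      using x \<theta> by (intro mult_left_mono mult_right_mono) auto
    finally have "min (6 * (W n t u x z)\<^sup>2) (\<theta> * \<bar>W n t u x z\<bar> ^ 3) \<le>
        min (x * (6 * w\<^sup>2)) (x * (\<rho> * \<bar>w\<bar> ^ 3))"
      unfolding Ww 1 by (intro min.mono) auto
    also have "\<dots> = x * \<psi> \<rho> w"
      using x by (simp add: \<psi>_def min_mult_distrib_left)
    also have "\<dots> \<le> x * (\<Sum>j<n. \<psi> \<rho> (real n * (u j * Y (sqrt x * t j) z)))"
      unfolding w_def using x by (intro mult_left_mono \<psi>_sum \<rho>) auto
    finally show ?thesis by (simp add: sum_distrib_left mult.assoc)
  qed
  have shift: "(\<integral>z. \<psi> \<rho> (b * Y s z) \<partial>gibbs) = (\<integral>z. \<psi> \<rho> (b * Y 0 z) \<partial>gibbs)" for b s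
    using integral_gibbs_flow[of "\<lambda>z. \<psi> \<rho> (b * Y 0 z)" s] by (simp add: Y0_flow)
  have "(\<integral>z. min (6 * (W n t u x z)\<^sup>2) (\<theta> * \<bar>W n t u x z\<bar> ^ 3) \<partial>gibbs) \<le>
      (\<integral>z. (\<Sum>j<n. x * \<psi> \<rho> (real n * u j * Y (sqrt x * t j) z)) \<partial>gibbs)"
  proof (rule integral_mono[OF _ _ le])
    show "integrable gibbs (\<lambda>z. min (6 * (W n t u x z)\<^sup>2) (\<theta> * \<bar>W n t u x z\<bar> ^ 3))"
    proof (rule Bochner_Integration.integrable_bound)
      show "integrable gibbs (\<lambda>z. 6 * (W n t u x z)\<^sup>2)" using W_moments(2)[OF x] by simp
      show "AE z in gibbs. norm (min (6 * (W n t u x z)\<^sup>2) (\<theta> * \<bar>W n t u x z\<bar> ^ 3)) \<le> norm (6 * (W n t u x z)\<^sup>2)"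
        using \<theta>(1) by (intro AE_I2) (simp add: min_def)
    qed measurable
    show "integrable gibbs (\<lambda>z. \<Sum>j<n. x * \<psi> \<rho> (real n * u j * Y (sqrt x * t j) z))"
      using \<psi>_integrable[OF \<rho>] by simp
  qed
  also have "\<dots> = (\<Sum>j<n. x * (\<integral>z. \<psi> \<rho> (real n * u j * Y (sqrt x * t j) z) \<partial>gibbs))"
    using \<psi>_integrable[OF \<rho>] by simp
  also have "\<dots> = x * lindeberg n u \<rho>"
    unfolding lindeberg_def sum_distrib_left by (intro sum.cong refl arg_cong2[of _ _ _ _ "(*)"] shift)
  finally show ?thesis .
qed

text \<open>The characteristic function at 1 / sqrt d is expanded to 1 - y, which is then replaced
  by exp (- y). The condition x \<le> \<rho>^2 * d gives both the hypothesis of the Lindeberg bound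
  and x / d \<le> \<rho>^2 in the error y^2. Both errors keep a factor x / d, so they can be summed
  over the coordinates.\<close>

lemma char_W_approx:
  assumes x: "0 < x" and d: "0 < d" and \<rho>: "0 \<le> \<rho>" "x \<le> \<rho>\<^sup>2 * real d"
    and B: "B = (\<Sum>k<n. \<Sum>j<n. \<bar>u k\<bar> * autocov 0 * \<bar>u j\<bar>)"
  shows "cmod ((\<integral>z. cis (W n t u x z / sqrt (real d)) \<partial>gibbs) - of_real (exp (- (var_W n t u x / (2 * real d)))))
    \<le> (lindeberg n u \<rho> / 6 + B\<^sup>2 * \<rho>\<^sup>2 / 4) * (x / real d)"
proof -
  define v where "v = var_W n t u x"
  define \<theta> where "\<theta> = 1 / sqrt (real d)"
  have \<theta>: "0 \<le> \<theta>" "\<theta>\<^sup>2 = 1 / real d" using d by (auto simp: \<theta>_def power_divide)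
  have v: "0 \<le> v" "v \<le> x * B" using var_W_bound[OF x] by (auto simp: v_def B)
  have char: "char (distr gibbs borel (W n t u x)) \<theta> = (\<integral>z. cis (W n t u x z / sqrt (real d)) \<partial>gibbs)"
    unfolding char_def by (subst integral_distr) (auto simp: cis_conv_exp \<theta>_def)
  have "cmod (char (distr gibbs borel (W n t u x)) \<theta> - (1 - \<theta>\<^sup>2 * v / 2)) \<le>
      \<theta>\<^sup>2 / 6 * (\<integral>z. min (6 * (W n t u x z)\<^sup>2) (\<bar>\<theta>\<bar> * \<bar>W n t u x z\<bar> ^ 3) \<partial>gibbs)"
    by (rule G.char_approx3'[OF _ W_moments(1)[OF x] W_moments(2)[OF x] W_moments(3)[OF x] _ refl])
      (simp_all add: W_moments[OF x] v_def)
  also have "\<dots> \<le> \<theta>\<^sup>2 / 6 * (x * lindeberg n u \<rho>)"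
  proof (rule mult_left_mono)
    have "sqrt x \<le> \<rho> * sqrt (real d)"
      using \<rho> by (intro real_le_lsqrt) (auto simp: power_mult_distrib)
    then have "sqrt x * \<theta> \<le> \<rho>" using d by (simp add: \<theta>_def divide_le_eq)
    then show "(\<integral>z. min (6 * (W n t u x z)\<^sup>2) (\<bar>\<theta>\<bar> * \<bar>W n t u x z\<bar> ^ 3) \<partial>gibbs) \<le> x * lindeberg n u \<rho>"
      using W_lindeberg[OF x \<theta>(1)] \<theta>(1) by simp
  qed simp
  finally have 1: "cmod ((\<integral>z. cis (W n t u x z / sqrt (real d)) \<partial>gibbs) - (1 - of_real (v / (2 * real d)))) \<le>
      lindeberg n u \<rho> / 6 * (x / real d)"
    unfolding char \<theta>(2) by (simp add: mult_ac)
  define y where "y = v / (2 * real d)"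
  have y: "0 \<le> y" using v by (simp add: y_def)
  have "(1 - of_real y) - of_real (exp (- y)) = (of_real (1 - y - exp (- y)) :: complex)" by simp
  then have "cmod ((1 - of_real y) - of_real (exp (- y))) = \<bar>1 - y - exp (- y)\<bar>"
    by (simp only: norm_of_real)
  also have "\<dots> \<le> y\<^sup>2" by (rule abs_one_minus_exp_le[OF y])
  also have "\<dots> \<le> (x * B / (2 * real d))\<^sup>2"
    unfolding y_def using v by (intro power_mono divide_right_mono) auto
  also have "\<dots> = B\<^sup>2 * (x / real d) / 4 * (x / real d)"
    by (simp add: power2_eq_square mult_ac)
  also have "\<dots> \<le> B\<^sup>2 * \<rho>\<^sup>2 / 4 * (x / real d)"
  proof (intro mult_right_mono divide_right_mono mult_left_mono)
    show "x / real d \<le> \<rho>\<^sup>2" using \<rho>(2) d by (simp add: divide_le_eq)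
  qed (use x in auto)
  finally have 2: "cmod ((1 - of_real y) - of_real (exp (- y))) \<le> B\<^sup>2 * \<rho>\<^sup>2 / 4 * (x / real d)" .
  have "cmod ((\<integral>z. cis (W n t u x z / sqrt (real d)) \<partial>gibbs) - of_real (exp (- y))) \<le>
      lindeberg n u \<rho> / 6 * (x / real d) + B\<^sup>2 * \<rho>\<^sup>2 / 4 * (x / real d)"
    using norm_triangle_mono[OF 1[folded y_def] 2] by simp
  then show ?thesis by (simp only: y_def v_def distrib_right)
qed

text \<open>All factors have modulus at most 1, so the distance of the products is at most the sum
  of the distances of the factors, hence a small multiple of the mean of \<nu>. Once \<rho> is
  fixed, \<open>mean_converges_max\<close> provides \<nu> i \<le> \<rho>^2 * d for all i <
  d.\<close>

theorem char_limit:
  assumes \<nu>: "\<And>i. 0 < \<nu> i"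
    and mean: "(\<lambda>d. (\<Sum>i<d. \<nu> i) / real d) \<longlonglongrightarrow> m"
    and cov: "\<And>s. (\<lambda>d. (\<Sum>i<d. \<nu> i * autocov (sqrt (\<nu> i) * s)) / real d) \<longlonglongrightarrow> V s"
  shows "0 \<le> (\<Sum>k<n. \<Sum>j<n. u k * V (t j - t k) * u j)"
    and "(\<lambda>d. \<Prod>i<d. \<integral>z. cis (W n t u (\<nu> i) z / sqrt (real d)) \<partial>gibbs)
      \<longlonglongrightarrow> of_real (exp (- (\<Sum>k<n. \<Sum>j<n. u k * V (t j - t k) * u j) / 2))"
proof -
  define \<sigma> where "\<sigma> = (\<Sum>k<n. \<Sum>j<n. u k * V (t j - t k) * u j)"
  define v where "v i = var_W n t u (\<nu> i)" for i
  have v_lim: "(\<lambda>d. (\<Sum>i<d. v i) / real d) \<longlonglongrightarrow> \<sigma>"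
  proof -
    have "(\<Sum>i<d. v i) / real d =
        (\<Sum>k<n. \<Sum>j<n. u k * ((\<Sum>i<d. \<nu> i * autocov (sqrt (\<nu> i) * (t j - t k))) / real d) * u j)" for d
    proof -
      have "(\<Sum>i<d. v i) = (\<Sum>k<n. \<Sum>i<d. \<Sum>j<n. u k * (\<nu> i * autocov (sqrt (\<nu> i) * (t j - t k))) * u j)"
        unfolding v_def var_W_def by (rule sum.swap)
      also have "\<dots> = (\<Sum>k<n. \<Sum>j<n. \<Sum>i<d. u k * (\<nu> i * autocov (sqrt (\<nu> i) * (t j - t k))) * u j)"
        by (rule sum.cong[OF refl]) (rule sum.swap)
      finally show ?thesis
        by (simp add: sum_divide_distrib sum_distrib_left sum_distrib_right)
    qed
    then show ?thesis unfolding \<sigma>_def by (simp only:) (intro tendsto_intros cov)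
  qed
  have v0: "0 \<le> v i" for i unfolding v_def by (rule var_W_bound(1)[OF \<nu>])
  have "0 \<le> \<sigma>"
    by (rule LIMSEQ_le_const[OF v_lim]) (auto intro!: exI[of _ 0] divide_nonneg_nonneg sum_nonneg v0)
  then show "0 \<le> (\<Sum>k<n. \<Sum>j<n. u k * V (t j - t k) * u j)" by (simp add: \<sigma>_def)
  define B where "B = (\<Sum>k<n. \<Sum>j<n. \<bar>u k\<bar> * autocov 0 * \<bar>u j\<bar>)"
  define \<phi> where "\<phi> i d = (\<integral>z. cis (W n t u (\<nu> i) z / sqrt (real d)) \<partial>gibbs)" for i d
  define \<xi> where "\<xi> i d = complex_of_real (exp (- (v i / (2 * real d))))" for i d
  have \<xi>_lim: "(\<lambda>d. \<Prod>i<d. \<xi> i d) \<longlonglongrightarrow> of_real (exp (- \<sigma> / 2))"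
  proof -
    have "(\<Prod>i<d. \<xi> i d) = of_real (exp (- ((\<Sum>i<d. v i) / real d) / 2))" for d
    proof -
      have "(\<Sum>i<d. - (v i / (2 * real d))) = - ((\<Sum>i<d. v i) / real d) / 2"
        by (simp add: sum_negf sum_divide_distrib mult.commute)
      then show ?thesis unfolding \<xi>_def of_real_prod[symmetric] by (simp add: exp_sum[symmetric])
    qed
    then show ?thesis by (simp only:) (intro tendsto_intros v_lim, simp)
  qed
  have m: "0 \<le> m"
    by (rule LIMSEQ_le_const[OF mean])
      (auto intro!: exI[of _ 0] divide_nonneg_nonneg sum_nonneg less_imp_le[OF \<nu>])
  have "(\<lambda>d. (\<Prod>i<d. \<phi> i d) - (\<Prod>i<d. \<xi> i d)) \<longlonglongrightarrow> 0"
  proof (rule tendstoI)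
    fix e :: real assume e: "0 < e"
    \<comment> \<open>The averages of \<nu> are eventually below m + 1.\<close>
    define e' where "e' = e / (m + 1)"
    have e': "0 < e'" using e m by (simp add: e'_def)
    have "(\<lambda>k. lindeberg n u (1 / real (Suc k)) / 6 + B\<^sup>2 * (1 / real (Suc k))\<^sup>2 / 4) \<longlonglongrightarrow> 0 / 6 + B\<^sup>2 * 0\<^sup>2 / 4"
      by (intro tendsto_intros lindeberg_null LIMSEQ_inverse_real_of_nat[unfolded inverse_eq_divide]) auto
    then have "\<forall>\<^sub>F k in sequentially. lindeberg n u (1 / real (Suc k)) / 6 + B\<^sup>2 * (1 / real (Suc k))\<^sup>2 / 4 < e'"
      using e' by (intro order_tendstoD(2)) auto
    then obtain k where k: "lindeberg n u (1 / real (Suc k)) / 6 + B\<^sup>2 * (1 / real (Suc k))\<^sup>2 / 4 < e'"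
      unfolding eventually_sequentially by blast
    define \<rho> where "\<rho> = 1 / real (Suc k)"
    have \<rho>: "0 < \<rho>" by (simp add: \<rho>_def)
    have "\<forall>\<^sub>F d in sequentially. \<forall>i<d. \<nu> i \<le> \<rho>\<^sup>2 * real d"
      using \<rho> by (intro mean_converges_max[OF less_imp_le[OF \<nu>] mean]) auto
    moreover have "\<forall>\<^sub>F d in sequentially. (\<Sum>i<d. \<nu> i) / real d < m + 1"
      by (rule order_tendstoD(2)[OF mean]) simp
    ultimately show "\<forall>\<^sub>F d in sequentially. dist ((\<Prod>i<d. \<phi> i d) - (\<Prod>i<d. \<xi> i d)) 0 < e"
    proof eventually_elim
      case (elim d)
      have "cmod ((\<Prod>i<d. \<phi> i d) - (\<Prod>i<d. \<xi> i d)) \<le> (\<Sum>i<d. cmod (\<phi> i d - \<xi> i d))"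
      proof (rule norm_prod_diff)
        show "cmod (\<xi> i d) \<le> 1" for i using v0[of i] by (simp add: \<xi>_def)
        show "cmod (\<phi> i d) \<le> 1" for i
        proof -
          have "cmod (\<phi> i d) \<le> (\<integral>z. cmod (cis (W n t u (\<nu> i) z / sqrt (real d))) \<partial>gibbs)"
            unfolding \<phi>_def by (rule integral_norm_bound)
          then show ?thesis using G.prob_space by simp
        qed
      qed
      also have "\<dots> \<le> (\<Sum>i<d. e' * (\<nu> i / real d))"
      proof (rule sum_mono)
        fix i assume "i \<in> {..<d}"
        then have i: "i < d" by simp
        have "cmod (\<phi> i d - \<xi> i d) \<le> (lindeberg n u \<rho> / 6 + B\<^sup>2 * \<rho>\<^sup>2 / 4) * (\<nu> i / real d)"
          unfolding \<phi>_def \<xi>_def v_def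
          using elim(1) i \<rho> by (intro char_W_approx \<nu>) (auto simp: B_def)
        also have "\<dots> \<le> e' * (\<nu> i / real d)"
          using k \<nu>[of i] by (intro mult_right_mono) (auto simp: \<rho>_def)
        finally show "cmod (\<phi> i d - \<xi> i d) \<le> e' * (\<nu> i / real d)" .
      qed
      also have "\<dots> = e' * ((\<Sum>i<d. \<nu> i) / real d)"
        by (simp add: sum_distrib_left sum_divide_distrib)
      also have "\<dots> < e' * (m + 1)" using elim(2) e' by (rule mult_strict_left_mono)
      also have "\<dots> = e" using m by (simp add: e'_def)
      finally show ?case by (simp add: dist_norm)
    qed
  qed
  from tendsto_add[OF this \<xi>_lim]
  show "(\<lambda>d. \<Prod>i<d. \<integral>z. cis (W n t u (\<nu> i) z / sqrt (real d)) \<partial>gibbs)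
      \<longlonglongrightarrow> of_real (exp (- (\<Sum>k<n. \<Sum>j<n. u k * V (t j - t k) * u j) / 2))"
    by (simp add: \<phi>_def \<sigma>_def)
qed

theorem fdd_convergence:
  assumes \<nu>: "\<And>i. 0 < \<nu> i"
    and mean: "(\<lambda>d. (\<Sum>i<d. \<nu> i) / real d) \<longlonglongrightarrow> m"
    and cov: "\<And>s. (\<lambda>d. (\<Sum>i<d. \<nu> i * autocov (sqrt (\<nu> i) * s)) / real d) \<longlonglongrightarrow> V s"
  shows "\<exists>N. centred_gaussian n (\<lambda>i j. V (t j - t i)) N \<and>
    conv_in_distr (\<lambda>d. distr (init_law g \<nu> d) borel (Dvec dg a ad \<nu> d n t)) N"
proof -
  let ?D = "\<lambda>d. distr (init_law g \<nu> d) borel (Dvec dg a ad \<nu> d n t)"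
  have V_sym: "V (- s) = V s" for s
    using cov[of "- s"] cov[of s] by (auto simp: autocov_minus intro: LIMSEQ_unique)
  obtain N where N: "centred_gaussian n (\<lambda>i j. V (t j - t i)) N"
  proof (rule centred_gaussian_exists[of n "\<lambda>i j. V (t j - t i)"])
    show "V (t j - t i) = V (t i - t j)" for i j using V_sym[of "t i - t j"] by simp
    show "0 \<le> (\<Sum>i<n. \<Sum>j<n. u i * V (t j - t i) * u j)" for u
      by (rule char_limit(1)[OF \<nu> mean cov])
  qed (rule that)
  have "conv_in_distr ?D N"
  proof (rule multidim_levy_continuity[where n = n])
    fix d
    interpret I: prob_space "init_law g \<nu> d" by (rule prob_space_init_law[OF \<nu>])
    show "prob_space (?D d)"
      by (rule I.prob_space_distr[OF Dvec_measurable[OF \<nu>]])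
    show "AE x in ?D d. \<forall>i\<ge>n. x i = 0"
    \<comment> \<open>The condition ranges over infinitely many coordinates; its measurability comes
      from closedness, as an intersection of coordinate hyperplanes.\<close>
    proof (subst AE_distr_iff[OF Dvec_measurable[OF \<nu>]])
      have "{x :: nat \<Rightarrow> real. \<forall>i\<ge>n. x i = 0} = (\<Inter>i\<in>{n..}. (\<lambda>x. x i) -` {0})" by auto
      moreover have "closed ((\<lambda>x :: nat \<Rightarrow> real. x i) -` {0})" for i
        by (rule closed_vimage[OF closed_singleton continuous_on_product_coordinates])
      ultimately show "{x \<in> space borel. \<forall>i\<ge>n. x i = (0 :: real)} \<in> sets borel"
        by (auto intro!: borel_closed closed_INT)
    qed (simp add: Dvec_def)
  next
    fix u :: "nat \<Rightarrow> real"
    show "(\<lambda>d. \<integral>x. cis (\<Sum>j<n. u j * x j) \<partial>?D d)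
        \<longlonglongrightarrow> (\<integral>x. cis (\<Sum>j<n. u j * x j) \<partial>N)"
      using N char_limit(2)[OF \<nu> mean cov, of n t u]
      by (simp add: char_Dvec[OF \<nu>] centred_gaussian_def)
  qed (use N in \<open>auto simp: centred_gaussian_def\<close>)
  with N show ?thesis by blast
qed

end

section \<open>The result for almost every realisation of the parameters\<close>

theorem theorem1:
  fixes g dg :: "real \<Rightarrow> real"
    and a ad :: "real \<Rightarrow> real \<Rightarrow> real \<Rightarrow> real"
    and \<mu> :: "real measure"
    and \<delta> :: real
  assumes g_deriv: "\<And>y. (g has_real_derivative dg y) (at y)"
    and dg_cont: "continuous_on UNIV dg"
    and g_norm: "has_bochner_integral lborel (\<lambda>y. exp (- g y)) 1"
    and \<delta>_pos: "\<delta> > 0"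
    and g_moment: "integrable lborel (\<lambda>y. \<bar>dg y\<bar> powr (2 + \<delta>) * exp (- g y))"
    and a_solves: "\<And>t y0 y0'. ((\<lambda>s. a s y0 y0') has_real_derivative ad t y0 y0') (at t)"
    and ad_solves: "\<And>t y0 y0'. ((\<lambda>s. ad s y0 y0') has_real_derivative - dg (a t y0 y0')) (at t)"
    and a_init: "\<And>y0 y0'. a 0 y0 y0' = y0 \<and> ad 0 y0 y0' = y0'"
    and a_unique: "\<And>y0 y0' (y :: real \<Rightarrow> real) y'.
        (\<forall>t. (y has_real_derivative y' t) (at t) \<and> (y' has_real_derivative - dg (y t)) (at t))
        \<Longrightarrow> y 0 = y0 \<Longrightarrow> y' 0 = y0' \<Longrightarrow> y = (\<lambda>t. a t y0 y0')"
    and \<mu>_prob: "prob_space \<mu>"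
    and \<mu>_sets: "sets \<mu> = sets borel"
    and \<mu>_pos: "AE \<nu> in \<mu>. \<nu> > 0"
    and \<mu>_moment: "integrable \<mu> (\<lambda>\<nu>. \<nu> powr (1 + \<delta> / 2))"
    and V_posdef: "\<And>n (t :: nat \<Rightarrow> real) (c :: nat \<Rightarrow> real).
        (\<forall>i<n. \<forall>j<n. i \<noteq> j \<longrightarrow> t i \<noteq> t j) \<Longrightarrow> (\<exists>i<n. c i \<noteq> 0) \<Longrightarrow>
        (\<Sum>i<n. \<Sum>j<n. c i * c j * Vfun g dg a ad \<mu> (t j - t i)) > 0"
  shows "AE \<nu> in (\<Pi>\<^sub>M i\<in>(UNIV :: nat set). \<mu>).
           \<forall>n \<ge> 1. \<forall>t :: nat \<Rightarrow> real.
             \<exists>N. centred_gaussian n (\<lambda>i j. Vfun g dg a ad \<mu> (t j - t i)) N \<and>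
                 conv_in_distr (\<lambda>d. distr (init_law g \<nu> d) borel (Dvec dg a ad \<nu> d n t)) N"
proof -
  interpret H: hamiltonian_flow g dg a ad
  proof
    fix y y' :: "real \<Rightarrow> real" and t
    assume "\<And>t. (y has_real_derivative y' t) (at t)" "\<And>t. (y' has_real_derivative - dg (y t)) (at t)"
    then show "y t = a t (y 0) (y' 0)" using a_unique[of y y' "y 0" "y' 0"] by metis
  qed (use g_deriv dg_cont a_solves ad_solves a_init in auto)
  interpret gibbs_flow g dg a ad
  proof
    show "integrable lborel (\<lambda>y. (dg y)\<^sup>2 * exp (- g y))"
    proof (rule Bochner_Integration.integrable_bound)
      show "integrable lborel (\<lambda>y. exp (- g y) + \<bar>dg y\<bar> powr (2 + \<delta>) * exp (- g y))"
        using g_norm g_moment by (auto simp: has_bochner_integral_iff)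
      show "AE y in lborel. norm ((dg y)\<^sup>2 * exp (- g y)) \<le>
          norm (exp (- g y) + \<bar>dg y\<bar> powr (2 + \<delta>) * exp (- g y))"
      proof (rule AE_I2)
        fix y
        have "(dg y)\<^sup>2 \<le> 1 + \<bar>dg y\<bar> powr (2 + \<delta>)"
        proof (cases "\<bar>dg y\<bar> \<le> 1")
          case True
          then have "(dg y)\<^sup>2 \<le> 1" by (simp add: abs_square_le_1)
          then show ?thesis by (simp add: add_increasing2)
        next
          case False
          then have "(dg y)\<^sup>2 = \<bar>dg y\<bar> powr 2" by simp
          also have "\<dots> \<le> \<bar>dg y\<bar> powr (2 + \<delta>)" using False \<delta>_pos by (intro powr_mono) auto
          finally show ?thesis by simp
        qed
        then have "(dg y)\<^sup>2 * exp (- g y) \<le> (1 + \<bar>dg y\<bar> powr (2 + \<delta>)) * exp (- g y)"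
          by (rule mult_right_mono) simp
        then show "norm ((dg y)\<^sup>2 * exp (- g y)) \<le>
            norm (exp (- g y) + \<bar>dg y\<bar> powr (2 + \<delta>) * exp (- g y))"
          by (simp add: distrib_right)
      qed
    qed measurable
  qed (rule g_norm)
  interpret \<mu>: prob_space \<mu> by (rule \<mu>_prob)
  note [measurable_cong] = \<mu>_sets
  have p: "1 < 1 + \<delta> / 2" using \<delta>_pos by simp
  have int: "integrable \<mu> (\<lambda>x. x)"
  proof (rule Bochner_Integration.integrable_bound)
    show "integrable \<mu> (\<lambda>x. 1 + x powr (1 + \<delta> / 2))" using \<mu>_moment by simp
    show "AE x in \<mu>. norm x \<le> norm (1 + x powr (1 + \<delta> / 2))"
      using \<mu>_pos
    proof eventually_elim
      case (elim x)
      have "x \<le> 1 + x powr (1 + \<delta> / 2)"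
      proof (cases "x \<le> 1")
        case True
        then show ?thesis by (simp add: add_increasing2)
      next
        case False
        then have "x powr 1 \<le> x powr (1 + \<delta> / 2)" using \<delta>_pos by (intro powr_mono) auto
        with elim show ?thesis by simp
      qed
      with elim show ?case by simp
    qed
  qed measurable
  define V where "V s = (\<integral>x. x * autocov (sqrt x * s) \<partial>\<mu>)" for s
  have V: "Vfun g dg a ad \<mu> s = V s" for s
    unfolding V_def by (rule Vfun_eq[OF \<mu>_prob \<mu>_sets int])
  define P where "P = (\<Pi>\<^sub>M i\<in>(UNIV :: nat set). \<mu>)"
  note slln = slln_dominated[OF \<mu>_prob \<mu>_sets \<mu>_pos p \<mu>_moment, folded P_def]
  have AE_pos: "AE \<nu> in P. \<forall>i. 0 < \<nu> i"
    unfolding AE_all_countable P_def using \<mu>_pos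
    by (intro allI AE_PiM_component) (auto simp: \<mu>_prob)
  \<comment> \<open>\<open>max 0\<close> makes the test function nonnegative on all of R, as
    \<open>slln_dominated\<close> requires; on the almost sure event that all \<nu> i are positive
    it disappears.\<close>
  have AE_mean: "AE \<nu> in P. (\<lambda>d. (\<Sum>i<d. max 0 (\<nu> i)) / real d) \<longlonglongrightarrow> (\<integral>x. max 0 x \<partial>\<mu>)"
    by (rule slln[of "\<lambda>x. max 0 x" 1]) auto
  have AE_tail: "AE \<nu> in P. \<forall>K :: nat. (\<lambda>d. (\<Sum>i<d. if real K < \<nu> i then \<nu> i else 0) / real d)
      \<longlonglongrightarrow> (\<integral>x. (if real K < x then x else 0) \<partial>\<mu>)"
    unfolding AE_all_countable
    by (intro allI slln[of _ 1]) auto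
  \<comment> \<open>\<open>autocov\<close> may be negative, so its bound \<open>autocov 0\<close> is
    added before the law of large numbers is applied and subtracted again afterwards with the help
    of the plain means.\<close>
  have AE_rat: "AE \<nu> in P. \<forall>q\<in>\<rat>. (\<lambda>d. (\<Sum>i<d. max 0 (\<nu> i) * (autocov (sqrt (\<nu> i) * q) + autocov 0)) / real d)
      \<longlonglongrightarrow> (\<integral>x. max 0 x * (autocov (sqrt x * q) + autocov 0) \<partial>\<mu>)"
  proof (rule AE_ball_countable'[OF _ countable_rat])
    fix q :: real
    show "AE \<nu> in P. (\<lambda>d. (\<Sum>i<d. max 0 (\<nu> i) * (autocov (sqrt (\<nu> i) * q) + autocov 0)) / real d)
      \<longlonglongrightarrow> (\<integral>x. max 0 x * (autocov (sqrt x * q) + autocov 0) \<partial>\<mu>)"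
    proof (rule slln[of "\<lambda>x. max 0 x * (autocov (sqrt x * q) + autocov 0)" "2 * autocov 0"])
      show "0 \<le> max 0 x * (autocov (sqrt x * q) + autocov 0)" for x
        using abs_autocov_le[of "sqrt x * q"] by (intro mult_nonneg_nonneg) auto
      show "max 0 x * (autocov (sqrt x * q) + autocov 0) \<le> 2 * autocov 0 * max 0 x" for x
      proof -
        have "max 0 x * (autocov (sqrt x * q) + autocov 0) \<le> max 0 x * (2 * autocov 0)"
          using abs_autocov_le[of "sqrt x * q"] by (intro mult_left_mono) auto
        then show ?thesis by (simp add: mult.commute)
      qed
    qed measurable
  qed
  have "AE \<nu> in P. \<forall>n \<ge> 1. \<forall>t :: nat \<Rightarrow> real.
      \<exists>N. centred_gaussian n (\<lambda>i j. V (t j - t i)) N \<and>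
          conv_in_distr (\<lambda>d. distr (init_law g \<nu> d) borel (Dvec dg a ad \<nu> d n t)) N"
    using AE_pos AE_mean AE_tail AE_rat
  proof eventually_elim
    case (elim \<nu>)
    have pos: "0 < \<nu> i" for i using elim(1) by blast
    have max: "max 0 (\<nu> i) = \<nu> i" for i using pos[of i] by simp
    have "(\<integral>x. max 0 x \<partial>\<mu>) = (\<integral>x. x \<partial>\<mu>)"
      using \<mu>_pos by (intro integral_cong_AE) auto
    with elim(2) have mean: "(\<lambda>d. (\<Sum>i<d. \<nu> i) / real d) \<longlonglongrightarrow> (\<integral>x. x \<partial>\<mu>)"
      by (simp add: max)
    have cov: "(\<lambda>d. (\<Sum>i<d. \<nu> i * autocov (sqrt (\<nu> i) * s)) / real d) \<longlonglongrightarrow> V s" for s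
      unfolding V_def
    proof (rule mean_converges_all_times[OF autocov_continuous abs_autocov_le pos \<mu>_sets \<mu>_pos int _ mean elim(3)[rule_format]])
      fix q :: real assume q: "q \<in> \<rat>"
      have h_int: "integrable \<mu> (\<lambda>x. x * autocov (sqrt x * q))"
      proof (rule Bochner_Integration.integrable_bound)
        show "integrable \<mu> (\<lambda>x. x * autocov 0)" using int by simp
        show "AE x in \<mu>. norm (x * autocov (sqrt x * q)) \<le> norm (x * autocov 0)"
          using abs_autocov_le autocov_0_nonneg by (intro AE_I2) (simp add: abs_mult mult_left_mono)
      qed measurable
      have "(\<integral>x. max 0 x * (autocov (sqrt x * q) + autocov 0) \<partial>\<mu>) = (\<integral>x. x * autocov (sqrt x * q) + x * autocov 0 \<partial>\<mu>)"
        using \<mu>_pos by (intro integral_cong_AE) (auto simp: distrib_left)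
      also have "\<dots> = (\<integral>x. x * autocov (sqrt x * q) \<partial>\<mu>) + (\<integral>x. x \<partial>\<mu>) * autocov 0"
        using h_int int by simp
      finally have "(\<lambda>d. (\<Sum>i<d. \<nu> i * (autocov (sqrt (\<nu> i) * q) + autocov 0)) / real d)
          \<longlonglongrightarrow> (\<integral>x. x * autocov (sqrt x * q) \<partial>\<mu>) + (\<integral>x. x \<partial>\<mu>) * autocov 0"
        using elim(4)[rule_format, OF q] by (simp add: max)
      from tendsto_diff[OF this tendsto_mult_right[OF mean, of "autocov 0"]]
      have "(\<lambda>d. (\<Sum>i<d. \<nu> i * (autocov (sqrt (\<nu> i) * q) + autocov 0)) / real d - (\<Sum>i<d. \<nu> i) / real d * autocov 0)
          \<longlonglongrightarrow> (\<integral>x. x * autocov (sqrt x * q) \<partial>\<mu>)"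
        by simp
      moreover have "(\<Sum>i<d. \<nu> i * (autocov (sqrt (\<nu> i) * q) + autocov 0)) / real d - (\<Sum>i<d. \<nu> i) / real d * autocov 0 =
          (\<Sum>i<d. \<nu> i * autocov (sqrt (\<nu> i) * q)) / real d" for d
        by (simp add: distrib_left sum.distrib sum_distrib_right add_divide_distrib)
      ultimately show "(\<lambda>d. (\<Sum>i<d. \<nu> i * autocov (sqrt (\<nu> i) * q)) / real d)
          \<longlonglongrightarrow> (\<integral>x. x * autocov (sqrt x * q) \<partial>\<mu>)"
        by simp
    qed
    show ?case by (intro allI impI fdd_convergence[OF pos mean cov])
  qed
  then show ?thesis by (simp only: V P_def)
qed

end
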